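(* Let $n\ge 1$, let $\mathcal{D}$ and $\mathcal{T}$ be two connected skew diagrams of size $n$ with $\mathcal{D}\neq\mathcal{T}$, and let $\delta,\tau\in S_n$. Then the skew Schur functions in noncommuting variables satisfy $$s_{(\delta,\mathcal{D})}=s_{(\tau,\mathcal{T})}$$ if and only if all three of the following conditions hold: (1) $\mathcal{D}$ is a nonsymmetric ribbon (that is, $\mathcal{D}$ is a ribbon and $\mathcal{D}\neq\mathcal{D}^*$); (2) $\mathcal{T}=\mathcal{D}^*$; (3) the bijection $\overline{\tau^{-1}\delta}:[n]\to[n]$, $j\mapsto n+1-\tau^{-1}(\delta(j))$, maps each block of the set partition $[\alpha]$ onto itself, where $\alpha$ is the row-length composition of $\mathcal{D}$.
   Context: **Skew diagrams.** The diagram of a partition $\lambda=(\lambda_1\ge\cdots\ge\lambda_{\ell(\lambda)}>0)$ is the left-justified array of boxes with $\lambda_i$ boxes in row $i$ from the top; $\ell(\lambda)$ is the number of parts. If $\mu\subseteq\lambda$ (i.e. $\ell(\mu)\le\ell(\lambda)$ and $\mu_i\le\lambda_i$ for all $i\le \ell(\mu)$), the skew diagram $\lambda/\mu$ is the array of boxes in $\lambda$ but not in $\mu$ (with $\mu$ placed in the top-left corner of $\lambda$); its size $|\lambda/\mu|$ is its number of boxes. Skew diagrams are regarded as arrays of boxes up to translation. A skew diagram is connected if each pair of adjacent rows overlaps in at least one column (in particular it has no empty rows), and is a ribbon if each pair of adjacent rows overlaps in exactly one column. $\mathcal{D}^*$ denotes the $180^\circ$ rotation of $\mathcal{D}$,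 and $\mathcal{D}$ is symmetric if $\mathcal{D}=\mathcal{D}^*$, nonsymmetric otherwise. The row-length composition of $\mathcal{D}$ is $\alpha=(\alpha_1,\ldots,\alpha_r)$, where $\alpha_i$ is the number of boxes in row $i$ from the top. **Set partitions.** Write $[n]=\{1,\ldots,n\}$. For a composition $\alpha=(\alpha_1,\ldots,\alpha_l)$ of $n$ (a sequence of positive integers with sum $n$), $[\alpha]$ is the set partition of $[n]$ whose blocks are the consecutive intervals $\{1,\ldots,\alpha_1\},\{\alpha_1+1,\ldots,\alpha_1+\alpha_2\},\ldots,\{n-\alpha_l+1,\ldots,n\}$. For $\delta\in S_n$ and a set partition $\pi$ of $[n]$, $\delta\pi$ is the set partition whose blocks are the images under $\delta$ of the blocks of $\pi$. **Symmetric functions in noncommuting variables.** For a set partition $\pi$ of $[n]$, the complete homogeneous symmetric function in noncommuting variables is the formal power series in noncommuting variables $x_1,x_2,\ldots$ over $\mathbb{Q}$ $$h_\pi=\sum_{\varepsilon}\ \sum_{(i_1,\ldots,i_n)}x_{i_{\varepsilon(1)}}\cdots x_{i_{\varepsilon(n)}},$$ where $\varepsilon$ ranges over all permutations in $S_n$ mapping each block of $\pi$ to itself, and $(i_1,\ldots,i_n)$ over all $n$-tuples of positive integers such that $i_j\le i_k$ whenever $j<k$ lie in the same block of $\pi$. The $h_\pi$, $\pi$ a set partition of $[n]$, are a basis of the degree $n$ component $\mathrm{NCSym}^n$ of the algebra of symmetric functions in noncommuting variables. $S_n$ acts linearly on $\mathrm{NCSym}^n$ by $\delta\circ h_\pi=h_{\delta\pi}$.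 For $k\geq 1$, $h_{[k]}$ denotes $h_\pi$ for the one-block set partition $\pi$ of $[k]$; also $h_{[0]}=1$, and $h_{[k]}=0$ for $k<0$ (so any expression $\frac{1}{k!}h_{[k]}$ with $k<0$ is $0$). **Skew Schur functions in noncommuting variables.** For a square matrix $A=(a_{ij})_{1\le i,j\le m}$ with noncommuting entries put $\mathbf{det}(A)=\sum_{\varepsilon\in S_m}\mathrm{sgn}(\varepsilon)\,a_{1\varepsilon(1)}a_{2\varepsilon(2)}\cdots a_{m\varepsilon(m)}$. For a skew diagram $\lambda/\mu$ of size $n$ and $\delta\in S_n$, $$s_{(\delta,\lambda/\mu)}=\delta\circ\mathbf{det}\left(\frac{1}{(\lambda_i-\mu_j-i+j)!}\,h_{[\lambda_i-\mu_j-i+j]}\right)_{1\le i,j\le\ell(\lambda)},$$ with $\mu_j=0$ for $j>\ell(\mu)$. (This depends only on $\lambda/\mu$ up to translation when $\lambda/\mu$ is connected.) *)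

theory Defs
  imports Complex_Main "HOL-Library.FuncSet" "HOL-Library.Disjoint_Sets"
    "HOL-Combinatorics.Permutations"
begin

section \<open>Formal power series in noncommuting variables\<close>

text \<open>A word \<open>[i\<^sub>1, \<dots>, i\<^sub>n]\<close> stands for the monomial \<open>x\<^sub>i\<^sub>1 \<cdots> x\<^sub>i\<^sub>n\<close>.  The letter \<open>0\<close> is
  available in the type but never used: the symmetric functions below only involve the
  variables \<open>x\<^sub>1, x\<^sub>2, \<dots>\<close>.\<close>

typedef ncps = "UNIV :: (nat list \<Rightarrow> rat) set"
  morphisms nc_coeff Abs_ncps ..

lemma nc_coeff_Abs [simp]: "nc_coeff (Abs_ncps f) = f"
  by (simp add: Abs_ncps_inverse)

lemma ncps_eqI: "(\<And>w. nc_coeff f w = nc_coeff g w) \<Longrightarrow> f = g"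
  by (metis ext nc_coeff_inject)

instantiation ncps :: ring_1
begin

definition "0 = Abs_ncps (\<lambda>w. 0)"
definition "1 = Abs_ncps (\<lambda>w. if w = [] then 1 else 0)"
definition "f + g = Abs_ncps (\<lambda>w. nc_coeff f w + nc_coeff g w)"
definition "- f = Abs_ncps (\<lambda>w. - nc_coeff f w)"
definition "f - g = Abs_ncps (\<lambda>w. nc_coeff f w - nc_coeff g w)"
definition "f * g = Abs_ncps (\<lambda>w. \<Sum>k\<le>length w. nc_coeff f (take k w) * nc_coeff g (drop k w))"

lemma nc_coeff_simps [simp]:
  "nc_coeff 0 w = 0"
  "nc_coeff 1 w = (if w = [] then 1 else 0)"
  "nc_coeff (f + g) w = nc_coeff f w + nc_coeff g w"
  "nc_coeff (- f) w = - nc_coeff f w"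
  "nc_coeff (f - g) w = nc_coeff f w - nc_coeff g w"
  by (simp_all add: zero_ncps_def one_ncps_def plus_ncps_def uminus_ncps_def minus_ncps_def)

lemma nc_coeff_mult:
  "nc_coeff (f * g) w = (\<Sum>k\<le>length w. nc_coeff f (take k w) * nc_coeff g (drop k w))"
  by (simp add: times_ncps_def)

instance
proof
  fix f g h :: ncps
  show "f * g * h = f * (g * h)"
  proof (rule ncps_eqI)
    fix w :: "nat list"
    let ?n = "length w"
    let ?t = "\<lambda>j k. nc_coeff f (take j w) * nc_coeff g (take (k - j) (drop j w))
                     * nc_coeff h (drop k w)"
    have "nc_coeff (f * g * h) w = (\<Sum>k\<le>?n. \<Sum>j\<le>k. ?t j k)"
      unfolding nc_coeff_mult sum_distrib_right
      by (intro sum.cong refl) (auto simp: drop_take min_def)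
    also have "\<dots> = (\<Sum>(k, j)\<in>(SIGMA k:{..?n}. {..k}). ?t j k)"
      by (subst sum.Sigma) auto
    also have "\<dots> = (\<Sum>(j, i)\<in>(SIGMA j:{..?n}. {..?n - j}). ?t j (i + j))"
      by (rule sum.reindex_bij_witness
            [where j = "\<lambda>(k, j). (j, k - j)" and i = "\<lambda>(j, i). (i + j, j)"]) auto
    also have "\<dots> = (\<Sum>j\<le>?n. \<Sum>i\<le>?n - j. ?t j (i + j))"
      by (subst sum.Sigma) auto
    also have "\<dots> = nc_coeff (f * (g * h)) w"
      unfolding nc_coeff_mult sum_distrib_left by (simp add: mult.assoc)
    finally show "nc_coeff (f * g * h) w = nc_coeff (f * (g * h)) w" .
  qed
  show "1 * f = f"
  proof (rule ncps_eqI)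
    fix w :: "nat list"
    have "nc_coeff (1 * f) w = (\<Sum>k\<in>{0}. nc_coeff 1 (take k w) * nc_coeff f (drop k w))"
      unfolding nc_coeff_mult by (rule sum.mono_neutral_right) auto
    then show "nc_coeff (1 * f) w = nc_coeff f w" by simp
  qed
  show "f * 1 = f"
  proof (rule ncps_eqI)
    fix w :: "nat list"
    have "nc_coeff (f * 1) w = (\<Sum>k\<in>{length w}. nc_coeff f (take k w) * nc_coeff 1 (drop k w))"
      unfolding nc_coeff_mult by (rule sum.mono_neutral_right) auto
    then show "nc_coeff (f * 1) w = nc_coeff f w" by simp
  qed
  have "nc_coeff (0 :: ncps) [] \<noteq> nc_coeff 1 []" by simp
  then show "(0 :: ncps) \<noteq> 1" by metis
qed (auto intro!: ncps_eqI simp: nc_coeff_mult algebra_simps sum.distrib)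

end

definition nc_scale :: "rat \<Rightarrow> ncps \<Rightarrow> ncps" where
  "nc_scale c f = Abs_ncps (\<lambda>w. c * nc_coeff f w)"

interpretation ncps: vector_space nc_scale
  by unfold_locales (auto intro!: ncps_eqI simp: nc_scale_def algebra_simps)


section \<open>Set partitions and complete homogeneous symmetric functions\<close>

definition set_partitions :: "nat \<Rightarrow> nat set set set" where
  "set_partitions n = {\<pi>. partition_on {1..n} \<pi>}"

definition interval_partition :: "nat list \<Rightarrow> nat set set" where
  "interval_partition \<alpha> =
     (\<lambda>l. {sum_list (take l \<alpha>) + 1 .. sum_list (take (Suc l) \<alpha>)}) ` {..<length \<alpha>}"

definition perm_partition :: "(nat \<Rightarrow> nat) \<Rightarrow> nat set set \<Rightarrow> nat set set" where
  "perm_partition \<delta> \<pi> = (\<lambda>B. \<delta> ` B) ` \<pi>"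

text \<open>The coefficient of a word \<open>w\<close> in \<open>h\<^sub>\<pi>\<close> counts the pairs \<open>(\<epsilon>, i)\<close> of the defining double
  sum that contribute the monomial \<open>w\<close>.\<close>

definition h_partition :: "nat \<Rightarrow> nat set set \<Rightarrow> ncps" where
  "h_partition n \<pi> = Abs_ncps (\<lambda>w. of_nat (card {(\<epsilon>, i).
      \<epsilon> permutes {1..n} \<and> (\<forall>B\<in>\<pi>. \<epsilon> ` B = B) \<and>
      i \<in> {1..n} \<rightarrow>\<^sub>E {1..} \<and> (\<forall>B\<in>\<pi>. \<forall>j\<in>B. \<forall>k\<in>B. j < k \<longrightarrow> i j \<le> i k) \<and>
      w = map (\<lambda>j. i (\<epsilon> j)) [1..<Suc n]}))"

text \<open>The linear action of \<open>S\<^sub>n\<close> on \<open>NCSym\<^sup>n\<close> determined by \<open>\<delta> \<circ> h\<^sub>\<pi> = h\<^bsub>\<delta>\<pi>\<^esub>\<close>: expand \<open>f\<close> in the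
  basis \<open>h\<^sub>\<pi>\<close> and permute the basis.  Only meaningful for \<open>f\<close> in the span of the \<open>h\<^sub>\<pi>\<close>.\<close>

definition h_coords :: "nat \<Rightarrow> ncps \<Rightarrow> nat set set \<Rightarrow> rat" where
  "h_coords n f =
     (SOME c. f = (\<Sum>\<pi>\<in>set_partitions n. nc_scale (c \<pi>) (h_partition n \<pi>)))"

definition ncsym_act :: "nat \<Rightarrow> (nat \<Rightarrow> nat) \<Rightarrow> ncps \<Rightarrow> ncps" where
  "ncsym_act n \<delta> f =
     (\<Sum>\<pi>\<in>set_partitions n. nc_scale (h_coords n f \<pi>) (h_partition n (perm_partition \<delta> \<pi>)))"

definition h_single :: "int \<Rightarrow> ncps" where
  "h_single k = (if k < 0 then 0 else if k = 0 then 1 else h_partition (nat k) {{1..nat k}})"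


section \<open>Skew diagrams\<close>

definition is_partition :: "nat list \<Rightarrow> bool" where
  "is_partition lam \<longleftrightarrow> sorted_wrt (\<ge>) lam \<and> 0 \<notin> set lam"

definition part :: "nat list \<Rightarrow> nat \<Rightarrow> nat" where
  "part lam i = (if 1 \<le> i \<and> i \<le> length lam then lam ! (i - 1) else 0)"

definition skew_shape :: "nat list \<Rightarrow> nat list \<Rightarrow> bool" where
  "skew_shape lam mu \<longleftrightarrow> is_partition lam \<and> is_partition mu \<and>
     length mu \<le> length lam \<and> (\<forall>i\<in>{1..length mu}. part mu i \<le> part lam i)"

text \<open>Boxes are (row, column) pairs, rows counted downwards; integer coordinates make room for
  rotations and translations.\<close>

definition skew_boxes :: "nat list \<Rightarrow> nat list \<Rightarrow> (int \<times> int) set" where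
  "skew_boxes lam mu =
     {(int i, int j) | i j. 1 \<le> i \<and> i \<le> length lam \<and> part mu i < j \<and> j \<le> part lam i}"

definition skew_size :: "nat list \<Rightarrow> nat list \<Rightarrow> nat" where
  "skew_size lam mu = card (skew_boxes lam mu)"

definition skew_row :: "nat list \<Rightarrow> nat list \<Rightarrow> nat \<Rightarrow> int set" where
  "skew_row lam mu i = {j. (int i, j) \<in> skew_boxes lam mu}"

definition row_lengths :: "nat list \<Rightarrow> nat list \<Rightarrow> nat list" where
  "row_lengths lam mu = map (\<lambda>i. card (skew_row lam mu i)) [1..<Suc (length lam)]"

text \<open>The rows are rows \<open>1, \<dots>, \<ell>(lam)\<close>, so for \<open>lam/mu\<close> with at least one box connectedness
  excludes empty rows, also at the top and at the bottom.\<close>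

definition skew_connected :: "nat list \<Rightarrow> nat list \<Rightarrow> bool" where
  "skew_connected lam mu \<longleftrightarrow>
     (\<forall>i. 1 \<le> i \<and> i < length lam \<longrightarrow> skew_row lam mu i \<inter> skew_row lam mu (Suc i) \<noteq> {})"

definition skew_ribbon :: "nat list \<Rightarrow> nat list \<Rightarrow> bool" where
  "skew_ribbon lam mu \<longleftrightarrow>
     (\<forall>i. 1 \<le> i \<and> i < length lam \<longrightarrow> card (skew_row lam mu i \<inter> skew_row lam mu (Suc i)) = 1)"

text \<open>Equality of arrays of boxes, i.e. equality up to translation.\<close>

definition same_array :: "(int \<times> int) set \<Rightarrow> (int \<times> int) set \<Rightarrow> bool" where
  "same_array D T \<longleftrightarrow> (\<exists>a b. T = (\<lambda>(i, j). (i + a, j + b)) ` D)"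

definition rotate_array :: "(int \<times> int) set \<Rightarrow> (int \<times> int) set" where
  "rotate_array D = (\<lambda>(i, j). (- i, - j)) ` D"

definition skew_symmetric :: "nat list \<Rightarrow> nat list \<Rightarrow> bool" where
  "skew_symmetric lam mu \<longleftrightarrow> same_array (skew_boxes lam mu) (rotate_array (skew_boxes lam mu))"


section \<open>Skew Schur functions in noncommuting variables\<close>

text \<open>The factors of each term are multiplied in the order of the rows.\<close>

definition nc_det :: "nat \<Rightarrow> (nat \<Rightarrow> nat \<Rightarrow> 'a::ring_1) \<Rightarrow> 'a" where
  "nc_det m A =
     (\<Sum>\<epsilon> | \<epsilon> permutes {1..m}. of_int (sign \<epsilon>) * prod_list (map (\<lambda>i. A i (\<epsilon> i)) [1..<Suc m]))"

definition jt_entry :: "nat list \<Rightarrow> nat list \<Rightarrow> nat \<Rightarrow> nat \<Rightarrow> ncps" where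
  "jt_entry lam mu i j =
     (let k = int (part lam i) - int (part mu j) - int i + int j
      in nc_scale (1 / fact (nat k)) (h_single k))"

definition skew_schur :: "(nat \<Rightarrow> nat) \<Rightarrow> nat list \<Rightarrow> nat list \<Rightarrow> ncps" where
  "skew_schur \<delta> lam mu = ncsym_act (skew_size lam mu) \<delta> (nc_det (length lam) (jt_entry lam mu))"

end

theory Submission
  imports Defs
begin

text \<open>
  Expanding the Jacobi--Trudi determinant of a connected shape \<open>\<D>\<close> with \<open>r\<close> rows, only permutations
  \<open>\<epsilon>\<close> all of whose entries \<open>k\<^bsub>i,\<epsilon>(i)\<^esub>\<close> are nonnegative survive, and such an \<open>\<epsilon>\<close> contributes a nonzero
  multiple of \<open>h\<^sub>\<pi>\<close> (\<open>nc_det_expansion\<close>), where \<open>\<pi>\<close> consists of consecutive intervals of lengths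
  \<open>k\<^bsub>1,\<epsilon>(1)\<^esub>, \<dots>, k\<^bsub>r,\<epsilon>(r)\<^esub>\<close>, empty ones dropped.  The \<open>h\<^sub>\<pi>\<close> are linearly independent
  (\<open>h_independent\<close>): evaluated at suitable words, their coefficients form the Gram matrix of the
  indicator functions of the Young subgroups, and these are independent because each Young subgroup
  contains a permutation whose cycles are exactly its blocks.  With \<open>\<sigma> = \<tau>\<^sup>-\<^sup>1\<delta>\<close>, the equality
  \<open>s\<^bsub>(\<delta>,\<D>)\<^esub> = s\<^bsub>(\<tau>,\<T>)\<^esub>\<close> therefore says that \<open>\<sigma>\<close> carries the coefficients of the expansion for \<open>\<D>\<close>
  to those for \<open>\<T>\<close>.

  The entries have the form \<open>k\<^bsub>i,j\<^esub> = a\<^sub>i + b\<^sub>j\<close> with \<open>a\<close> strictly decreasing and \<open>b\<close> strictly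
  increasing.  The diagonal holds the row lengths, the subdiagonal entry \<open>o\<^sub>i = k\<^bsub>i+1,i\<^esub>\<close> is one less
  than the overlap of rows \<open>i\<close> and \<open>i + 1\<close>, and these numbers determine the shape.  By the rearrangement
  inequality the identity is the unique term minimising the sum of the squares of the block sizes,
  a quantity that \<open>\<sigma>\<close> respects; hence \<open>\<sigma>\<close> maps \<open>[\<alpha>]\<close> to \<open>[\<alpha>']\<close> (\<open>jt_pair.id_partition\<close>).  The
  partition of the transposition \<open>(i, i+1)\<close> belongs to no other term
  (\<open>jt_matrix.jt_partition_swap_unique\<close>), so it is carried to some partition into intervals.  One of its
  blocks contains row block \<open>i\<close> and meets row block \<open>i + 1\<close>, and the image of that block is an interval
  disjoint from the images of the remaining row blocks.  So \<open>\<sigma>\<close> preserves adjacency of row blocks and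
  acts on them as the identity or as the reversal (\<open>jt_pair.block_dichotomy\<close>).  If \<open>o\<^sub>i > 0\<close>, then
  the partition of \<open>(i, i+1)\<close> must be carried to that of the corresponding transposition for \<open>\<T>\<close>,
  which forces equal subdiagonal entries and the order of the two row blocks to be kept
  (\<open>jt_pair.subdiagonal_transfer\<close>).  Consequently the identity gives \<open>\<D> = \<T>\<close>, while the reversal
  forces all \<open>o\<^sub>i\<close> to vanish, which makes \<open>\<D>\<close> a ribbon with \<open>\<T> = \<D>\<^sup>*\<close>.

  For the converse let \<open>\<D>\<close> be a ribbon and \<open>\<T> = \<D>\<^sup>*\<close>.  Then \<open>\<epsilon> \<mapsto> w\<^sub>0 \<epsilon>\<^sup>-\<^sup>1 w\<^sub>0\<close> is a bijection between
  the two expansions keeping sign and entries, and every block of a term is a union of row blocks, so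
  that \<open>\<sigma>\<close> and \<open>w\<^sub>0\<close> act on it alike (\<open>reversed_ribbons.partition_dual\<close>); here \<open>w\<^sub>0\<close>
  is the order reversal of \<open>[r]\<close> in the first place and of \<open>[n]\<close> in the second.
\<close>


section \<open>Coefficients of complete homogeneous functions\<close>

lemma partition_on_ex_block:
  assumes "partition_on A \<pi>" "x \<in> A"
  obtains B where "B \<in> \<pi>" "x \<in> B"
  using assms unfolding partition_on_def by blast

lemma partition_on_block_subset: "partition_on A \<pi> \<Longrightarrow> B \<in> \<pi> \<Longrightarrow> B \<subseteq> A"
  unfolding partition_on_def by blast

lemma partition_on_block_unique:
  "partition_on A \<pi> \<Longrightarrow> B \<in> \<pi> \<Longrightarrow> C \<in> \<pi> \<Longrightarrow> x \<in> B \<Longrightarrow> x \<in> C \<Longrightarrow> B = C"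
  by (metis disjointD disjoint_iff partition_onD2)

definition young_subgroup :: "nat \<Rightarrow> nat set set \<Rightarrow> (nat \<Rightarrow> nat) set" where
  "young_subgroup n \<pi> = {g. g permutes {1..n} \<and> (\<forall>B\<in>\<pi>. g ` B = B)}"

lemma finite_young [simp]: "finite (young_subgroup n \<pi>)"
proof -
  have "young_subgroup n \<pi> \<subseteq> {g. g permutes {1..n}}" by (auto simp: young_subgroup_def)
  then show ?thesis using finite_permutations[of "{1..n}"] finite_subset by blast
qed

lemma young_compose: "g \<in> young_subgroup n \<pi> \<Longrightarrow> h \<in> young_subgroup n \<pi> \<Longrightarrow> g \<circ> h \<in> young_subgroup n \<pi>"
  unfolding young_subgroup_def by (simp only: permutes_compose image_comp [symmetric] mem_Collect_eq simp_thms) simp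

lemma young_inv: "g \<in> young_subgroup n \<pi> \<Longrightarrow> inv g \<in> young_subgroup n \<pi>"
  unfolding young_subgroup_def
  by (auto simp: permutes_inv) (metis image_inv_f_f permutes_inj image_eqI image_f_inv_f permutes_surj)+

lemma young_id: "id \<in> young_subgroup n \<pi>"
  by (auto simp: young_subgroup_def permutes_id)

lemma transpose_in_young_subgroup:
  assumes "partition_on {1..n} \<pi>" "B \<in> \<pi>" "j \<in> B" "k \<in> B"
  shows "transpose j k \<in> young_subgroup n \<pi>"
proof -
  have "B \<subseteq> {1..n}" using assms(1,2) by (auto simp: partition_on_def)
  then have 1: "transpose j k permutes {1..n}"
    using assms(3,4) by (intro permutes_swap_id) auto
  have 2: "transpose j k ` C = C" if "C \<in> \<pi>" for C
  proof (cases "C = B")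
    case True then show ?thesis using assms by simp
  next
    case False
    then have "C \<inter> B = {}" using assms(1,2) that by (metis partition_onD2 disjointD)
    then have "j \<notin> C" "k \<notin> C" using assms by auto
    then show ?thesis by simp
  qed
  show ?thesis using 1 2 by (simp add: young_subgroup_def)
qed

definition block_sorted :: "nat set set \<Rightarrow> (nat \<Rightarrow> nat) \<Rightarrow> bool" where
  "block_sorted \<pi> f \<longleftrightarrow> (\<forall>B\<in>\<pi>. \<forall>j\<in>B. \<forall>k\<in>B. j < k \<longrightarrow> f j \<le> f k)"

text \<open>An exchange argument: for \<open>h\<close> maximising \<open>\<Sum>x. x * w (h x)\<close>, a descent of \<open>w \<circ> h\<close> inside a
  block could be removed by a transposition, which would increase the sum.\<close>

lemma ex_block_sorting:
  assumes \<pi>: "partition_on {1..n} \<pi>"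
  shows "\<exists>h\<in>young_subgroup n \<pi>. block_sorted \<pi> (w \<circ> h)"
proof -
  define S where "S h = (\<Sum>x\<in>{1..n}. x * w (h x))" for h
  have fin: "finite (S ` young_subgroup n \<pi>)" and ne: "S ` young_subgroup n \<pi> \<noteq> {}"
    using young_id by auto
  then obtain h where h: "h \<in> young_subgroup n \<pi>" and hS: "S h = Max (S ` young_subgroup n \<pi>)"
    by (metis (no_types, lifting) Max_in imageE)
  have mx: "S g \<le> S h" if "g \<in> young_subgroup n \<pi>" for g
    using that fin hS by simp
  have "w (h j) \<le> w (h k)" if B: "B \<in> \<pi>" "j \<in> B" "k \<in> B" "j < k" for B j k
  proof (rule ccontr)
    assume "\<not> ?thesis"
    then have lt: "w (h k) < w (h j)" by simp
    let ?t = "transpose j k"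
    have t: "h \<circ> ?t \<in> young_subgroup n \<pi>"
      using young_compose[OF h transpose_in_young_subgroup[OF \<pi> B(1-3)]] .
    have jk: "j \<in> {1..n}" "k \<in> {1..n}" using \<pi> B by (auto simp: partition_on_def)
    define R where "R = {1..n} - {j} - {k}"
    have spl: "sum f {1..n} = f j + f k + sum f R" for f :: "nat \<Rightarrow> nat"
    proof -
      have "sum f {1..n} = f j + sum f ({1..n} - {j})" using jk by (intro sum.remove) auto
      also have "sum f ({1..n} - {j}) = f k + sum f R"
        unfolding R_def using jk \<open>j < k\<close> by (intro sum.remove) auto
      finally show ?thesis by simp
    qed
    have "sum (\<lambda>x. x * w ((h \<circ> ?t) x)) R = sum (\<lambda>x. x * w (h x)) R"
      unfolding R_def by (intro sum.cong) (auto simp: transpose_def)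
    then have "S (h \<circ> ?t) = j * w (h k) + k * w (h j) + sum (\<lambda>x. x * w (h x)) R"
      unfolding S_def spl by simp
    moreover have "S h = j * w (h j) + k * w (h k) + sum (\<lambda>x. x * w (h x)) R"
      unfolding S_def spl by simp
    moreover have "j * w (h j) + k * w (h k) < j * w (h k) + k * w (h j)"
    proof -
      obtain d e where "k = j + Suc d" "w (h j) = w (h k) + Suc e"
        using lt \<open>j < k\<close> by (metis less_imp_Suc_add add_Suc_right)
      then show ?thesis by (simp add: algebra_simps)
    qed
    ultimately show False using mx[OF t] by linarith
  qed
  then show ?thesis using h by (auto simp: block_sorted_def)
qed

text \<open>On each block, \<open>f\<close> and \<open>f \<circ> g\<close> are two sorted arrangements of the same multiset of values.\<close>

lemma block_sorted_unique:
  assumes \<pi>: "partition_on {1..n} \<pi>" and g: "g \<in> young_subgroup n \<pi>"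
    and f: "block_sorted \<pi> f" and fg: "block_sorted \<pi> (f \<circ> g)" and x: "x \<in> {1..n}"
  shows "f (g x) = f x"
proof -
  obtain B where B: "B \<in> \<pi>" "x \<in> B"
    by (rule partition_on_ex_block[OF \<pi> x])
  have finB: "finite B" using \<pi> B by (metis finite_atLeastAtMost finite_elements finite_UnionD partition_onD1 Union_upper finite_subset)
  define l where "l = sorted_list_of_set B"
  have l: "sorted l" "set l = B" "mset l = mset_set B" "distinct l" 
    using finB mset_sorted_list_of_multiset[of "mset_set B"] by (simp_all add: l_def)
  have mono: "sorted (map e l)" if "block_sorted \<pi> e" for e :: "nat \<Rightarrow> nat"
    unfolding sorted_map
    by (rule sorted_wrt_mono_rel[OF _ l(1)])
       (use that B(1) in \<open>auto simp: block_sorted_def l(2) le_less\<close>)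
  have "g ` B = B" "inj_on g B" using g B by (auto simp: young_subgroup_def permutes_inj_on)
  then have "image_mset g (mset_set B) = mset_set B" by (simp add: image_mset_mset_set)
  then have "mset (map (f \<circ> g) l) = mset (map f l)"
    by (simp add: l(3) flip: multiset.map_comp)
  then have "map (f \<circ> g) l = map f l"
    using mono[OF f] mono[OF fg] by (metis properties_for_sort)
  then have "\<forall>y\<in>set l. (f \<circ> g) y = f y" by (simp only: map_eq_conv)
  then show ?thesis using B l(2) by simp
qed

definition letter :: "nat list \<Rightarrow> nat \<Rightarrow> nat" where
  "letter w j = w ! (j - 1)"

lemma map_letter: "map (letter w) [1..<Suc (length w)] = w"
  by (rule nth_equalityI) (auto simp: letter_def simp del: upt_Suc)

lemma letter_map: "j \<in> {1..n} \<Longrightarrow> letter (map f [1..<Suc n]) j = f j"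
  by (auto simp: letter_def simp del: upt_Suc)

text \<open>The pairs \<open>(\<epsilon>, i)\<close> counted by a coefficient form a torsor: the sorted filling \<open>i\<close> is determined by
  the word \<open>w\<close>, and any two choices of \<open>\<epsilon>\<close> differ by an element of the Young subgroup that leaves \<open>w\<close>
  unchanged.\<close>

lemma nc_coeff_h_partition:
  assumes \<pi>: "partition_on {1..n} \<pi>"
  shows "nc_coeff (h_partition n \<pi>) w =
    (if length w = n \<and> 0 \<notin> set w
     then of_nat (card {g\<in>young_subgroup n \<pi>. \<forall>j\<in>{1..n}. letter w (g j) = letter w j}) else 0)"
proof -
  define Z where "Z = {(\<epsilon>, i).
      \<epsilon> permutes {1..n} \<and> (\<forall>B\<in>\<pi>. \<epsilon> ` B = B) \<and>
      i \<in> {1..n} \<rightarrow>\<^sub>E {1..} \<and> (\<forall>B\<in>\<pi>. \<forall>j\<in>B. \<forall>k\<in>B. j < k \<longrightarrow> i j \<le> i k) \<and>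
      w = map (\<lambda>j. i (\<epsilon> j)) [1..<Suc n]}"
  have Z: "Z = {(\<epsilon>, i). \<epsilon> \<in> young_subgroup n \<pi> \<and> i \<in> {1..n} \<rightarrow>\<^sub>E {1..} \<and> block_sorted \<pi> i \<and>
      w = map (\<lambda>j. i (\<epsilon> j)) [1..<Suc n]}"
    unfolding Z_def young_subgroup_def block_sorted_def by auto
  have co: "nc_coeff (h_partition n \<pi>) w = of_nat (card Z)"
    by (simp add: h_partition_def Z_def)
  show ?thesis
  proof (cases "length w = n \<and> 0 \<notin> set w")
    case False
    have "Z = {}"
    proof -
      have "length w = n \<and> 0 \<notin> set w" if "(\<epsilon>, i) \<in> Z" for \<epsilon> i
      proof -
        have w: "w = map (\<lambda>j. i (\<epsilon> j)) [1..<Suc n]" and i: "i \<in> {1..n} \<rightarrow>\<^sub>E {1..}"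
          and e: "\<epsilon> permutes {1..n}"
          using that by (auto simp: Z young_subgroup_def simp del: upt_Suc)
        have "i (\<epsilon> j) \<ge> 1" if "j \<in> {1..n}" for j
          using i e that by (metis PiE_mem atLeast_iff permutes_in_image)
        then have "0 \<notin> set w" unfolding w by (force simp del: upt_Suc)
        then show ?thesis using w by (simp del: upt_Suc)
      qed
      then show ?thesis using False by auto
    qed
    then show ?thesis using False co by auto
  next
    case True
    then have len: "length w = n" and pos: "0 \<notin> set w" by auto
    have weq: "w = map (letter w) [1..<Suc n]" using map_letter[of w] len by simp
    have posl: "letter w j \<ge> 1" if "j \<in> {1..n}" for j
    proof -
      have "letter w j \<in> set w" unfolding letter_def using that len by (intro nth_mem) auto
      then show ?thesis using pos by (metis One_nat_def Suc_leI neq0_conv)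
    qed
    obtain h where h: "h \<in> young_subgroup n \<pi>" "block_sorted \<pi> (letter w \<circ> h)"
      using ex_block_sorting[OF \<pi>] by blast
    have hp: "h permutes {1..n}" using h by (simp add: young_subgroup_def)
    define i where "i = restrict (letter w \<circ> h) {1..n}"
    have blk: "x \<in> {1..n}" if "B \<in> \<pi>" "x \<in> B" for x B
      using \<pi> that by (auto simp: partition_on_def)
    have i1: "i \<in> {1..n} \<rightarrow>\<^sub>E {1..}"
      unfolding i_def using posl hp by (auto simp: permutes_in_image) (metis One_nat_def atLeastAtMost_iff permutes_in_image)
    have i2: "block_sorted \<pi> i"
      using h(2) blk unfolding block_sorted_def i_def by (metis restrict_apply')
    let ?G = "{g\<in>young_subgroup n \<pi>. \<forall>j\<in>{1..n}. letter w (g j) = letter w j}"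
    have key: "i (\<epsilon> j) = letter w (h (\<epsilon> j))" if "\<epsilon> permutes {1..n}" "j \<in> {1..n}" for \<epsilon> j
      using that unfolding i_def by (simp only: permutes_in_image restrict_apply' o_def)
    have wi: "w = map e [1..<Suc n] \<longleftrightarrow> (\<forall>j\<in>{1..n}. e j = letter w j)" for e
    proof
      assume "w = map e [1..<Suc n]"
      then show "\<forall>j\<in>{1..n}. e j = letter w j" using letter_map[of _ n e] by metis
    next
      assume "\<forall>j\<in>{1..n}. e j = letter w j"
      then have "map (letter w) [1..<Suc n] = map e [1..<Suc n]" 
        by (auto simp del: upt_Suc)
      then show "w = map e [1..<Suc n]" by (rule trans[OF weq])
    qed
    have Zi: "(\<epsilon>, i') \<in> Z \<longleftrightarrow> \<epsilon> \<in> young_subgroup n \<pi> \<and> i' = i \<and> h \<circ> \<epsilon> \<in> ?G" for \<epsilon> i'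
    proof
      assume a: "(\<epsilon>, i') \<in> Z"
      then have e: "\<epsilon> \<in> young_subgroup n \<pi>" and i': "i' \<in> {1..n} \<rightarrow>\<^sub>E {1..}" "block_sorted \<pi> i'"
        and w': "\<forall>j\<in>{1..n}. i' (\<epsilon> j) = letter w j"
        unfolding Z wi by auto
      have ep: "\<epsilon> permutes {1..n}" using e by (simp add: young_subgroup_def)
      have eh: "\<epsilon> \<circ> h \<in> young_subgroup n \<pi>" using young_compose e h by blast
      have e1: "(i' \<circ> (\<epsilon> \<circ> h)) j = i j" if "j \<in> {1..n}" for j
        using w' that hp unfolding i_def by (metis comp_apply permutes_in_image restrict_apply')
      have "block_sorted \<pi> (i' \<circ> (\<epsilon> \<circ> h))"
        using i2 e1 blk unfolding block_sorted_def by metis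
      then have "i' ((\<epsilon> \<circ> h) j) = i' j" if "j \<in> {1..n}" for j
        using block_sorted_unique[OF \<pi> eh i'(2)] that by blast
      then have "i' j = i j" if "j \<in> {1..n}" for j using e1 that by simp
      moreover have "i' \<in> extensional {1..n}" "i \<in> extensional {1..n}"
        using i' i1 by (auto simp: PiE_def)
      ultimately have "i' = i" using extensionalityI by blast
      moreover have "h \<circ> \<epsilon> \<in> ?G"
        using w' key[OF ep] \<open>i' = i\<close> young_compose[OF h(1) e] by simp
      ultimately show "\<epsilon> \<in> young_subgroup n \<pi> \<and> i' = i \<and> h \<circ> \<epsilon> \<in> ?G" using e by blast
    next
      assume a: "\<epsilon> \<in> young_subgroup n \<pi> \<and> i' = i \<and> h \<circ> \<epsilon> \<in> ?G"
      then have "\<epsilon> permutes {1..n}" by (simp add: young_subgroup_def)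
      then show "(\<epsilon>, i') \<in> Z" unfolding Z wi using a i1 i2 key by auto
    qed
    have "bij_betw (\<lambda>g. (inv h \<circ> g, i)) ?G Z"
    proof (rule bij_betw_byWitness[where f' = "\<lambda>(\<epsilon>, i'). h \<circ> \<epsilon>"])
      show "\<forall>g\<in>?G. (case (inv h \<circ> g, i) of (\<epsilon>, i') \<Rightarrow> h \<circ> \<epsilon>) = g"
        using permutes_inv_o(1)[OF hp] by (simp add: o_assoc)
      show "\<forall>p\<in>Z. (inv h \<circ> (case p of (\<epsilon>, i') \<Rightarrow> h \<circ> \<epsilon>), i) = p"
        using permutes_inv_o(2)[OF hp] Zi by (auto simp: o_assoc)
      show "(\<lambda>g. (inv h \<circ> g, i)) ` ?G \<subseteq> Z"
      proof (rule image_subsetI)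
        fix g assume g: "g \<in> ?G"
        have "h \<circ> (inv h \<circ> g) = g" using permutes_inv_o(1)[OF hp] by (simp add: o_assoc)
        then have "h \<circ> (inv h \<circ> g) \<in> ?G" using g by (simp only:)
        moreover have "inv h \<circ> g \<in> young_subgroup n \<pi>" using young_compose[OF young_inv[OF h(1)]] g by blast
        ultimately show "(inv h \<circ> g, i) \<in> Z" unfolding Zi by blast
      qed
      show "(\<lambda>(\<epsilon>, i'). h \<circ> \<epsilon>) ` Z \<subseteq> ?G"
      proof (rule image_subsetI)
        fix p assume "p \<in> Z"
        then show "(case p of (\<epsilon>, i') \<Rightarrow> h \<circ> \<epsilon>) \<in> ?G"
          using Zi[of "fst p" "snd p"] unfolding case_prod_unfold prod.collapse by (rule iffD1[THEN conjunct2, THEN conjunct2, rotated])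
      qed
    qed
    then have "card ?G = card Z" by (rule bij_betw_same_card)
    then show ?thesis using co True by simp
  qed
qed


section \<open>Linear independence of the complete homogeneous functions\<close>

lemma ex_cycle:
  assumes "finite B" "B \<noteq> {}"
  shows "\<exists>p. p permutes B \<and> (\<forall>X. p ` X \<subseteq> X \<longrightarrow> X \<inter> B \<noteq> {} \<longrightarrow> B \<subseteq> X)"
  using assms
proof (induction rule: finite_ne_induct)
  case (singleton x)
  then show ?case by (intro exI[of _ id]) (auto simp: permutes_id)
next
  case (insert b F)
  then obtain p where p: "p permutes F"
    and tr: "\<And>X. p ` X \<subseteq> X \<Longrightarrow> X \<inter> F \<noteq> {} \<Longrightarrow> F \<subseteq> X" by blast
  obtain f where f: "f \<in> F" using insert by blast
  let ?q = "p \<circ> transpose f b"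
  have q: "?q permutes insert b F"
  proof (rule permutes_compose)
    show "transpose f b permutes insert b F" using f by (intro permutes_swap_id) auto
    show "p permutes insert b F" by (rule permutes_subset[OF p]) auto
  qed
  have pb: "p b = b" using p insert by (simp add: permutes_def)
  have "insert b F \<subseteq> X" if X: "?q ` X \<subseteq> X" "X \<inter> insert b F \<noteq> {}" for X
  proof -
    have bX: "p f \<in> X" if "b \<in> X" using X(1) that by force
    have fX: "b \<in> X" if "f \<in> X" using X(1) that pb by force
    have "p ` (X - {b}) \<subseteq> X - {b}"
    proof
      fix y assume "y \<in> p ` (X - {b})"
      then obtain x where x: "x \<in> X" "x \<noteq> b" "y = p x" by blast
      have "y \<noteq> b" using x pb permutes_inj[OF p] by (metis injD)
      moreover have "y \<in> X"
      proof (cases "x = f")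
        case True then show ?thesis using bX fX x by simp
      next
        case False
        then have "?q x = y" using x by simp
        then show ?thesis using X(1) x by blast
      qed
      ultimately show "y \<in> X - {b}" by simp
    qed
    moreover have "(X - {b}) \<inter> F \<noteq> {}"
    proof (cases "b \<in> X")
      case True
      have "p f \<in> F" using p f by (simp add: permutes_in_image)
      then show ?thesis using bX[OF True] insert by blast
    next
      case False then show ?thesis using X(2) by blast
    qed
    ultimately have "F \<subseteq> X - {b}" by (rule tr)
    then show ?thesis using f fX by blast
  qed
  then show ?case using q by blast
qed

text \<open>Such a permutation separates the Young subgroups: it lies in the Young subgroup of \<open>\<rho>\<close> only if
  every block of \<open>\<rho>\<close> is a union of blocks of \<open>\<pi>\<close>.\<close>

lemma ex_perm_with_cycles:
  assumes "finite \<pi>" "\<And>B. B \<in> \<pi> \<Longrightarrow> finite B \<and> B \<noteq> {}" "disjoint \<pi>"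
  shows "\<exists>p. p permutes \<Union>\<pi> \<and> (\<forall>B\<in>\<pi>. p ` B = B) \<and>
    (\<forall>B\<in>\<pi>. \<forall>X. p ` X \<subseteq> X \<longrightarrow> X \<inter> B \<noteq> {} \<longrightarrow> B \<subseteq> X)"
  using assms
proof (induction rule: finite_induct)
  case empty
  then show ?case by (intro exI[of _ id]) (auto simp: permutes_id)
next
  case (insert B \<pi>)
  have "disjoint \<pi>" using insert.prems by (auto intro: pairwise_subset)
  then obtain p where p: "p permutes \<Union>\<pi>" "\<And>C. C \<in> \<pi> \<Longrightarrow> p ` C = C"
    and ptr: "\<And>C X. C \<in> \<pi> \<Longrightarrow> p ` X \<subseteq> X \<Longrightarrow> X \<inter> C \<noteq> {} \<Longrightarrow> C \<subseteq> X"
    using insert by auto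
  obtain q where q: "q permutes B"
    and qtr: "\<And>X. q ` X \<subseteq> X \<Longrightarrow> X \<inter> B \<noteq> {} \<Longrightarrow> B \<subseteq> X"
    using ex_cycle insert.prems by (metis insertI1)
  have dis: "B \<inter> C = {}" if "C \<in> \<pi>" for C
    using insert.prems(2) insert.hyps that by (metis disjointD insertI1 insertI2)
  have eB: "(p \<circ> q) x = q x" if "x \<in> B" for x
  proof -
    have "q x \<in> B" using q that by (simp add: permutes_in_image)
    then have "q x \<notin> \<Union>\<pi>" using dis by blast
    then show ?thesis using p(1) by (simp add: permutes_def)
  qed
  have eC: "(p \<circ> q) x = p x" if "x \<in> C" "C \<in> \<pi>" for x C
  proof -
    have "x \<notin> B" using dis that by blast
    then show ?thesis using q by (simp add: permutes_def)
  qed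
  have 1: "p \<circ> q permutes \<Union>(insert B \<pi>)"
  proof (rule permutes_compose)
    show "q permutes \<Union>(insert B \<pi>)" by (rule permutes_subset[OF q]) auto
    show "p permutes \<Union>(insert B \<pi>)" by (rule permutes_subset[OF p(1)]) auto
  qed
  have imB: "(p \<circ> q) ` B = B" 
    by (rule trans[OF image_cong[OF refl eB] permutes_image[OF q]])
  have imC: "(p \<circ> q) ` C = C" if "C \<in> \<pi>" for C
    by (rule trans[OF image_cong[OF refl eC[OF _ that]] p(2)[OF that]])
  have trB: "B \<subseteq> X" if "(p \<circ> q) ` X \<subseteq> X" "X \<inter> B \<noteq> {}" for X
  proof -
    have "q ` (X \<inter> B) \<subseteq> X \<inter> B"
    proof
      fix y assume "y \<in> q ` (X \<inter> B)"
      then obtain x where x: "x \<in> X" "x \<in> B" "y = q x" by blast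
      have "y \<in> B" using x permutes_image[OF q] by blast
      moreover have "y \<in> X" using that(1) x(1) eB[OF x(2)] unfolding x(3) by (metis image_subset_iff)
      ultimately show "y \<in> X \<inter> B" by simp
    qed
    then show ?thesis using qtr[of "X \<inter> B"] that by blast
  qed
  have trC: "C \<subseteq> X" if "(p \<circ> q) ` X \<subseteq> X" "X \<inter> C \<noteq> {}" "C \<in> \<pi>" for X C
  proof -
    have "p ` (X \<inter> C) \<subseteq> X \<inter> C"
    proof
      fix y assume "y \<in> p ` (X \<inter> C)"
      then obtain x where x: "x \<in> X" "x \<in> C" "y = p x" by blast
      have "y \<in> C" using x p(2)[OF that(3)] by blast
      moreover have "y \<in> X" using that(1) x(1) eC[OF x(2) that(3)] unfolding x(3) by (metis image_subset_iff)
      ultimately show "y \<in> X \<inter> C" by simp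
    qed
    then show ?thesis using ptr[OF that(3), of "X \<inter> C"] that by blast
  qed
  show ?case
  proof (intro exI[of _ "p \<circ> q"] conjI ballI allI impI)
    show "(p \<circ> q) ` C = C" if "C \<in> insert B \<pi>" for C
      using that imB imC by blast
    show "C \<subseteq> X" if "C \<in> insert B \<pi>" "(p \<circ> q) ` X \<subseteq> X" "X \<inter> C \<noteq> {}" for C X
      using that(1) trB[OF that(2)] trC[OF that(2)] that(3) by blast
  qed (rule 1)
qed

lemma finite_set_partitions [simp]: "finite (set_partitions n)"
proof -
  have "set_partitions n \<subseteq> Pow (Pow {1..n})"
    by (auto simp: set_partitions_def partition_on_def)
  then show ?thesis by (rule finite_subset) simp
qed

definition block_word :: "nat \<Rightarrow> nat set set \<Rightarrow> nat list" where
  "block_word n \<rho> = map (\<lambda>j. Min (\<Union>{B\<in>\<rho>. j \<in> B})) [1..<Suc n]"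

text \<open>Two positions carry the same letter of \<open>block_word\<close> exactly if they lie in the same block, because
  the minima of distinct blocks are distinct.\<close>

lemma block_word_stabiliser:
  assumes \<rho>: "partition_on {1..n} \<rho>" and g: "g permutes {1..n}"
  shows "(\<forall>j\<in>{1..n}. letter (block_word n \<rho>) (g j) = letter (block_word n \<rho>) j)
    \<longleftrightarrow> (\<forall>B\<in>\<rho>. g ` B = B)"
proof -
  have sub: "B \<subseteq> {1..n}" "finite B" "B \<noteq> {}" if "B \<in> \<rho>" for B
    using \<rho> that by (auto simp: partition_on_def intro: finite_subset)
  have uniq: "B = C" if "B \<in> \<rho>" "C \<in> \<rho>" "x \<in> B" "x \<in> C" for B C x
    using \<rho> that by (metis disjointD disjoint_iff partition_onD2)
  have blk: "\<Union>{C\<in>\<rho>. j \<in> C} = B" if "B \<in> \<rho>" "j \<in> B" for B j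
    using uniq that by auto
  have lw: "letter (block_word n \<rho>) j = Min B" if "B \<in> \<rho>" "j \<in> B" for B j
  proof -
    have "j \<in> {1..n}" using sub that by blast
    then show ?thesis unfolding block_word_def using letter_map blk[OF that] by metis
  qed
  show ?thesis
  proof
    assume L: "\<forall>j\<in>{1..n}. letter (block_word n \<rho>) (g j) = letter (block_word n \<rho>) j"
    show "\<forall>B\<in>\<rho>. g ` B = B"
    proof
      fix B assume B: "B \<in> \<rho>"
      have "g ` B \<subseteq> B"
      proof
        fix y assume "y \<in> g ` B"
        then obtain x where x: "x \<in> B" "y = g x" by blast
        then have xn: "x \<in> {1..n}" using sub B by blast
        then have "y \<in> {1..n}" using x g by (simp only: permutes_in_image)
        then obtain C where C: "C \<in> \<rho>" "y \<in> C"
          by (rule partition_on_ex_block[OF \<rho>])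
        then have "Min C = Min B" using L lw[OF B x(1)] lw[OF C] x xn by simp
        then show "y \<in> B" using uniq[OF B C(1)] Min_in[OF sub(2,3)[OF B]] Min_in[OF sub(2,3)[OF C(1)]] C by metis
      qed
      then show "g ` B = B"
        using endo_inj_surj sub(2)[OF B] permutes_inj_on[OF g] by metis
    qed
  next
    assume R: "\<forall>B\<in>\<rho>. g ` B = B"
    show "\<forall>j\<in>{1..n}. letter (block_word n \<rho>) (g j) = letter (block_word n \<rho>) j"
    proof
      fix j assume "j \<in> {1..n}"
      then obtain B where B: "B \<in> \<rho>" "j \<in> B"
          by (rule partition_on_ex_block[OF \<rho>])
      then have "g j \<in> B" using R by blast
      then show "letter (block_word n \<rho>) (g j) = letter (block_word n \<rho>) j"
        using lw B by metis
    qed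
  qed
qed

text \<open>This exhibits the coefficients as a Gram matrix: the cardinality is the inner product of the
  indicator functions of two Young subgroups of \<open>S\<^sub>n\<close>.\<close>

lemma nc_coeff_h_block_word:
  assumes \<pi>: "partition_on {1..n} \<pi>" and \<rho>: "partition_on {1..n} \<rho>"
  shows "nc_coeff (h_partition n \<pi>) (block_word n \<rho>) = of_nat (card (young_subgroup n \<pi> \<inter> young_subgroup n \<rho>))"
proof -
  have len: "length (block_word n \<rho>) = n" by (simp add: block_word_def del: upt_Suc)
  have "0 \<notin> set (block_word n \<rho>)"
  proof
    assume "0 \<in> set (block_word n \<rho>)"
    then have "0 \<in> (\<lambda>j. Min (\<Union>{B\<in>\<rho>. j \<in> B})) ` {1..n}"
      unfolding block_word_def by (simp only: set_map set_upt atLeastLessThanSuc_atLeastAtMost)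
    then obtain j where j0: "0 = Min (\<Union>{B\<in>\<rho>. j \<in> B})" and j: "j \<in> {1..n}" by (rule imageE)
    let ?U = "\<Union>{B\<in>\<rho>. j \<in> B}"
    obtain B where "B \<in> \<rho>" "j \<in> B" by (rule partition_on_ex_block[OF \<rho> j])
    then have ne: "?U \<noteq> {}" by blast
    have sub: "?U \<subseteq> {1..n}" using partition_on_block_subset[OF \<rho>] by blast
    have "Min ?U \<in> ?U" by (rule Min_in[OF finite_subset[OF sub] ne]) simp
    then have "Min ?U \<in> {1..n}" using sub by blast
    then show False using j0 by simp
  qed
  moreover have "{g\<in>young_subgroup n \<pi>. \<forall>j\<in>{1..n}. letter (block_word n \<rho>) (g j) = letter (block_word n \<rho>) j}
      = young_subgroup n \<pi> \<inter> young_subgroup n \<rho>"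
  proof -
    have "g \<in> young_subgroup n \<pi> \<Longrightarrow> (\<forall>j\<in>{1..n}. letter (block_word n \<rho>) (g j) = letter (block_word n \<rho>) j)
        \<longleftrightarrow> g \<in> young_subgroup n \<rho>" for g
      using block_word_stabiliser[OF \<rho>, of g] by (simp add: young_subgroup_def)
    then show ?thesis by blast
  qed
  ultimately show ?thesis unfolding nc_coeff_h_partition[OF \<pi>] using len by simp
qed

lemma nc_coeff_scale [simp]: "nc_coeff (nc_scale c f) w = c * nc_coeff f w"
  by (simp add: nc_scale_def)

lemma nc_coeff_sum [simp]: "nc_coeff (sum f A) w = (\<Sum>a\<in>A. nc_coeff (f a) w)"
  by (induction A rule: infinite_finite_induct) auto

text \<open>A relation with coefficients \<open>c\<close> lies in the kernel of the Gram matrix, so by positive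
  definiteness the function \<open>F g = (\<Sum>\<pi>. c \<pi> * I g \<pi>)\<close>, with \<open>I\<close> the indicator of the Young
  subgroup, vanishes on \<open>S\<^sub>n\<close>.  Evaluating \<open>F\<close> at a permutation whose cycles are the blocks of a partition with the fewest
  blocks among those with \<open>c \<noteq> 0\<close> leaves a single summand.\<close>

lemma h_independent:
  assumes z: "(\<Sum>\<pi>\<in>set_partitions n. nc_scale (c \<pi>) (h_partition n \<pi>)) = 0"
    and "\<pi> \<in> set_partitions n"
  shows "c \<pi> = 0"
proof (rule ccontr)
  assume "c \<pi> \<noteq> 0"
  let ?S = "set_partitions n" and ?P = "{g. g permutes {1..n}}"
  have P: "finite ?P" by (simp add: finite_permutations)
  define I where "I g \<pi> = (if g \<in> young_subgroup n \<pi> then 1 else (0::rat))" for g \<pi>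
  define F where "F g = (\<Sum>\<pi>\<in>?S. c \<pi> * I g \<pi>)" for g
  have cardeq: "rat_of_nat (card (young_subgroup n \<pi> \<inter> young_subgroup n \<rho>)) = (\<Sum>g\<in>?P. I g \<pi> * I g \<rho>)" for \<pi> \<rho>
  proof -
    have sub: "young_subgroup n \<pi> \<inter> young_subgroup n \<rho> \<subseteq> ?P" by (auto simp: young_subgroup_def)
    have "rat_of_nat (card (young_subgroup n \<pi> \<inter> young_subgroup n \<rho>)) = (\<Sum>g\<in>young_subgroup n \<pi> \<inter> young_subgroup n \<rho>. I g \<pi> * I g \<rho>)"
      by (simp add: I_def)
    also have "\<dots> = (\<Sum>g\<in>?P. I g \<pi> * I g \<rho>)"
      by (rule sum.mono_neutral_left[OF P sub]) (auto simp: I_def)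
    finally show ?thesis .
  qed
  have row: "(\<Sum>\<pi>\<in>?S. c \<pi> * of_nat (card (young_subgroup n \<pi> \<inter> young_subgroup n \<rho>))) = 0" if "\<rho> \<in> ?S" for \<rho>
  proof -
    have "(\<Sum>\<pi>\<in>?S. c \<pi> * of_nat (card (young_subgroup n \<pi> \<inter> young_subgroup n \<rho>)))
        = (\<Sum>\<pi>\<in>?S. c \<pi> * nc_coeff (h_partition n \<pi>) (block_word n \<rho>))"
      using that by (intro sum.cong refl) (simp add: set_partitions_def nc_coeff_h_block_word)
    also have "\<dots> = 0"
      using arg_cong[OF z, of "\<lambda>f. nc_coeff f (block_word n \<rho>)"] by simp
    finally show ?thesis .
  qed
  have "(\<Sum>g\<in>?P. F g * F g) = (\<Sum>g\<in>?P. \<Sum>\<rho>\<in>?S. \<Sum>\<pi>\<in>?S. (c \<rho> * I g \<rho>) * (c \<pi> * I g \<pi>))"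
    by (simp only: F_def sum_product)
  also have "\<dots> = (\<Sum>\<rho>\<in>?S. \<Sum>g\<in>?P. \<Sum>\<pi>\<in>?S. (c \<rho> * I g \<rho>) * (c \<pi> * I g \<pi>))"
    by (rule sum.swap)
  also have "\<dots> = (\<Sum>\<rho>\<in>?S. \<Sum>\<pi>\<in>?S. \<Sum>g\<in>?P. (c \<rho> * I g \<rho>) * (c \<pi> * I g \<pi>))"
    by (rule sum.cong[OF refl], rule sum.swap)
  also have "\<dots> = (\<Sum>\<rho>\<in>?S. c \<rho> * (\<Sum>\<pi>\<in>?S. c \<pi> * of_nat (card (young_subgroup n \<pi> \<inter> young_subgroup n \<rho>))))"
    unfolding cardeq sum_distrib_left by (intro sum.cong refl) (simp only: mult_ac)
  also have "\<dots> = 0" using row by (intro sum.neutral) simp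
  finally have "(\<Sum>g\<in>?P. F g * F g) = 0" .
  then have "\<forall>g\<in>?P. F g * F g = 0"
    using sum_nonneg_eq_0_iff[OF P, of "\<lambda>g. F g * F g"] by simp
  then have F0: "F g = 0" if "g permutes {1..n}" for g using that by simp
  obtain \<pi>0 where \<pi>0: "\<pi>0 \<in> ?S" "c \<pi>0 \<noteq> 0"
    and least: "\<And>\<pi>. \<pi> \<in> ?S \<Longrightarrow> c \<pi> \<noteq> 0 \<Longrightarrow> card \<pi>0 \<le> card \<pi>"
    using ex_has_least_nat[of "\<lambda>\<pi>. \<pi> \<in> ?S \<and> c \<pi> \<noteq> 0" \<pi> card] assms(2) \<open>c \<pi> \<noteq> 0\<close> by blast
  have part0: "partition_on {1..n} \<pi>0" using \<pi>0 by (simp add: set_partitions_def)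
  have fin0: "finite \<pi>0" by (rule finite_elements[OF finite_atLeastAtMost part0])
  have "\<exists>p. p permutes \<Union>\<pi>0 \<and> (\<forall>B\<in>\<pi>0. p ` B = B) \<and>
    (\<forall>B\<in>\<pi>0. \<forall>X. p ` X \<subseteq> X \<longrightarrow> X \<inter> B \<noteq> {} \<longrightarrow> B \<subseteq> X)"
  proof (rule ex_perm_with_cycles[OF fin0])
    show "finite B \<and> B \<noteq> {}" if "B \<in> \<pi>0" for B
      using partition_onD3[OF part0] partition_on_block_subset[OF part0 that] that
      by (metis finite_atLeastAtMost finite_subset)
    show "disjoint \<pi>0" by (rule partition_onD2[OF part0])
  qed
  then obtain p where "p permutes \<Union>\<pi>0" and p2: "\<forall>B\<in>\<pi>0. p ` B = B"
    and tr: "\<forall>B\<in>\<pi>0. \<forall>X. p ` X \<subseteq> X \<longrightarrow> X \<inter> B \<noteq> {} \<longrightarrow> B \<subseteq> X"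
    by (elim exE conjE)
  then have p: "p permutes {1..n}" unfolding partition_onD1[OF part0, symmetric] by simp
  have "c \<pi> * I p \<pi> = 0" if \<pi>: "\<pi> \<in> ?S" "\<pi> \<noteq> \<pi>0" for \<pi>
  proof (cases "p \<in> young_subgroup n \<pi>")
    case True
    have part: "partition_on {1..n} \<pi>" using \<pi> by (simp add: set_partitions_def)
    have sub: "B \<subseteq> C" if "B \<in> \<pi>0" "C \<in> \<pi>" "C \<inter> B \<noteq> {}" for B C
    proof -
      have "p ` C \<subseteq> C" using True that(2) by (simp add: young_subgroup_def)
      then show ?thesis using tr that(1,3) by blast
    qed
    have ex: "\<exists>B\<in>\<pi>0. B \<subseteq> C" if "C \<in> \<pi>" for C
    proof -
      have "C \<noteq> {}" "C \<subseteq> {1..n}"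
        using that partition_onD3[OF part] partition_on_block_subset[OF part] by metis+
      then obtain x where x: "x \<in> C" "x \<in> {1..n}" by blast
      obtain B where "B \<in> \<pi>0" "x \<in> B"
        by (rule partition_on_ex_block[OF part0 x(2)])
      then show ?thesis using sub that x by blast
    qed
    then obtain f where f: "\<And>C. C \<in> \<pi> \<Longrightarrow> f C \<in> \<pi>0 \<and> f C \<subseteq> C" by metis
    have inj: "inj_on f \<pi>"
    proof (rule inj_onI)
      fix C D assume CD: "C \<in> \<pi>" "D \<in> \<pi>" "f C = f D"
      have "f C \<noteq> {}" using f[OF CD(1)] partition_onD3[OF part0] by metis
      then have "C \<inter> D \<noteq> {}" using f[OF CD(1)] f[OF CD(2)] CD(3) by auto
      then show "C = D" using CD part by (metis disjointD partition_onD2)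
    qed
    have le: "card \<pi> \<le> card \<pi>0" using card_inj_on_le[OF inj _ fin0] f by blast
    have "card \<pi> \<noteq> card \<pi>0"
    proof
      assume "card \<pi> = card \<pi>0"
      then have "f ` \<pi> = \<pi>0"
        using card_image[OF inj] f by (intro card_subset_eq[OF fin0]) auto
      have "f C = C" if C: "C \<in> \<pi>" for C
      proof
        show "f C \<subseteq> C" using f C by blast
        show "C \<subseteq> f C"
        proof
          fix x assume x: "x \<in> C"
          then have "x \<in> {1..n}" using partition_on_block_subset[OF part C] by blast
          then obtain B where B: "B \<in> \<pi>0" "x \<in> B"
          by (rule partition_on_ex_block[OF part0])
          then obtain D where D: "D \<in> \<pi>" "B = f D" using \<open>f ` \<pi> = \<pi>0\<close> by blast
          then have "x \<in> D" using f B by blast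
          then have "D = C" using partition_on_block_unique[OF part D(1) C _ x] by blast
          then show "x \<in> f C" using B D by simp
        qed
      qed
      then have "f ` \<pi> = \<pi>" by simp
      then have "\<pi> = \<pi>0" using \<open>f ` \<pi> = \<pi>0\<close> by simp
      then show False using \<pi> by simp
    qed
    then have "c \<pi> = 0" using least[OF \<pi>(1)] le by linarith
    then show ?thesis by simp
  qed (simp add: I_def)
  then have "F p = (\<Sum>\<pi>\<in>{\<pi>0}. c \<pi> * I p \<pi>)"
    unfolding F_def by (intro sum.mono_neutral_right) (use \<pi>0 in auto)
  also have "\<dots> = c \<pi>0" using p p2 by (simp add: young_subgroup_def I_def)
  finally show False using F0[OF p] \<pi>0 by simp
qed


section \<open>Products of complete homogeneous functions\<close>

lemma permutes_imageI:
  assumes "finite S" "p ` S = S" "\<And>x. x \<notin> S \<Longrightarrow> p x = x"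
  shows "p permutes S"
  using assms by (intro bij_imp_permutes) (auto simp: bij_betw_def intro!: finite_surj_inj)

text \<open>A permutation stabilising both pieces \<open>{1..m}\<close> and \<open>{m<..m + k}\<close> is the same as a pair of
  permutations, the second one shifted by \<open>m\<close>; leaving \<open>f\<close> invariant is a condition on each
  piece separately.\<close>

lemma card_stabiliser_join:
  fixes f :: "nat \<Rightarrow> nat"
  assumes \<pi>: "partition_on {1..m} \<pi>"
  shows "card {h\<in>young_subgroup (m + k) (insert {m<..m + k} \<pi>). \<forall>j\<in>{1..m + k}. f (h j) = f j} =
    card {g\<in>young_subgroup m \<pi>. \<forall>j\<in>{1..m}. f (g j) = f j} *
    card {g\<in>young_subgroup k {{1..k}}. \<forall>j\<in>{1..k}. f (m + g j) = f (m + j)}" (is "card ?C = card ?A * card ?B")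
proof -
  define U where "U = {1..m}"
  define V where "V = {m<..m + k}"
  have UV: "{1..m + k} = U \<union> V" "U \<inter> V = {}" by (auto simp: U_def V_def)
  have fin: "finite U" "finite V" by (simp_all add: U_def V_def)
  have shift: "(\<lambda>x. m + x) ` {1..k} = V"
    unfolding V_def by (subst image_add_atLeastAtMost) (auto simp: atLeastSucAtMost_greaterThanAtMost)
  have unshift: "(\<lambda>x. x - m) ` V = {1..k}"
    unfolding shift[symmetric] image_image by simp
  define J where "J p x = (if x \<in> U then fst p x else if x \<in> V then m + snd p (x - m) else x)"
    for p :: "(nat \<Rightarrow> nat) \<times> (nat \<Rightarrow> nat)" and x
  define R where "R h = ((\<lambda>x. if x \<in> U then h x else x), (\<lambda>y. if y \<in> {1..k} then h (m + y) - m else y))"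
    for h :: "nat \<Rightarrow> nat"
  have subU: "C \<subseteq> U" if "C \<in> \<pi>" for C using partition_on_block_subset[OF \<pi> that] by (simp add: U_def)
  have JU: "J p x = fst p x" if "x \<in> U" for p x using that by (simp add: J_def)
  have JV: "J p x = m + snd p (x - m)" if "x \<in> V" for p x using that UV(2) by (auto simp: J_def)
  have JC: "J p \<in> ?C" if p: "p \<in> ?A \<times> ?B" for p
  proof -
    obtain g l where pe: "p = (g, l)" by (cases p)
    have g: "g permutes U" "\<And>C. C \<in> \<pi> \<Longrightarrow> g ` C = C" "\<And>j. j \<in> U \<Longrightarrow> f (g j) = f j"
      using p by (auto simp: pe young_subgroup_def U_def)
    have l: "l permutes {1..k}" "\<And>j. j \<in> {1..k} \<Longrightarrow> f (m + l j) = f (m + j)"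
      using p by (auto simp: pe young_subgroup_def)
    have imC: "J p ` C = C" if "C \<in> \<pi>" for C
    proof -
      have "J p ` C = g ` C" using JU subU[OF that] by (intro image_cong) (auto simp: pe)
      then show ?thesis using g(2)[OF that] by simp
    qed
    have imU: "J p ` U = U"
    proof -
      have "J p ` U = g ` U" using JU by (intro image_cong) (auto simp: pe)
      then show ?thesis using permutes_image[OF g(1)] by simp
    qed
    have imV: "J p ` V = V"
    proof -
      have "J p ` V = (\<lambda>x. m + x) ` (l ` ((\<lambda>x. x - m) ` V))"
        unfolding image_image using JV by (intro image_cong) (auto simp: pe)
      also have "\<dots> = V" unfolding unshift permutes_image[OF l(1)] shift ..
      finally show ?thesis .
    qed
    have "J p permutes U \<union> V"
    proof (rule permutes_imageI)
      show "J p ` (U \<union> V) = U \<union> V" by (simp only: image_Un imU imV)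
    qed (use fin in \<open>simp_all add: J_def\<close>)
    moreover have "f (J p j) = f j" if "j \<in> U \<union> V" for j
    proof (cases "j \<in> U")
      case True then show ?thesis using g(3) JU by (simp add: pe)
    next
      case False
      then have j: "j \<in> V" using that by simp
      then have "j - m \<in> {1..k}" "m + (j - m) = j" by (auto simp: V_def)
      then show ?thesis using l(2)[of "j - m"] JV[OF j] by (simp add: pe)
    qed
    ultimately show ?thesis
      using imC imV unfolding young_subgroup_def UV(1) V_def[symmetric] by simp
  qed
  have RA: "R h \<in> ?A \<times> ?B" if h: "h \<in> ?C" for h
  proof -
    have hp: "h permutes U \<union> V" and hC: "\<And>C. C \<in> \<pi> \<Longrightarrow> h ` C = C" and hV: "h ` V = V"
      and hf: "\<And>j. j \<in> U \<union> V \<Longrightarrow> f (h j) = f j"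
      using h unfolding young_subgroup_def UV(1) V_def[symmetric] by simp_all
    have "U = \<Union>\<pi>" using partition_onD1[OF \<pi>] by (simp add: U_def)
    then have hU: "h ` U = U" using hC by (simp add: image_Union)
    have f1: "fst (R h) ` C = C" if "C \<in> \<pi>" for C
    proof -
      have "fst (R h) ` C = h ` C" using subU[OF that] by (intro image_cong) (auto simp: R_def)
      then show ?thesis using hC[OF that] by simp
    qed
    have "fst (R h) ` U = h ` U" by (intro image_cong) (auto simp: R_def)
    then have p1: "fst (R h) permutes U"
      by (intro permutes_imageI) (use fin hU in \<open>auto simp: R_def\<close>)
    have "snd (R h) ` {1..k} = (\<lambda>x. x - m) ` (h ` ((\<lambda>x. m + x) ` {1..k}))"
      unfolding image_image by (intro image_cong) (auto simp: R_def)
    also have "\<dots> = {1..k}" unfolding shift hV unshift ..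
    finally have i2: "snd (R h) ` {1..k} = {1..k}" .
    then have p2: "snd (R h) permutes {1..k}"
      by (intro permutes_imageI) (auto simp: R_def)
    have "f (fst (R h) j) = f j" if "j \<in> U" for j using that hf by (simp add: R_def)
    moreover have "f (m + snd (R h) j) = f (m + j)" if "j \<in> {1..k}" for j
    proof -
      have mj: "m + j \<in> V" using that by (auto simp: V_def)
      then have "h (m + j) \<in> V" using hV by blast
      then have "m + (h (m + j) - m) = h (m + j)" by (auto simp: V_def)
      then show ?thesis using hf[of "m + j"] mj that by (simp add: R_def)
    qed
    ultimately show ?thesis
      using p1 p2 f1 i2 unfolding young_subgroup_def U_def[symmetric] by (simp add: mem_Times_iff)
  qed
  have "bij_betw J (?A \<times> ?B) ?C"
  proof (rule bij_betw_byWitness[where f' = R])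
    show "\<forall>p\<in>?A \<times> ?B. R (J p) = p"
    proof
      fix p assume p: "p \<in> ?A \<times> ?B"
      obtain g l where pe: "p = (g, l)" by (cases p)
      have g: "g permutes U" and l: "l permutes {1..k}" using p by (auto simp: pe young_subgroup_def U_def)
      have "fst (R (J p)) = g"
        using permutes_not_in[OF g] by (auto simp: R_def J_def pe)
      moreover have "snd (R (J p)) = l"
      proof
        fix y
        show "snd (R (J p)) y = l y"
        proof (cases "y \<in> {1..k}")
          case True
          then have "m + y \<in> V" by (auto simp: V_def)
          then show ?thesis using True JV by (simp add: R_def pe)
        next
          case False
          then have "l y = y" by (rule permutes_not_in[OF l])
          then show ?thesis using False unfolding R_def snd_conv by (simp only: if_False)
        qed
      qed
      ultimately show "R (J p) = p" by (simp add: pe prod_eq_iff)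
    qed
    show "\<forall>h\<in>?C. J (R h) = h"
    proof
      fix h assume h: "h \<in> ?C"
      have hp: "h permutes U \<union> V" and hV: "h ` V = V"
        using h unfolding young_subgroup_def UV(1) V_def[symmetric] by simp_all
      show "J (R h) = h"
      proof
        fix x
        consider "x \<in> U" | "x \<in> V" "x \<notin> U" | "x \<notin> U \<union> V" by blast
        then show "J (R h) x = h x"
        proof cases
          case 1 then show ?thesis by (simp add: J_def R_def)
        next
          case 2
          then have "h x \<in> V" using hV by blast
          then have "m + (h x - m) = h x" "x - m \<in> {1..k}" "m + (x - m) = x" using 2 by (auto simp: V_def)
          then show ?thesis using JV[OF 2(1)] by (simp add: R_def)
        next
          case 3
          then show ?thesis using permutes_not_in[OF hp] by (simp add: J_def)
        qed
      qed
    qed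
    show "J ` (?A \<times> ?B) \<subseteq> ?C" using JC by (rule image_subsetI)
    show "R ` ?C \<subseteq> ?A \<times> ?B" using RA by (rule image_subsetI)
  qed
  then have "card (?A \<times> ?B) = card ?C" by (rule bij_betw_same_card)
  then show ?thesis by (simp add: card_cartesian_product)
qed

lemma partition_on_append_interval:
  fixes m k :: nat
  assumes "partition_on {1..m} \<pi>" "k \<ge> 1"
  shows "partition_on {1..m + k} (insert {m<..m + k} \<pi>)"
proof -
  have U: "\<Union>\<pi> = {1..m}" using partition_onD1[OF assms(1)] by simp
  have "{1..m + k} - {m<..m + k} = {1..m}" by auto
  then show ?thesis
    using assms by (subst partition_on_insert) (auto simp: U disjnt_def)
qed

lemma letter_take: "j \<in> {1..m} \<Longrightarrow> letter (take m w) j = letter w j"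
  unfolding letter_def by (intro nth_take) auto

lemma letter_drop: "j \<ge> 1 \<Longrightarrow> m \<le> length w \<Longrightarrow> letter (drop m w) j = letter w (m + j)"
  unfolding letter_def by (cases j) auto

text \<open>Only the splitting of a word after position \<open>m\<close> contributes to the product.\<close>

lemma h_partition_mult_interval:
  assumes \<pi>: "partition_on {1..m} \<pi>" and k: "k \<ge> 1"
  shows "h_partition m \<pi> * h_partition k {{1..k}} = h_partition (m + k) (insert {m<..m + k} \<pi>)"
proof (rule ncps_eqI)
  fix w
  have pk: "partition_on {1..k} {{1..k}}" using k by (intro partition_on_space) simp
  note pmk = partition_on_append_interval[OF \<pi> k]
  have z: "nc_coeff (h_partition m \<pi>) (take j w) * nc_coeff (h_partition k {{1..k}}) (drop j w) = 0"
    if "j \<le> length w" "j \<noteq> m" for j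
    using that by (simp add: nc_coeff_h_partition[OF \<pi>])
  show "nc_coeff (h_partition m \<pi> * h_partition k {{1..k}}) w =
      nc_coeff (h_partition (m + k) (insert {m<..m + k} \<pi>)) w"
  proof (cases "length w = m + k \<and> 0 \<notin> set w")
    case False
    have "nc_coeff (h_partition m \<pi>) (take j w) * nc_coeff (h_partition k {{1..k}}) (drop j w) = 0"
      if "j \<le> length w" for j
    proof (cases "j = m")
      case True
      have "set w = set (take j w) \<union> set (drop j w)" by (metis append_take_drop_id set_append)
      then show ?thesis
        using False True that unfolding nc_coeff_h_partition[OF \<pi>] nc_coeff_h_partition[OF pk] by auto
    qed (use z that in simp)
    then have "nc_coeff (h_partition m \<pi> * h_partition k {{1..k}}) w = 0"
      unfolding nc_coeff_mult by (intro sum.neutral) simp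
    moreover have "nc_coeff (h_partition (m + k) (insert {m<..m + k} \<pi>)) w = 0"
      using False unfolding nc_coeff_h_partition[OF pmk] by (simp only: if_False)
    ultimately show ?thesis by simp
  next
    case True
    have nz: "0 \<notin> set (take m w)" "0 \<notin> set (drop m w)"
      using True by (meson in_set_takeD in_set_dropD)+
    have "nc_coeff (h_partition m \<pi> * h_partition k {{1..k}}) w =
        (\<Sum>j\<in>{m}. nc_coeff (h_partition m \<pi>) (take j w) * nc_coeff (h_partition k {{1..k}}) (drop j w))"
      unfolding nc_coeff_mult by (rule sum.mono_neutral_right) (use True z in auto)
    also have "\<dots> = nc_coeff (h_partition m \<pi>) (take m w) * nc_coeff (h_partition k {{1..k}}) (drop m w)"
      by simp
    also have "nc_coeff (h_partition m \<pi>) (take m w) =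
        of_nat (card {g\<in>young_subgroup m \<pi>. \<forall>j\<in>{1..m}. letter w (g j) = letter w j})"
    proof -
      have "{g\<in>young_subgroup m \<pi>. \<forall>j\<in>{1..m}. letter (take m w) (g j) = letter (take m w) j} =
        {g\<in>young_subgroup m \<pi>. \<forall>j\<in>{1..m}. letter w (g j) = letter w j}"
      proof (rule Collect_cong)
        fix g
        show "(g \<in> young_subgroup m \<pi> \<and> (\<forall>j\<in>{1..m}. letter (take m w) (g j) = letter (take m w) j)) =
          (g \<in> young_subgroup m \<pi> \<and> (\<forall>j\<in>{1..m}. letter w (g j) = letter w j))"
        proof (rule conj_cong[OF refl], rule ball_cong[OF refl])
          fix j assume "g \<in> young_subgroup m \<pi>" and j: "j \<in> {1..m}"
          then have "g j \<in> {1..m}" unfolding young_subgroup_def by (simp only: mem_Collect_eq permutes_in_image)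
          then show "(letter (take m w) (g j) = letter (take m w) j) = (letter w (g j) = letter w j)"
            using j by (simp only: letter_take)
        qed
      qed
      then show ?thesis unfolding nc_coeff_h_partition[OF \<pi>] using True nz by simp
    qed
    also have "nc_coeff (h_partition k {{1..k}}) (drop m w) =
        of_nat (card {g\<in>young_subgroup k {{1..k}}. \<forall>j\<in>{1..k}. letter w (m + g j) = letter w (m + j)})"
    proof -
      have "{g\<in>young_subgroup k {{1..k}}. \<forall>j\<in>{1..k}. letter (drop m w) (g j) = letter (drop m w) j} =
        {g\<in>young_subgroup k {{1..k}}. \<forall>j\<in>{1..k}. letter w (m + g j) = letter w (m + j)}"
      proof (rule Collect_cong)
        fix g
        show "(g \<in> young_subgroup k {{1..k}} \<and> (\<forall>j\<in>{1..k}. letter (drop m w) (g j) = letter (drop m w) j)) =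
          (g \<in> young_subgroup k {{1..k}} \<and> (\<forall>j\<in>{1..k}. letter w (m + g j) = letter w (m + j)))"
        proof (rule conj_cong[OF refl], rule ball_cong[OF refl])
          fix j assume "g \<in> young_subgroup k {{1..k}}" and j: "j \<in> {1..k}"
          then have "g j \<in> {1..k}" unfolding young_subgroup_def by (simp only: mem_Collect_eq permutes_in_image)
          then show "(letter (drop m w) (g j) = letter (drop m w) j) = (letter w (m + g j) = letter w (m + j))"
            using j True by (simp add: letter_drop)
        qed
      qed
      then show ?thesis unfolding nc_coeff_h_partition[OF pk] using True nz by simp
    qed
    finally show ?thesis
      using True unfolding nc_coeff_h_partition[OF pmk] card_stabiliser_join[OF \<pi>] by simp
  qed
qed

lemma interval_partition_snoc:
  "interval_partition (c @ [k]) = insert {sum_list c<..sum_list c + k} (interval_partition c)"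
proof -
  have "{sum_list (take l (c @ [k])) + 1..sum_list (take (Suc l) (c @ [k]))}
      = {sum_list (take l c) + 1..sum_list (take (Suc l) c)}" if "l < length c" for l
    using that by simp
  then show ?thesis
    unfolding interval_partition_def
    by (simp add: lessThan_Suc atLeastSucAtMost_greaterThanAtMost)
qed

lemma partition_on_interval_partition:
  "partition_on {1..sum_list c} (interval_partition c - {{}})"
proof (induction c rule: rev_induct)
  case Nil
  then show ?case by (simp add: interval_partition_def partition_on_empty)
next
  case (snoc k c)
  show ?case
  proof (cases "k = 0")
    case True
    then show ?thesis using snoc by (simp add: interval_partition_snoc)
  next
    case False
    then have "insert {sum_list c<..sum_list c + k} (interval_partition c) - {{}}
      = insert {sum_list c<..sum_list c + k} (interval_partition c - {{}})" by auto
    then show ?thesis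
      using partition_on_append_interval[OF snoc, of k] False by (simp add: interval_partition_snoc)
  qed
qed

text \<open>Zeros in \<open>c\<close> are admitted: they contribute the factor \<open>1\<close> on the left and an empty interval,
  which is discarded, on the right.\<close>

lemma prod_list_h_single:
  "prod_list (map (\<lambda>k. h_single (int k)) c) = h_partition (sum_list c) (interval_partition c - {{}})"
proof (induction c rule: rev_induct)
  case Nil
  have "nc_coeff (h_partition 0 {}) w = nc_coeff 1 w" for w
  proof -
    have "young_subgroup 0 {} = {id}" by (auto simp: young_subgroup_def permutes_empty)
    then show ?thesis
      using nc_coeff_h_partition[of 0 "{}" w] by (simp add: partition_on_empty)
  qed
  then show ?case by (simp add: interval_partition_def ncps_eqI)
next
  case (snoc k c)
  let ?\<pi> = "interval_partition c - {{}}"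
  show ?case
  proof (cases "k = 0")
    case True
    then show ?thesis using snoc by (simp add: interval_partition_snoc h_single_def)
  next
    case False
    then have "insert {sum_list c<..sum_list c + k} (interval_partition c) - {{}}
      = insert {sum_list c<..sum_list c + k} ?\<pi>" by auto
    then show ?thesis
      using h_partition_mult_interval[OF partition_on_interval_partition, of k c] False snoc
      by (simp add: interval_partition_snoc h_single_def)
  qed
qed


section \<open>The action of the symmetric group\<close>

lemma perm_partition_in_set_partitions:
  assumes \<delta>: "\<delta> permutes {1..n}" and \<pi>: "\<pi> \<in> set_partitions n"
  shows "perm_partition \<delta> \<pi> \<in> set_partitions n"
proof -
  have p: "partition_on {1..n} \<pi>" using \<pi> by (simp add: set_partitions_def)
  have "partition_on (\<delta> ` {1..n}) ((`) \<delta> ` \<pi> - {{}})"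
    by (rule partition_on_inj_image[OF p permutes_inj_on[OF \<delta>]])
  moreover have "(`) \<delta> ` \<pi> - {{}} = perm_partition \<delta> \<pi>"
    using partition_onD3[OF p] by (auto simp: perm_partition_def)
  ultimately show ?thesis unfolding set_partitions_def permutes_image[OF \<delta>] by simp
qed

lemma perm_partition_comp: "perm_partition f (perm_partition g \<pi>) = perm_partition (f \<circ> g) \<pi>"
  by (simp add: perm_partition_def image_image image_comp)

lemma perm_partition_id [simp]: "perm_partition id \<pi> = \<pi>"
  by (simp add: perm_partition_def)

lemma nc_scale_sum_left: "(\<Sum>e\<in>A. nc_scale (x e) f) = nc_scale (\<Sum>e\<in>A. x e) f"
  by (rule ncps_eqI) (simp add: sum_distrib_right)

lemma collect_combination:
  assumes "finite E" "finite S" "p ` E \<subseteq> S"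
  shows "(\<Sum>e\<in>E. nc_scale (x e) (H (p e))) = (\<Sum>\<pi>\<in>S. nc_scale (\<Sum>e\<in>{e\<in>E. p e = \<pi>}. x e) (H \<pi>))"
proof -
  have "(\<Sum>e\<in>E. nc_scale (x e) (H (p e))) = (\<Sum>\<pi>\<in>S. \<Sum>e\<in>{e\<in>E. p e = \<pi>}. nc_scale (x e) (H (p e)))"
    by (rule sum.group[OF assms, symmetric])
  also have "\<dots> = (\<Sum>\<pi>\<in>S. \<Sum>e\<in>{e\<in>E. p e = \<pi>}. nc_scale (x e) (H \<pi>))"
    by (intro sum.cong refl) auto
  finally show ?thesis by (simp only: nc_scale_sum_left)
qed

lemma h_coefficients_unique:
  assumes "(\<Sum>\<pi>\<in>set_partitions n. nc_scale (c \<pi>) (h_partition n \<pi>)) =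
      (\<Sum>\<pi>\<in>set_partitions n. nc_scale (d \<pi>) (h_partition n \<pi>))"
    and "\<pi> \<in> set_partitions n"
  shows "c \<pi> = d \<pi>"
proof -
  have "(\<Sum>\<pi>\<in>set_partitions n. nc_scale (c \<pi> - d \<pi>) (h_partition n \<pi>)) = 0"
    using assms(1) by (simp add: ncps.scale_left_diff_distrib sum_subtractf)
  from h_independent[OF this assms(2)] show ?thesis by simp
qed

lemma h_combination_unique:
  assumes "finite E" "p ` E \<subseteq> set_partitions n" "finite E'" "p' ` E' \<subseteq> set_partitions n"
    and "(\<Sum>e\<in>E. nc_scale (x e) (h_partition n (p e))) = (\<Sum>e\<in>E'. nc_scale (x' e) (h_partition n (p' e)))"
    and "\<pi> \<in> set_partitions n"
  shows "(\<Sum>e\<in>{e\<in>E. p e = \<pi>}. x e) = (\<Sum>e\<in>{e\<in>E'. p' e = \<pi>}. x' e)"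
  using assms(5)
  unfolding collect_combination[OF assms(1) finite_set_partitions assms(2)]
    collect_combination[OF assms(3) finite_set_partitions assms(4)]
  by (rule h_coefficients_unique[OF _ assms(6)])

text \<open>Linear independence makes the coordinates chosen in \<open>h_coords\<close> the expected ones, also
  if several \<open>e\<close> share the same partition \<open>p e\<close>.\<close>

lemma ncsym_act_combination:
  assumes "finite E" "p ` E \<subseteq> set_partitions n"
  shows "ncsym_act n \<delta> (\<Sum>e\<in>E. nc_scale (x e) (h_partition n (p e))) =
    (\<Sum>e\<in>E. nc_scale (x e) (h_partition n (perm_partition \<delta> (p e))))"
proof -
  define c where "c \<pi> = (\<Sum>e\<in>{e\<in>E. p e = \<pi>}. x e)" for \<pi>
  define f where "f = (\<Sum>e\<in>E. nc_scale (x e) (h_partition n (p e)))"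
  have f: "f = (\<Sum>\<pi>\<in>set_partitions n. nc_scale (c \<pi>) (h_partition n \<pi>))"
    unfolding f_def c_def by (rule collect_combination[OF assms(1) finite_set_partitions assms(2)])
  then have "f = (\<Sum>\<pi>\<in>set_partitions n. nc_scale (h_coords n f \<pi>) (h_partition n \<pi>))"
    unfolding h_coords_def
    by (rule someI[where P = "\<lambda>c. f = (\<Sum>\<pi>\<in>set_partitions n. nc_scale (c \<pi>) (h_partition n \<pi>))"])
  then have "h_coords n f \<pi> = c \<pi>" if "\<pi> \<in> set_partitions n" for \<pi>
    using h_coefficients_unique[OF _ that] f by metis
  then have "ncsym_act n \<delta> f =
      (\<Sum>\<pi>\<in>set_partitions n. nc_scale (c \<pi>) (h_partition n (perm_partition \<delta> \<pi>)))"
    unfolding ncsym_act_def by simp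
  also have "\<dots> = (\<Sum>e\<in>E. nc_scale (x e) (h_partition n (perm_partition \<delta> (p e))))"
    unfolding c_def
    by (rule collect_combination[OF assms(1) finite_set_partitions assms(2), symmetric])
  finally show ?thesis unfolding f_def .
qed


section \<open>Expansion of the Jacobi--Trudi determinant\<close>

text \<open>The term of \<open>\<epsilon>\<close> in the determinant of \<open>K\<close> cuts \<open>{1..n}\<close> at the partial sums of its entries.  An entry
  \<open>0\<close> yields an empty row block, which keeps row blocks indexed by the rows of the matrix and is only
  removed in the partition.\<close>

definition partial_sum :: "(nat \<Rightarrow> nat \<Rightarrow> int) \<Rightarrow> (nat \<Rightarrow> nat) \<Rightarrow> nat \<Rightarrow> nat" where
  "partial_sum K \<epsilon> m = (\<Sum>i\<in>{1..m}. nat (K i (\<epsilon> i)))"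

definition row_block :: "(nat \<Rightarrow> nat \<Rightarrow> int) \<Rightarrow> (nat \<Rightarrow> nat) \<Rightarrow> nat \<Rightarrow> nat set" where
  "row_block K \<epsilon> i = {partial_sum K \<epsilon> (i - 1)<..partial_sum K \<epsilon> i}"

definition jt_partition :: "nat \<Rightarrow> (nat \<Rightarrow> nat \<Rightarrow> int) \<Rightarrow> (nat \<Rightarrow> nat) \<Rightarrow> nat set set" where
  "jt_partition r K \<epsilon> = row_block K \<epsilon> ` {1..r} - {{}}"

definition jt_perms :: "nat \<Rightarrow> (nat \<Rightarrow> nat \<Rightarrow> int) \<Rightarrow> (nat \<Rightarrow> nat) set" where
  "jt_perms r K = {\<epsilon>. \<epsilon> permutes {1..r} \<and> (\<forall>i\<in>{1..r}. K i (\<epsilon> i) \<ge> 0)}"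

definition jt_weight :: "nat \<Rightarrow> (nat \<Rightarrow> nat \<Rightarrow> int) \<Rightarrow> (nat \<Rightarrow> nat) \<Rightarrow> rat" where
  "jt_weight r K \<epsilon> = of_int (sign \<epsilon>) * (\<Prod>i\<in>{1..r}. 1 / fact (nat (K i (\<epsilon> i))))"

lemma finite_jt_perms [simp]: "finite (jt_perms r K)"
  by (rule finite_subset[of _ "{\<epsilon>. \<epsilon> permutes {1..r}}"]) (auto simp: jt_perms_def finite_permutations)

lemma partial_sum_0 [simp]: "partial_sum K \<epsilon> 0 = 0"
  by (simp add: partial_sum_def)

lemma partial_sum_Suc: "partial_sum K \<epsilon> (Suc m) = partial_sum K \<epsilon> m + nat (K (Suc m) (\<epsilon> (Suc m)))"
  by (simp add: partial_sum_def)

lemma partial_sum_minus_1: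
  "i \<ge> 1 \<Longrightarrow> partial_sum K \<epsilon> i = partial_sum K \<epsilon> (i - 1) + nat (K i (\<epsilon> i))"
  by (cases i) (auto simp: partial_sum_Suc)

lemma sum_list_take_upt:
  "l \<le> r \<Longrightarrow> sum_list (take l (map f [1..<Suc r])) = (\<Sum>i\<in>{1..l}. f i)"
  by (simp add: take_map take_upt interv_sum_list_conv_sum_set_nat atLeastLessThanSuc_atLeastAtMost del: upt_Suc)

lemma interval_partition_map:
  "interval_partition (map f [1..<Suc r]) =
    (\<lambda>i. {(\<Sum>k\<in>{1..i - 1}. f k)<..(\<Sum>k\<in>{1..i}. f k)}) ` {1..r}"
proof -
  have "interval_partition (map f [1..<Suc r]) =
      (\<lambda>l. {(\<Sum>k\<in>{1..l}. f k)<..(\<Sum>k\<in>{1..Suc l}. f k)}) ` {..<r}"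
    unfolding interval_partition_def
    by (intro image_cong) (simp_all only: length_map length_upt sum_list_take_upt atLeastSucAtMost_greaterThanAtMost
      Suc_eq_plus1[symmetric] diff_Suc_1 lessThan_iff Suc_le_eq less_imp_le)
  also have "\<dots> = (\<lambda>i. {(\<Sum>k\<in>{1..i - 1}. f k)<..(\<Sum>k\<in>{1..i}. f k)}) ` (Suc ` {..<r})"
    by (simp add: image_image)
  also have "Suc ` {..<r} = {1..r}" by (simp add: image_Suc_lessThan)
  finally show ?thesis .
qed

lemma jt_partition_eq_interval_partition:
  "jt_partition r K \<epsilon> = interval_partition (map (\<lambda>i. nat (K i (\<epsilon> i))) [1..<Suc r]) - {{}}"
  unfolding interval_partition_map jt_partition_def row_block_def partial_sum_def ..

lemma jt_partition_in_set_partitions: "jt_partition r K \<epsilon> \<in> set_partitions (partial_sum K \<epsilon> r)"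
proof -
  let ?c = "map (\<lambda>i. nat (K i (\<epsilon> i))) [1..<Suc r]"
  have "sum_list (take r ?c) = partial_sum K \<epsilon> r"
    unfolding partial_sum_def by (rule sum_list_take_upt) simp
  then have "sum_list ?c = partial_sum K \<epsilon> r" by (simp del: upt_Suc)
  then show ?thesis
    using partition_on_interval_partition[of ?c]
    by (simp only: set_partitions_def jt_partition_eq_interval_partition mem_Collect_eq)
qed

lemma nc_scale_mult: "nc_scale a f * nc_scale b g = nc_scale (a * b) (f * g)"
  by (rule ncps_eqI) (simp add: nc_coeff_mult sum_distrib_left mult_ac)

lemma prod_list_nc_scale:
  "prod_list (map (\<lambda>i. nc_scale (x i) (f i)) is) = nc_scale (prod_list (map x is)) (prod_list (map f is))"
  by (induction "is") (auto simp: nc_scale_mult)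

lemma of_int_mult_nc_scale: "of_int z * nc_scale x f = nc_scale (of_int z * x) f"
proof -
  have "of_int z = nc_scale (of_int z) (1 :: ncps)"
  proof (induction z rule: int_induct[of _ 0])
    case base show ?case by simp
  next
    case (step1 i) then show ?case by (simp add: ncps.scale_left_distrib)
  next
    case (step2 i) then show ?case by (simp add: ncps.scale_left_diff_distrib)
  qed
  then show ?thesis using nc_scale_mult[of "of_int z" 1 x f] by simp
qed

lemma prod_list_eq_0: "0 \<in> set fs \<Longrightarrow> prod_list (fs :: 'a::semiring_1 list) = 0"
  by (induction fs) auto

text \<open>A term with a negative entry contains a factor \<open>0\<close>; for the others the product formula applies.\<close>

lemma nc_det_expansion:
  "nc_det r (\<lambda>i j. nc_scale (1 / fact (nat (K i j))) (h_single (K i j))) =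
    (\<Sum>\<epsilon>\<in>jt_perms r K. nc_scale (jt_weight r K \<epsilon>) (h_partition (partial_sum K \<epsilon> r) (jt_partition r K \<epsilon>)))"
proof -
  let ?P = "{\<epsilon>. \<epsilon> permutes {1..r}}"
  let ?t = "\<lambda>\<epsilon>. of_int (sign \<epsilon>) * prod_list (map (\<lambda>i. nc_scale (1 / fact (nat (K i (\<epsilon> i)))) (h_single (K i (\<epsilon> i)))) [1..<Suc r])"
  have zero: "?t \<epsilon> = 0" if "\<epsilon> \<in> ?P - jt_perms r K" for \<epsilon>
  proof -
    have "\<not> (\<forall>i\<in>{1..r}. K i (\<epsilon> i) \<ge> 0)" using that unfolding jt_perms_def by blast
    then obtain i where i: "i \<in> {1..r}" "K i (\<epsilon> i) < 0" by (meson linorder_not_le)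
    then have "nc_scale (1 / fact (nat (K i (\<epsilon> i)))) (h_single (K i (\<epsilon> i))) = 0"
      by (simp add: h_single_def)
    moreover have "i \<in> set [1..<Suc r]" using i by auto
    ultimately have "0 \<in> set (map (\<lambda>i. nc_scale (1 / fact (nat (K i (\<epsilon> i)))) (h_single (K i (\<epsilon> i)))) [1..<Suc r])"
      by (metis (no_types, lifting) image_eqI set_map)
    then show ?thesis using prod_list_eq_0 by (metis mult_zero_right)
  qed
  have "nc_det r (\<lambda>i j. nc_scale (1 / fact (nat (K i j))) (h_single (K i j))) = sum ?t ?P"
    by (simp add: nc_det_def)
  also have "\<dots> = sum ?t (jt_perms r K)"
    by (rule sum.mono_neutral_right) (use zero in \<open>auto simp: jt_perms_def finite_permutations\<close>)
  also have "\<dots> = (\<Sum>\<epsilon>\<in>jt_perms r K. nc_scale (jt_weight r K \<epsilon>) (h_partition (partial_sum K \<epsilon> r) (jt_partition r K \<epsilon>)))"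
  proof (rule sum.cong[OF refl])
    fix \<epsilon> assume \<epsilon>: "\<epsilon> \<in> jt_perms r K"
    let ?c = "map (\<lambda>i. nat (K i (\<epsilon> i))) [1..<Suc r]"
    have "map (\<lambda>i. h_single (K i (\<epsilon> i))) [1..<Suc r] = map (\<lambda>k. h_single (int k)) ?c"
      using \<epsilon> by (simp add: jt_perms_def del: upt_Suc)
    then have "prod_list (map (\<lambda>i. h_single (K i (\<epsilon> i))) [1..<Suc r]) =
        h_partition (sum_list ?c) (interval_partition ?c - {{}})"
      using prod_list_h_single[of ?c] by (simp only:)
    moreover have "sum_list ?c = partial_sum K \<epsilon> r"
      using sum_list_take_upt[of r r "\<lambda>i. nat (K i (\<epsilon> i))"] by (simp add: partial_sum_def del: upt_Suc)
    moreover have "prod_list (map (\<lambda>i. 1 / fact (nat (K i (\<epsilon> i)))) [1..<Suc r])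
        = (\<Prod>i\<in>{1..r}. 1 / fact (nat (K i (\<epsilon> i))) :: rat)"
      by (subst prod.distinct_set_conv_list[symmetric])
         (simp_all only: distinct_upt set_upt atLeastLessThanSuc_atLeastAtMost)
    ultimately show "?t \<epsilon> = nc_scale (jt_weight r K \<epsilon>) (h_partition (partial_sum K \<epsilon> r) (jt_partition r K \<epsilon>))"
      unfolding prod_list_nc_scale of_int_mult_nc_scale jt_partition_eq_interval_partition jt_weight_def
      by simp
  qed
  finally show ?thesis .
qed


section \<open>The set partitions occurring in a determinant\<close>

lemma partial_sum_mono: "m \<le> m' \<Longrightarrow> partial_sum K \<epsilon> m \<le> partial_sum K \<epsilon> m'"
  unfolding partial_sum_def by (rule sum_mono2) auto

lemma partial_sum_cong: "(\<And>i. i \<in> {1..m} \<Longrightarrow> \<epsilon> i = \<epsilon>' i) \<Longrightarrow> partial_sum K \<epsilon> m = partial_sum K \<epsilon>' m"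
  unfolding partial_sum_def by (intro sum.cong) auto

lemma row_block_unique:
  assumes "x \<in> row_block K \<epsilon> i" "x \<in> row_block K \<epsilon> j"
  shows "i = j"
proof (rule ccontr)
  assume "i \<noteq> j"
  then consider "i \<le> j - 1" | "j \<le> i - 1" by linarith
  then show False
  proof cases
    case 1
    then show False using partial_sum_mono[OF 1, of K \<epsilon>] assms by (auto simp: row_block_def)
  next
    case 2
    then show False using partial_sum_mono[OF 2, of K \<epsilon>] assms by (auto simp: row_block_def)
  qed
qed

lemma finite_row_block [simp]: "finite (row_block K \<epsilon> i)"
  by (simp add: row_block_def)

lemma card_row_block: "i \<ge> 1 \<Longrightarrow> card (row_block K \<epsilon> i) = nat (K i (\<epsilon> i))"
  using partial_sum_minus_1[of i K \<epsilon>] by (simp add: row_block_def)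

lemma row_block_empty_iff: "i \<ge> 1 \<Longrightarrow> row_block K \<epsilon> i = {} \<longleftrightarrow> K i (\<epsilon> i) \<le> 0"
  using card_row_block[of i K \<epsilon>] by (metis card_0_eq finite_row_block nat_eq_iff2 nat_le_0 le_refl nat_0_iff)

lemma first_in_row_block: "i \<ge> 1 \<Longrightarrow> K i (\<epsilon> i) > 0 \<Longrightarrow> Suc (partial_sum K \<epsilon> (i - 1)) \<in> row_block K \<epsilon> i"
  using partial_sum_minus_1[of i K \<epsilon>] by (simp add: row_block_def)

lemma last_in_row_block: "i \<ge> 1 \<Longrightarrow> K i (\<epsilon> i) > 0 \<Longrightarrow> partial_sum K \<epsilon> i \<in> row_block K \<epsilon> i"
  using partial_sum_minus_1[of i K \<epsilon>] by (simp add: row_block_def)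

lemma row_block_in_jt_partition:
  "i \<in> {1..r} \<Longrightarrow> K i (\<epsilon> i) > 0 \<Longrightarrow> row_block K \<epsilon> i \<in> jt_partition r K \<epsilon>"
  using row_block_empty_iff[of i K \<epsilon>] by (auto simp: jt_partition_def)

lemma jt_partition_block_unique:
  assumes "B \<in> jt_partition r K \<epsilon>" "C \<in> jt_partition r K \<epsilon>" "x \<in> B" "x \<in> C"
  shows "B = C"
proof -
  obtain i j where "B = row_block K \<epsilon> i" "C = row_block K \<epsilon> j"
    using assms(1,2) unfolding jt_partition_def by blast
  then show ?thesis using row_block_unique[of x K \<epsilon> i j] assms(3,4) by simp
qed

text \<open>A statistic of set partitions that is invariant under the action of permutations.\<close>

definition square_sum :: "nat set set \<Rightarrow> nat" where
  "square_sum \<pi> = (\<Sum>B\<in>\<pi>. (card B)\<^sup>2)"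

lemma square_sum_jt_partition:
  "square_sum (jt_partition r K \<epsilon>) = (\<Sum>i\<in>{1..r}. (nat (K i (\<epsilon> i)))\<^sup>2)"
proof -
  have "square_sum (jt_partition r K \<epsilon>) = (\<Sum>B\<in>row_block K \<epsilon> ` {1..r}. (card B)\<^sup>2)"
    unfolding square_sum_def jt_partition_def by (rule sum.mono_neutral_left) auto
  also have "\<dots> = sum ((\<lambda>B. (card B)\<^sup>2) \<circ> row_block K \<epsilon>) {1..r}"
  proof (rule sum.reindex_nontrivial)
    fix x y assume xy: "x \<noteq> y" "row_block K \<epsilon> x = row_block K \<epsilon> y"
    then have "row_block K \<epsilon> x = {}" using row_block_unique by blast
    then show "(card (row_block K \<epsilon> x))\<^sup>2 = 0" by simp
  qed simp
  also have "\<dots> = (\<Sum>i\<in>{1..r}. (nat (K i (\<epsilon> i)))\<^sup>2)"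
    by (intro sum.cong refl) (simp add: card_row_block)
  finally show ?thesis .
qed

text \<open>Having \<open>r\<close> blocks means that no row block is empty.\<close>

lemma card_jt_partition_full:
  assumes "card (jt_partition r K \<epsilon>) = r" "i \<in> {1..r}"
  shows "K i (\<epsilon> i) > 0"
proof (rule ccontr)
  assume "\<not> ?thesis"
  then have e: "row_block K \<epsilon> i = {}" using row_block_empty_iff[of i K \<epsilon>] assms(2) by simp
  have "jt_partition r K \<epsilon> \<subseteq> row_block K \<epsilon> ` ({1..r} - {i})"
    using e by (auto simp: jt_partition_def)
  then have "r \<le> card (row_block K \<epsilon> ` ({1..r} - {i}))"
    using assms(1) card_mono by (metis finite_Diff finite_atLeastAtMost finite_imageI)
  also have "\<dots> \<le> card ({1..r} - {i})" by (rule card_image_le) simp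
  also have "\<dots> < r" using assms(2) by simp
  finally show False by simp
qed

lemma card_jt_partition:
  assumes "\<And>i. i \<in> {1..r} \<Longrightarrow> K i (\<epsilon> i) > 0"
  shows "card (jt_partition r K \<epsilon>) = r"
proof -
  have ne: "row_block K \<epsilon> i \<noteq> {}" if "i \<in> {1..r}" for i
    using assms[OF that] row_block_empty_iff[of i K \<epsilon>] that by simp
  have "inj_on (row_block K \<epsilon>) {1..r}"
    using row_block_unique ne unfolding inj_on_def by (metis all_not_in_conv)
  moreover have "jt_partition r K \<epsilon> = row_block K \<epsilon> ` {1..r}"
    using ne by (auto simp: jt_partition_def)
  ultimately show ?thesis by (simp add: card_image)
qed

text \<open>The coefficient of \<open>h\<^sub>\<pi>\<close> in the determinant; terms of different permutations with the
  same partition may cancel, so a nonzero coefficient needs an argument.\<close>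

definition jt_coeff :: "nat \<Rightarrow> (nat \<Rightarrow> nat \<Rightarrow> int) \<Rightarrow> nat set set \<Rightarrow> rat" where
  "jt_coeff r K \<pi> = (\<Sum>\<epsilon>\<in>{\<epsilon>\<in>jt_perms r K. jt_partition r K \<epsilon> = \<pi>}. jt_weight r K \<epsilon>)"

lemma jt_coeff_nonzero_ex:
  assumes "jt_coeff r K \<pi> \<noteq> 0"
  obtains \<epsilon> where "\<epsilon> \<in> jt_perms r K" "jt_partition r K \<epsilon> = \<pi>"
proof -
  have "{\<epsilon>\<in>jt_perms r K. jt_partition r K \<epsilon> = \<pi>} \<noteq> {}"
    using assms unfolding jt_coeff_def by (metis sum.empty)
  then show ?thesis using that by blast
qed

lemma jt_coeff_unique_nonzero:
  assumes "\<epsilon> \<in> jt_perms r K"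
    and "\<And>\<epsilon>'. \<epsilon>' \<in> jt_perms r K \<Longrightarrow> jt_partition r K \<epsilon>' = jt_partition r K \<epsilon> \<Longrightarrow> \<epsilon>' = \<epsilon>"
  shows "jt_coeff r K (jt_partition r K \<epsilon>) \<noteq> 0"
proof -
  have "{\<epsilon>'\<in>jt_perms r K. jt_partition r K \<epsilon>' = jt_partition r K \<epsilon>} = {\<epsilon>}"
    using assms by blast
  then show ?thesis by (simp add: jt_coeff_def jt_weight_def)
qed


section \<open>Jacobi--Trudi matrices of connected shapes\<close>

text \<open>The entries \<open>\<lambda>\<^sub>i - \<mu>\<^sub>j - i + j\<close> split into \<open>a\<^sub>i = \<lambda>\<^sub>i - i\<close> and \<open>b\<^sub>j = j - \<mu>\<^sub>j\<close>.  The last two assumptions express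
  that rows are nonempty and that consecutive rows overlap.\<close>

locale jt_matrix =
  fixes r :: nat and K :: "nat \<Rightarrow> nat \<Rightarrow> int" and a b :: "nat \<Rightarrow> int"
  assumes K_eq: "K i j = a i + b j"
    and a_less: "1 \<le> i \<Longrightarrow> i < j \<Longrightarrow> j \<le> r \<Longrightarrow> a j < a i"
    and b_less: "1 \<le> i \<Longrightarrow> i < j \<Longrightarrow> j \<le> r \<Longrightarrow> b i < b j"
    and diag_pos: "i \<in> {1..r} \<Longrightarrow> K i i > 0"
    and sub_nonneg: "1 \<le> i \<Longrightarrow> i < r \<Longrightarrow> K (Suc i) i \<ge> 0"
begin

abbreviation P :: "nat \<Rightarrow> nat" where "P \<equiv> partial_sum K id"

lemma id_in_jt_perms: "id \<in> jt_perms r K"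
  using diag_pos by (auto simp: jt_perms_def permutes_id less_imp_le)

lemma jt_perms_in: "\<epsilon> \<in> jt_perms r K \<Longrightarrow> i \<in> {1..r} \<Longrightarrow> \<epsilon> i \<in> {1..r}"
  unfolding jt_perms_def by (simp only: mem_Collect_eq permutes_in_image)

lemma jt_perms_nonneg: "\<epsilon> \<in> jt_perms r K \<Longrightarrow> i \<in> {1..r} \<Longrightarrow> K i (\<epsilon> i) \<ge> 0"
  unfolding jt_perms_def by blast

lemma jt_perms_eq_iff: "\<epsilon> \<in> jt_perms r K \<Longrightarrow> \<epsilon> i = \<epsilon> j \<longleftrightarrow> i = j"
  unfolding jt_perms_def using permutes_inj by (blast dest: injD)

lemma K_right_mono: "1 \<le> j \<Longrightarrow> j \<le> j' \<Longrightarrow> j' \<le> r \<Longrightarrow> K i j \<le> K i j'"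
  using b_less[of j j'] by (cases "j = j'") (auto simp: K_eq)

lemma K_right_inj:
  assumes "j \<in> {1..r}" "j' \<in> {1..r}" "K i j = K i j'"
  shows "j = j'"
proof (rule ccontr)
  assume "j \<noteq> j'"
  then consider "j < j'" | "j' < j" by linarith
  then show False using b_less[of j j'] b_less[of j' j] assms by cases (auto simp: K_eq)
qed

lemma int_partial_sum:
  assumes "\<epsilon> \<in> jt_perms r K" "m \<le> r"
  shows "int (partial_sum K \<epsilon> m) = (\<Sum>i\<in>{1..m}. a i) + (\<Sum>i\<in>{1..m}. b (\<epsilon> i))"
proof -
  have "int (partial_sum K \<epsilon> m) = (\<Sum>i\<in>{1..m}. K i (\<epsilon> i))"
    unfolding partial_sum_def of_nat_sum using assms by (intro sum.cong) (auto simp: jt_perms_def)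
  then show ?thesis by (simp add: K_eq sum.distrib)
qed

text \<open>The values \<open>a\<close> and \<open>b\<close> picked up in the first \<open>m\<close> rows are those of the diagonal, in another order.\<close>

lemma partial_sum_stable:
  assumes "\<epsilon> \<in> jt_perms r K" "m \<le> r" "\<epsilon> ` {1..m} = {1..m}"
  shows "partial_sum K \<epsilon> m = P m"
proof -
  have "inj_on \<epsilon> {1..m}" using assms(1) by (auto simp: jt_perms_def permutes_inj_on)
  then have "(\<Sum>i\<in>{1..m}. b (\<epsilon> i)) = (\<Sum>i\<in>{1..m}. b i)"
    using sum.reindex[of \<epsilon> "{1..m}" b] assms(3) by simp
  then show ?thesis
    using int_partial_sum[OF assms(1,2)] int_partial_sum[OF id_in_jt_perms assms(2)] by simp
qed

lemma partial_sum_total: "\<epsilon> \<in> jt_perms r K \<Longrightarrow> partial_sum K \<epsilon> r = P r"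
  by (rule partial_sum_stable) (auto simp: jt_perms_def permutes_image simp del: One_nat_def)

text \<open>Passing from \<open>{1..m}\<close> to \<open>S\<close> exchanges some indices \<open>\<le> m\<close> for equally many indices \<open>> m\<close>, each of which
  carries a value exceeding all the values given up.\<close>

lemma sum_b_least:
  assumes "S \<subseteq> {1..r}" "card S = m"
  shows "(\<Sum>x\<in>{1..m}. b x) \<le> (\<Sum>x\<in>S. b x)"
    and "S \<noteq> {1..m} \<Longrightarrow> (\<Sum>x\<in>{1..m}. b x) < (\<Sum>x\<in>S. b x)"
proof -
  let ?T = "{1..m}"
  have finS: "finite S" using assms(1) finite_subset by blast
  have "m \<le> r" using assms card_mono[OF _ assms(1)] by simp
  have c: "card (S - ?T) = card (?T - S)"
    using card_Diff_subset_Int[of S ?T] card_Diff_subset_Int[of ?T S] finS assms(2)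
    by (simp add: Int_commute)
  have big: "b x \<ge> b m + 1" if "x \<in> S - ?T" for x
  proof (cases "m = 0")
    case True
    then have "S = {}" using assms(2) finS by simp
    then show ?thesis using that by simp
  next
    case False
    then show ?thesis using b_less[of m x] that assms(1) by fastforce
  qed
  have small: "b x \<le> b m" if "x \<in> ?T - S" for x
    using b_less[of x m] that \<open>m \<le> r\<close> by (cases "x = m") auto
  have 1: "(\<Sum>x\<in>S - ?T. b x) \<ge> of_nat (card (S - ?T)) * (b m + 1)"
    by (rule sum_bounded_below) (rule big)
  have 2: "(\<Sum>x\<in>?T - S. b x) \<le> of_nat (card (?T - S)) * b m"
    by (rule sum_bounded_above) (rule small)
  have s1: "(\<Sum>x\<in>S. b x) = (\<Sum>x\<in>S \<inter> ?T. b x) + (\<Sum>x\<in>S - ?T. b x)"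
    using sum.Int_Diff[OF finS] by blast
  have s2: "(\<Sum>x\<in>?T. b x) = (\<Sum>x\<in>S \<inter> ?T. b x) + (\<Sum>x\<in>?T - S. b x)"
    using sum.Int_Diff[of ?T b S] by (simp add: Int_commute)
  have 3: "(\<Sum>x\<in>?T. b x) + of_nat (card (S - ?T)) \<le> (\<Sum>x\<in>S. b x)"
    using 1 2 s1 s2 c by (simp add: algebra_simps)
  then show "(\<Sum>x\<in>?T. b x) \<le> (\<Sum>x\<in>S. b x)" by linarith
  assume "S \<noteq> ?T"
  then have "\<not> S \<subseteq> ?T"
    using card_subset_eq[of ?T S] assms(2) by auto
  then have "card (S - ?T) > 0" using finS by (simp add: card_gt_0_iff)
  then show "(\<Sum>x\<in>?T. b x) < (\<Sum>x\<in>S. b x)" using 3 by linarith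
qed

lemma permutes_eq_idI:
  assumes "\<epsilon> permutes {1..r}" "\<And>m. m < r \<Longrightarrow> \<epsilon> ` {1..m} = {1..m}"
  shows "\<epsilon> = id"
proof
  fix i
  show "\<epsilon> i = id i"
  proof (cases "i \<in> {1..r}")
    case True
    have st: "\<epsilon> ` {1..m} = {1..m}" if "m \<le> r" for m
      using assms that permutes_image[OF assms(1)] by (cases "m = r") auto
    have "i \<in> {1..i}" "i \<le> r" "i - 1 \<le> r" using True by auto
    then have "\<epsilon> i \<in> {1..i}" using st by blast
    moreover have "\<epsilon> i \<notin> {1..i - 1}"
    proof
      assume "\<epsilon> i \<in> {1..i - 1}"
      then have "\<epsilon> i \<in> \<epsilon> ` {1..i - 1}" using st[OF \<open>i - 1 \<le> r\<close>] by simp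
      then obtain x where x: "x \<in> {1..i - 1}" "\<epsilon> i = \<epsilon> x" by blast
      then have "i = x" using permutes_inj[OF assms(1)] by (simp add: inj_eq)
      then show False using x(1) True by auto
    qed
    ultimately show ?thesis by auto
  next
    case False
    then show ?thesis using permutes_not_in[OF assms(1)] by simp
  qed
qed

text \<open>Abel summation turns the difference into \<open>\<Sum>i. (a\<^sub>i - a\<^bsub>i+1\<^esub>) * D\<^sub>i\<close>, where \<open>D\<^sub>m\<close> compares the sum of \<open>b\<close>
  over \<open>\<epsilon> ` {1..m}\<close> with the sum over \<open>{1..m}\<close> and is positive for some \<open>m < r\<close>.\<close>

lemma rearrangement_strict:
  assumes \<epsilon>: "\<epsilon> permutes {1..r}" "\<epsilon> \<noteq> id"
  shows "(\<Sum>i\<in>{1..r}. a i * b i) < (\<Sum>i\<in>{1..r}. a i * b (\<epsilon> i))"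
proof -
  define D where "D m = (\<Sum>i\<in>{1..m}. b (\<epsilon> i) - b i)" for m
  have D: "D m = (\<Sum>x\<in>\<epsilon> ` {1..m}. b x) - (\<Sum>x\<in>{1..m}. b x)" for m
    unfolding D_def sum_subtractf
    using sum.reindex[of \<epsilon> "{1..m}" b] permutes_inj_on[OF \<epsilon>(1)] by simp
  have sub: "\<epsilon> ` {1..m} \<subseteq> {1..r}" "card (\<epsilon> ` {1..m}) = m" if "m \<le> r" for m
  proof -
    have "\<epsilon> ` {1..m} \<subseteq> \<epsilon> ` {1..r}" using that by (intro image_mono) auto
    then show "\<epsilon> ` {1..m} \<subseteq> {1..r}" using permutes_image[OF \<epsilon>(1)] by simp
    show "card (\<epsilon> ` {1..m}) = m" using permutes_inj_on[OF \<epsilon>(1)] by (simp add: card_image)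
  qed
  have nonneg: "D m \<ge> 0" if "m \<le> r" for m
    using sum_b_least(1)[OF sub[OF that]] D by simp
  have abel: "(\<Sum>i\<in>{1..m}. a i * (b (\<epsilon> i) - b i)) = a m * D m + (\<Sum>i\<in>{1..<m}. (a i - a (Suc i)) * D i)" for m
  proof (induction m)
    case 0 then show ?case by (simp add: D_def)
  next
    case (Suc m)
    have DS: "D (Suc m) = D m + (b (\<epsilon> (Suc m)) - b (Suc m))" by (simp add: D_def)
    show ?case
    proof (cases "m = 0")
      case True then show ?thesis by (simp add: D_def)
    next
      case False
      then have "(\<Sum>i\<in>{1..<Suc m}. (a i - a (Suc i)) * D i) =
          (\<Sum>i\<in>{1..<m}. (a i - a (Suc i)) * D i) + (a m - a (Suc m)) * D m" by simp
      then show ?thesis using Suc by (simp add: DS algebra_simps)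
    qed
  qed
  obtain m where m: "m < r" "\<epsilon> ` {1..m} \<noteq> {1..m}" using permutes_eq_idI \<epsilon> by blast
  then have Dm: "D m > 0" using sum_b_least(2)[OF sub[of m]] D by simp
  have "m \<noteq> 0" using m by auto
  have "(\<Sum>i\<in>{1..<r}. (a i - a (Suc i)) * D i) > 0"
  proof (rule sum_pos2[of _ m])
    show "0 < (a m - a (Suc m)) * D m" using Dm a_less[of m "Suc m"] m(1) \<open>m \<noteq> 0\<close> by simp
    show "0 \<le> (a i - a (Suc i)) * D i" if "i \<in> {1..<r}" for i
      using nonneg[of i] a_less[of i "Suc i"] that by simp
  qed (use m \<open>m \<noteq> 0\<close> in auto)
  moreover have "D r = 0" using D[of r] permutes_image[OF \<epsilon>(1)] by simp
  ultimately show ?thesis using abel[of r] by (simp add: algebra_simps sum_subtractf)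
qed

text \<open>In \<open>\<Sum>i. (a\<^sub>i + b\<^bsub>\<epsilon>(i)\<^esub>)\<^sup>2\<close> only the mixed term \<open>2 * a\<^sub>i * b\<^bsub>\<epsilon>(i)\<^esub>\<close> depends on \<open>\<epsilon>\<close>.\<close>

lemma square_sum_minimal:
  assumes \<epsilon>: "\<epsilon> \<in> jt_perms r K" "\<epsilon> \<noteq> id"
  shows "square_sum (jt_partition r K id) < square_sum (jt_partition r K \<epsilon>)"
proof -
  have p: "\<epsilon> permutes {1..r}" using \<epsilon> by (simp add: jt_perms_def)
  have sq: "int (square_sum (jt_partition r K \<phi>)) =
      (\<Sum>i\<in>{1..r}. a i * a i) + 2 * (\<Sum>i\<in>{1..r}. a i * b (\<phi> i)) + (\<Sum>i\<in>{1..r}. b i * b i)"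
    if \<phi>: "\<phi> \<in> jt_perms r K" for \<phi>
  proof -
    have "int (square_sum (jt_partition r K \<phi>)) = (\<Sum>i\<in>{1..r}. (K i (\<phi> i))\<^sup>2)"
      unfolding square_sum_jt_partition of_nat_sum using \<phi> by (intro sum.cong) (auto simp: jt_perms_def)
    also have "\<dots> = (\<Sum>i\<in>{1..r}. a i * a i + 2 * (a i * b (\<phi> i)) + b (\<phi> i) * b (\<phi> i))"
      by (intro sum.cong refl) (simp add: K_eq power2_eq_square algebra_simps)
    also have "(\<dots>) = (\<Sum>i\<in>{1..r}. a i * a i) + 2 * (\<Sum>i\<in>{1..r}. a i * b (\<phi> i)) + (\<Sum>i\<in>{1..r}. b (\<phi> i) * b (\<phi> i))"
      by (simp add: sum.distrib sum_distrib_left)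
    also have "(\<Sum>i\<in>{1..r}. b (\<phi> i) * b (\<phi> i)) = (\<Sum>i\<in>{1..r}. b i * b i)"
      using sum.permute[of \<phi> "{1..r}" "\<lambda>i. b i * b i"] \<phi> by (simp add: jt_perms_def o_def)
    finally show ?thesis .
  qed
  show ?thesis using sq[OF \<epsilon>(1)] sq[OF id_in_jt_perms] rearrangement_strict[OF p \<epsilon>(2)] by simp
qed

lemma jt_partition_id_unique:
  "\<epsilon> \<in> jt_perms r K \<Longrightarrow> jt_partition r K \<epsilon> = jt_partition r K id \<Longrightarrow> \<epsilon> = id"
  using square_sum_minimal by fastforce

lemma jt_coeff_id: "jt_coeff r K (jt_partition r K id) \<noteq> 0"
  using jt_coeff_unique_nonzero[OF id_in_jt_perms] jt_partition_id_unique by blast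

lemma equal_blocks_equal_entries:
  assumes "row_block K \<epsilon> i = row_block K \<epsilon>' i'" "i \<ge> 1" "i' \<ge> 1" "K i (\<epsilon> i) \<ge> 0" "K i' (\<epsilon>' i') \<ge> 0"
  shows "K i (\<epsilon> i) = K i' (\<epsilon>' i')"
  using card_row_block[of i K \<epsilon>] card_row_block[of i' K \<epsilon>'] assms by simp

text \<open>A partition determines its permutation row by row as long as no entry vanishes: after rows
  \<open>1, \<dots>, i - 1\<close> the next row block is the block containing the following number, its
  length is the entry, and entries of a row are distinct.\<close>

lemma jt_partition_greedy:
  assumes \<epsilon>: "\<epsilon> \<in> jt_perms r K" and \<epsilon>': "\<epsilon>' \<in> jt_perms r K"
    and eq: "jt_partition r K \<epsilon> = jt_partition r K \<epsilon>'"
    and i: "i \<in> {1..r}" and agree: "\<And>j. j \<in> {1..<i} \<Longrightarrow> \<epsilon> j = \<epsilon>' j"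
    and pos: "K i (\<epsilon> i) > 0" "K i (\<epsilon>' i) > 0"
  shows "\<epsilon> i = \<epsilon>' i"
proof -
  have "partial_sum K \<epsilon> (i - 1) = partial_sum K \<epsilon>' (i - 1)"
    by (rule partial_sum_cong) (use agree in auto)
  then have "Suc (partial_sum K \<epsilon> (i - 1)) \<in> row_block K \<epsilon> i \<inter> row_block K \<epsilon>' i"
    using first_in_row_block[of i K \<epsilon>] first_in_row_block[of i K \<epsilon>'] pos i by simp
  moreover have "row_block K \<epsilon> i \<in> jt_partition r K \<epsilon>" "row_block K \<epsilon>' i \<in> jt_partition r K \<epsilon>"
    using row_block_in_jt_partition[of i r K \<epsilon>] row_block_in_jt_partition[of i r K \<epsilon>'] pos i eq by simp_all
  ultimately have "row_block K \<epsilon> i = row_block K \<epsilon>' i"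
    using jt_partition_block_unique by blast
  then have "K i (\<epsilon> i) = K i (\<epsilon>' i)"
    using equal_blocks_equal_entries[of \<epsilon> i \<epsilon>' i] pos i by simp
  moreover have "\<epsilon> i \<in> {1..r}" "\<epsilon>' i \<in> {1..r}"
    using jt_perms_in \<epsilon> \<epsilon>' i by blast+
  ultimately show ?thesis using K_right_inj by blast
qed


section \<open>Terms of adjacent transpositions\<close>

abbreviation swap :: "nat \<Rightarrow> nat \<Rightarrow> nat" where "swap i \<equiv> transpose i (Suc i)"

lemma K_down_less: "1 \<le> i \<Longrightarrow> i < i' \<Longrightarrow> i' \<le> r \<Longrightarrow> K i' j < K i j"
  using a_less[of i i'] by (simp add: K_eq)

lemma K_superdiag_pos: "1 \<le> i \<Longrightarrow> i < r \<Longrightarrow> K i (Suc i) > 0"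
  using diag_pos[of i] K_right_mono[of i "Suc i" i] by simp

lemma swap_in_jt_perms:
  assumes "1 \<le> i" "i < r"
  shows "swap i \<in> jt_perms r K"
proof -
  have "K j (swap i j) \<ge> 0" if "j \<in> {1..r}" for j
    using K_superdiag_pos[OF assms] sub_nonneg[OF assms] diag_pos[OF that]
    by (cases "j = i"; cases "j = Suc i") auto
  moreover have "swap i permutes {1..r}" using assms by (intro permutes_swap_id) auto
  ultimately show ?thesis by (simp add: jt_perms_def)
qed

lemma swap_image_initial:
  assumes "1 \<le> i" "m \<noteq> i"
  shows "swap i ` {1..m} = {1..m}"
  using assms by (cases "i < m") auto

text \<open>If the rows before \<open>j\<close> use up the columns before \<open>j\<close>, row \<open>j\<close> must pick a column on or right of
  the diagonal.\<close>

lemma not_below_if_agree: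
  assumes \<epsilon>: "\<epsilon> \<in> jt_perms r K" and j: "j \<in> {1..r}"
    and st: "\<phi> ` {1..<j} = {1..<j}" and agree: "\<And>k. k \<in> {1..<j} \<Longrightarrow> \<epsilon> k = \<phi> k"
  shows "\<epsilon> j \<ge> j"
proof (rule ccontr)
  assume "\<not> \<epsilon> j \<ge> j"
  then have "\<epsilon> j \<in> {1..<j}" using jt_perms_in[OF \<epsilon> j] by auto
  then obtain k where k: "k \<in> {1..<j}" "\<epsilon> j = \<phi> k" using st by blast
  then have "\<epsilon> j = \<epsilon> k" using agree by simp
  then show False using k jt_perms_eq_iff[OF \<epsilon>] by auto
qed

text \<open>The greedy reconstruction works in every row in which both entries are known to be positive.  The
  only delicate row is \<open>i + 1\<close>, where the entry of the transposition may be \<open>0\<close>; a competitor would have to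
  choose a column \<open>\<ge> i + 2\<close> there, and its entry would be too long for the block of row \<open>i + 2\<close> that it
  has to coincide with.\<close>

lemma jt_partition_swap_unique:
  assumes i: "1 \<le> i" "i < r" and \<epsilon>: "\<epsilon> \<in> jt_perms r K"
    and eq: "jt_partition r K \<epsilon> = jt_partition r K (swap i)"
  shows "\<epsilon> = swap i"
proof -
  note s = swap_in_jt_perms[OF i]
  have main: "\<epsilon> j = swap i j" if "j \<in> {1..r}" for j
    using that
  proof (induction j rule: less_induct)
    case (less j)
    then have agree: "\<epsilon> k = swap i k" if "k \<in> {1..<j}" for k using that by auto
    have ej: "\<epsilon> j \<in> {1..r}" using jt_perms_in[OF \<epsilon> less.prems] .
    show ?case
    proof (cases "j = Suc i")
      case False
      then have "swap i ` {1..j - 1} = {1..j - 1}" using i by (intro swap_image_initial) auto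
      moreover have "{1..j - 1} = {1..<j}" using less.prems by auto
      ultimately have "swap i ` {1..<j} = {1..<j}" by simp
      then have "\<epsilon> j \<ge> j" by (rule not_below_if_agree[OF \<epsilon> less.prems _ agree])
      then have "K j (\<epsilon> j) > 0"
        using K_right_mono[of j "\<epsilon> j" j] diag_pos[OF less.prems] less.prems ej by auto
      moreover have "K j (swap i j) > 0"
        using False K_superdiag_pos[OF i] diag_pos[OF less.prems] by (cases "j = i") auto
      ultimately show ?thesis
        using jt_partition_greedy[OF \<epsilon> s eq less.prems agree] by blast
    next
      case True
      have sj: "swap i j = i" using True by simp
      show ?thesis
      proof (rule ccontr)
        assume ne: "\<epsilon> j \<noteq> swap i j"
        have "\<epsilon> j \<noteq> swap i k" if "k \<in> {1..<j}" for k
          using agree[OF that] jt_perms_eq_iff[OF \<epsilon>, of j k] that by auto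
        then have "\<epsilon> j \<notin> swap i ` {1..<j}" by blast
        moreover have "swap i ` {1..<j} = {1..<i} \<union> {Suc i}"
        proof -
          have "{1..<j} = {1..<i} \<union> {i}" using i True by auto
          moreover have "swap i ` {1..<i} = {1..<i}" by auto
          ultimately show ?thesis by (simp only: image_Un image_insert image_empty transpose_apply_first)
        qed
        ultimately have "\<epsilon> j \<notin> {1..<i} \<union> {Suc i}" by simp
        then have ge: "\<epsilon> j \<ge> Suc j" using ne sj ej True by auto
        then have jr: "Suc j \<in> {1..r}" using ej by auto
        have "K j (\<epsilon> j) \<ge> K j (Suc j)" using ge ej by (intro K_right_mono) auto
        moreover have "K j (Suc j) > K (Suc j) (Suc j)" using jr less.prems by (intro K_down_less) auto
        ultimately have gt: "K j (\<epsilon> j) > K (Suc j) (Suc j)" by simp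
        have dp: "K (Suc j) (Suc j) > 0" using diag_pos[OF jr] .
        show False
        proof (cases "K j i = 0")
          case False
          then have "K j (swap i j) > 0" using sub_nonneg[OF i] True by simp
          then show False
            using jt_partition_greedy[OF \<epsilon> s eq less.prems agree] gt dp ne by auto
        next
          case z: True
          have ssj: "swap i (Suc j) = Suc j" using True by simp
          have ps: "partial_sum K \<epsilon> (j - 1) = partial_sum K (swap i) (j - 1)"
            by (rule partial_sum_cong) (use agree in auto)
          have "partial_sum K (swap i) j = partial_sum K (swap i) (j - 1)"
            using partial_sum_minus_1[of j K "swap i"] less.prems sj z by simp
          then have "Suc (partial_sum K \<epsilon> (j - 1)) \<in> row_block K \<epsilon> j \<inter> row_block K (swap i) (Suc j)"
            using first_in_row_block[of j K \<epsilon>] first_in_row_block[of "Suc j" K "swap i"] gt dp ssj ps less.prems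
            by simp
          moreover have "row_block K \<epsilon> j \<in> jt_partition r K \<epsilon>"
            using row_block_in_jt_partition[of j r K \<epsilon>] less.prems gt dp by simp
          moreover have "row_block K (swap i) (Suc j) \<in> jt_partition r K \<epsilon>"
            unfolding eq using row_block_in_jt_partition[of "Suc j" r K "swap i"] jr dp ssj by simp
          ultimately have "row_block K \<epsilon> j = row_block K (swap i) (Suc j)"
            using jt_partition_block_unique by blast
          then have "K j (\<epsilon> j) = K (Suc j) (Suc j)"
            using equal_blocks_equal_entries[of \<epsilon> j "swap i" "Suc j"] gt dp ssj less.prems by simp
          then show False using gt by simp
        qed
      qed
    qed
  qed
  have "\<epsilon> j = swap i j" if "j \<notin> {1..r}" for j
    using permutes_not_in[of \<epsilon> "{1..r}" j] permutes_not_in[of "swap i" "{1..r}" j] that \<epsilon> s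
    by (simp add: jt_perms_def)
  then show ?thesis using main by blast
qed

lemma jt_coeff_swap: "1 \<le> i \<Longrightarrow> i < r \<Longrightarrow> jt_coeff r K (jt_partition r K (swap i)) \<noteq> 0"
  using jt_coeff_unique_nonzero[OF swap_in_jt_perms] jt_partition_swap_unique by blast

lemma partial_sum_swap:
  assumes "1 \<le> i" "i < r" "m \<noteq> i" "m \<le> r"
  shows "partial_sum K (swap i) m = P m"
  using partial_sum_stable[OF swap_in_jt_perms[OF assms(1,2)] assms(4)] swap_image_initial assms by blast

lemma partial_sum_swap_bounds:
  assumes "1 \<le> i" "i < r"
  shows "P i < partial_sum K (swap i) i" "partial_sum K (swap i) i \<le> P (Suc i)"
    "P (Suc i) = partial_sum K (swap i) i + nat (K (Suc i) i)"
proof -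
  have 1: "partial_sum K (swap i) i = P (i - 1) + nat (K i (Suc i))"
    using partial_sum_minus_1[of i K "swap i"] partial_sum_swap[OF assms, of "i - 1"] assms by simp
  have 2: "P i = P (i - 1) + nat (K i i)" using partial_sum_minus_1[of i K id] assms by simp
  have "K i i < K i (Suc i)" using b_less[of i "Suc i"] assms by (simp add: K_eq)
  then show "P i < partial_sum K (swap i) i" using 1 2 diag_pos[of i] assms by simp
  show 3: "P (Suc i) = partial_sum K (swap i) i + nat (K (Suc i) i)"
    using partial_sum_Suc[of K "swap i" i] partial_sum_swap[OF assms, of "Suc i"] assms by simp
  then show "partial_sum K (swap i) i \<le> P (Suc i)" by simp
qed

lemma row_block_swap_other:
  assumes "1 \<le> i" "i < r" "k \<in> {1..r}" "k \<noteq> i" "k \<noteq> Suc i"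
  shows "row_block K (swap i) k = row_block K id k"
  unfolding row_block_def using partial_sum_swap[OF assms(1,2)] assms by auto

lemma row_block_swap_first:
  assumes "1 \<le> i" "i < r"
  shows "row_block K (swap i) i = {P (i - 1)<..partial_sum K (swap i) i}"
  unfolding row_block_def using partial_sum_swap[OF assms, of "i - 1"] assms by simp

lemma row_block_swap_second:
  assumes "1 \<le> i" "i < r"
  shows "row_block K (swap i) (Suc i) = {partial_sum K (swap i) i<..P (Suc i)}"
  unfolding row_block_def using partial_sum_swap[OF assms, of "Suc i"] assms by simp

lemma row_block_swap_second_subset:
  assumes "1 \<le> i" "i < r"
  shows "row_block K (swap i) (Suc i) \<subseteq> row_block K id (Suc i)"
  unfolding row_block_swap_second[OF assms] using partial_sum_swap_bounds[OF assms] by (auto simp: row_block_def)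

text \<open>The first of the two modified blocks swallows row block \<open>i\<close> and reaches into row block \<open>i + 1\<close>.\<close>

lemma row_block_swap_first_meets:
  assumes "1 \<le> i" "i < r"
  shows "row_block K id i \<subseteq> row_block K (swap i) i"
    and "Suc (P i) \<in> row_block K (swap i) i \<inter> row_block K id (Suc i)"
proof -
  have "P (i - 1) \<le> P i" by (rule partial_sum_mono) simp
  then show "row_block K id i \<subseteq> row_block K (swap i) i"
    "Suc (P i) \<in> row_block K (swap i) i \<inter> row_block K id (Suc i)"
    unfolding row_block_swap_first[OF assms] using partial_sum_swap_bounds[OF assms] by (auto simp: row_block_def)
qed

text \<open>With all entries positive, the known blocks below \<open>j\<close> fix \<open>\<epsilon>\<close> there by working upwards from row \<open>1\<close>,
  and those above \<open>j + 1\<close> by working downwards from row \<open>r\<close>.  Only rows \<open>j\<close> and \<open>j + 1\<close> remain free.\<close>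

lemma eq_swap_if_other_blocks:
  assumes \<epsilon>: "\<epsilon> \<in> jt_perms r K" and full: "card (jt_partition r K \<epsilon>) = r" and j: "1 \<le> j" "j < r"
    and blocks: "\<And>k. k \<in> {1..r} \<Longrightarrow> k \<noteq> j \<Longrightarrow> k \<noteq> Suc j \<Longrightarrow> row_block K id k \<in> jt_partition r K \<epsilon>"
    and ne: "jt_partition r K \<epsilon> \<noteq> jt_partition r K id"
  shows "\<epsilon> = swap j"
proof -
  have p: "\<epsilon> permutes {1..r}" using \<epsilon> by (simp add: jt_perms_def)
  have pos: "K k (\<epsilon> k) > 0" if "k \<in> {1..r}" for k using card_jt_partition_full[OF full that] .
  have fixI: "\<epsilon> k = k" if k: "k \<in> {1..r}" "k \<noteq> j" "k \<noteq> Suc j"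
    and x: "x \<in> row_block K \<epsilon> k" "x \<in> row_block K id k" for k x
  proof -
    have "row_block K \<epsilon> k = row_block K id k"
      using jt_partition_block_unique[OF _ blocks[OF k] x] row_block_in_jt_partition[where K = K and \<epsilon> = \<epsilon>, OF k(1) pos[OF k(1)]] by blast
    then have "K k (\<epsilon> k) = K k k"
      using equal_blocks_equal_entries[of \<epsilon> k id k] k pos[OF k(1)] diag_pos[OF k(1)] by simp
    then show ?thesis using K_right_inj[OF jt_perms_in[OF \<epsilon> k(1)] k(1)] by simp
  qed
  have low: "\<epsilon> k = k" if "k \<in> {1..<j}" for k
    using that
  proof (induction k rule: less_induct)
    case (less k)
    have k: "k \<in> {1..r}" "k \<noteq> j" "k \<noteq> Suc j" "k \<ge> 1" using less.prems j by auto
    have "partial_sum K \<epsilon> (k - 1) = P (k - 1)"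
      by (rule partial_sum_cong) (use less in auto)
    then have "Suc (P (k - 1)) \<in> row_block K \<epsilon> k"
      using first_in_row_block[of k K \<epsilon>] pos k by simp
    moreover have "Suc (P (k - 1)) \<in> row_block K id k"
      using first_in_row_block[of k K id] diag_pos[OF k(1)] k by simp
    ultimately show ?case using fixI[OF k(1-3)] by blast
  qed
  have high: "\<epsilon> k = k" if "k \<in> {Suc (Suc j)..r}" for k
    using that
  proof (induction "r - k" arbitrary: k rule: less_induct)
    case less
    have k: "k \<in> {1..r}" "k \<noteq> j" "k \<noteq> Suc j" "k \<ge> 1" using less.prems j by auto
    have fx: "\<epsilon> l = l" if "l \<in> {1..r} - {1..k}" for l
      using less.hyps[of l] that less.prems by auto
    have "\<epsilon> permutes {1..k}" by (rule permutes_superset[OF p fx])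
    then have "\<epsilon> ` {1..k} = {1..k}" by (rule permutes_image)
    then have "partial_sum K \<epsilon> k = P k" using partial_sum_stable[OF \<epsilon>] k by simp
    then have "P k \<in> row_block K \<epsilon> k"
      using last_in_row_block[of k K \<epsilon>] pos k by simp
    moreover have "P k \<in> row_block K id k"
      using last_in_row_block[of k K id] diag_pos[OF k(1)] k by simp
    ultimately show ?case using fixI[OF k(1-3)] by blast
  qed
  have "\<epsilon> permutes {j, Suc j}"
  proof (rule permutes_superset[OF p])
    fix x assume "x \<in> {1..r} - {j, Suc j}"
    then show "\<epsilon> x = x" using low[of x] high[of x] by (cases "x < j") auto
  qed
  then show ?thesis using ne by (auto simp: permutes_doubleton_iff)
qed

end


section \<open>Comparing two determinants\<close>

lemma perm_partition_image_eq: "perm_partition \<sigma> \<pi> = (`) \<sigma> ` \<pi>"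
  by (simp add: perm_partition_def)

lemma inj_perm_partition:
  assumes "inj \<sigma>"
  shows "inj (perm_partition \<sigma>)"
  using inj_image_eq_iff[OF inj_on_image[of "(`) \<sigma>" UNIV]] assms
  unfolding perm_partition_image_eq[abs_def] inj_def by (metis inj_image_eq_iff inj_def)

lemma card_perm_partition: "inj \<sigma> \<Longrightarrow> card (perm_partition \<sigma> \<pi>) = card \<pi>"
  unfolding perm_partition_def by (rule card_image) (auto simp: inj_on_def inj_image_eq_iff)

lemma square_sum_perm_partition:
  assumes "inj \<sigma>"
  shows "square_sum (perm_partition \<sigma> \<pi>) = square_sum \<pi>"
proof -
  have "inj_on ((`) \<sigma>) \<pi>" using assms by (auto simp: inj_on_def inj_image_eq_iff)
  then have "square_sum (perm_partition \<sigma> \<pi>) = (\<Sum>B\<in>\<pi>. (card (\<sigma> ` B))\<^sup>2)"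
    unfolding square_sum_def perm_partition_def by (simp add: sum.reindex o_def)
  also have "\<dots> = square_sum \<pi>"
    unfolding square_sum_def using card_image[OF inj_on_subset[OF assms subset_UNIV]] by simp
  finally show ?thesis .
qed

text \<open>An injective walk along the path \<open>1, \<dots>, r\<close> cannot turn round.\<close>

lemma path_automorphism:
  fixes f :: "nat \<Rightarrow> nat"
  assumes f: "f ` {1..r} \<subseteq> {1..r}" "inj_on f {1..r}"
    and adj: "\<And>i. 1 \<le> i \<Longrightarrow> i < r \<Longrightarrow> f (Suc i) = Suc (f i) \<or> f i = Suc (f (Suc i))"
  shows "(\<forall>k\<in>{1..r}. f k = k) \<or> (\<forall>k\<in>{1..r}. f k = r + 1 - k)"
proof (cases "r \<le> 1")
  case True
  then show ?thesis using f(1) by (cases r) auto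
next
  case False
  have in_r: "f k \<in> {1..r}" if "k \<in> {1..r}" for k using f(1) that by blast
  have turn: "f (Suc (Suc i)) \<noteq> f i" if "1 \<le> i" "Suc i < r" for i
  proof
    assume "f (Suc (Suc i)) = f i"
    then have "Suc (Suc i) = i" by (rule inj_onD[OF f(2)]) (use that in auto)
    then show False by simp
  qed
  consider "f (Suc 1) = Suc (f 1)" | "f 1 = Suc (f (Suc 1))" using adj[of 1] False by auto
  then show ?thesis
  proof cases
    case 1
    have step: "f (Suc i) = Suc (f i)" if "1 \<le> i" "i < r" for i
      using that
    proof (induction i rule: nat_induct_at_least)
      case base then show ?case using 1 by simp
    next
      case (Suc i)
      then show ?case using adj[of "Suc i"] turn[of i] by auto
    qed
    have eq: "f k = f 1 + (k - 1)" if "1 \<le> k" "k \<le> r" for k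
      using that
    proof (induction k rule: nat_induct_at_least)
      case base then show ?case by simp
    next
      case (Suc k) then show ?case using step[of k] by auto
    qed
    have "f 1 \<in> {1..r}" "f r \<in> {1..r}" using in_r False by auto
    then have "f 1 = 1" using eq[of r] False by auto
    then show ?thesis using eq by auto
  next
    case 2
    have step: "f i = Suc (f (Suc i))" if "1 \<le> i" "i < r" for i
      using that
    proof (induction i rule: nat_induct_at_least)
      case base then show ?case using 2 by simp
    next
      case (Suc i)
      then show ?case using adj[of "Suc i"] turn[of i] by auto
    qed
    have eq: "f 1 = f k + (k - 1)" if "1 \<le> k" "k \<le> r" for k
      using that
    proof (induction k rule: nat_induct_at_least)
      case base then show ?case by simp
    next
      case (Suc k) then show ?case using step[of k] by auto
    qed
    have "f 1 \<in> {1..r}" "f r \<in> {1..r}" using in_r False by auto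
    then have "f 1 = r" using eq[of r] False by auto
    then have "f k = r + 1 - k" if "k \<in> {1..r}" for k using eq[of k] that by auto
    then show ?thesis by blast
  qed
qed

text \<open>The situation obtained from an equality of two skew Schur functions, with \<open>\<sigma> = \<tau>\<^sup>-\<^sup>1\<delta>\<close>.\<close>

locale jt_pair = D: jt_matrix r K a b + T: jt_matrix r' K' a' b'
  for r K a b r' K' a' b' +
  fixes n :: nat and \<sigma> :: "nat \<Rightarrow> nat"
  assumes \<sigma>: "\<sigma> permutes {1..n}"
    and size: "D.P r = n" "T.P r' = n"
    and coeff: "\<pi> \<in> set_partitions n \<Longrightarrow> jt_coeff r K \<pi> = jt_coeff r' K' (perm_partition \<sigma> \<pi>)"
begin

lemma inj_\<sigma>: "inj \<sigma>" using permutes_inj[OF \<sigma>] .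

lemma D_in_set_partitions: "\<epsilon> \<in> jt_perms r K \<Longrightarrow> jt_partition r K \<epsilon> \<in> set_partitions n"
  using jt_partition_in_set_partitions[of r K \<epsilon>] D.partial_sum_total size by simp

lemma transfer:
  assumes "\<epsilon> \<in> jt_perms r K" "jt_coeff r K (jt_partition r K \<epsilon>) \<noteq> 0"
  obtains \<epsilon>' where "\<epsilon>' \<in> jt_perms r' K'" "jt_partition r' K' \<epsilon>' = perm_partition \<sigma> (jt_partition r K \<epsilon>)"
  using coeff[OF D_in_set_partitions[OF assms(1)]] assms(2) jt_coeff_nonzero_ex by metis

text \<open>The image of the minimal partition for \<open>K\<close> is the partition of some term for \<open>K'\<close>.\<close>

lemma square_sum_le:
  "square_sum (jt_partition r' K' id) \<le> square_sum (jt_partition r K id)"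
proof -
  obtain \<epsilon>' where e: "\<epsilon>' \<in> jt_perms r' K'" "jt_partition r' K' \<epsilon>' = perm_partition \<sigma> (jt_partition r K id)"
    using transfer[OF D.id_in_jt_perms D.jt_coeff_id] .
  then have "square_sum (jt_partition r' K' \<epsilon>') = square_sum (jt_partition r K id)"
    using square_sum_perm_partition[OF inj_\<sigma>] by simp
  then show ?thesis using T.square_sum_minimal[OF e(1)] by (cases "\<epsilon>' = id") auto
qed

lemma reverse: "jt_pair r' K' a' b' r K a b n (inv \<sigma>)"
proof (unfold_locales)
  show "inv \<sigma> permutes {1..n}" using permutes_inv[OF \<sigma>] .
  fix \<pi> assume "\<pi> \<in> set_partitions n"
  then have "perm_partition (inv \<sigma>) \<pi> \<in> set_partitions n"
    using perm_partition_in_set_partitions[OF permutes_inv[OF \<sigma>]] by blast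
  from coeff[OF this] show "jt_coeff r' K' \<pi> = jt_coeff r K (perm_partition (inv \<sigma>) \<pi>)"
    by (simp add: perm_partition_comp permutes_inv_o[OF \<sigma>])
qed (use size in auto)

text \<open>Applied in both directions, the inequality shows that the image of the minimal partition is
  again minimal, and the minimum is attained by the identity only.\<close>

lemma id_partition: "perm_partition \<sigma> (jt_partition r K id) = jt_partition r' K' id"
proof -
  interpret R: jt_pair r' K' a' b' r K a b n "inv \<sigma>" by (rule reverse)
  obtain \<epsilon>' where e: "\<epsilon>' \<in> jt_perms r' K'" "jt_partition r' K' \<epsilon>' = perm_partition \<sigma> (jt_partition r K id)"
    using transfer[OF D.id_in_jt_perms D.jt_coeff_id] .
  then have "square_sum (jt_partition r' K' \<epsilon>') = square_sum (jt_partition r K id)"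
    using square_sum_perm_partition[OF inj_\<sigma>] by simp
  then have "\<epsilon>' = id"
    using T.square_sum_minimal[OF e(1)] R.square_sum_le by fastforce
  then show ?thesis using e by simp
qed

lemma same_rows: "r' = r"
proof -
  have "card (jt_partition r K id) = r" "card (jt_partition r' K' id) = r'"
    using D.diag_pos T.diag_pos by (auto intro!: card_jt_partition simp del: atLeastAtMost_iff)
  then show ?thesis using id_partition card_perm_partition[OF inj_\<sigma>] by metis
qed

lemma block_image:
  assumes "k \<in> {1..r}"
  obtains l where "l \<in> {1..r}" "\<sigma> ` row_block K id k = row_block K' id l"
proof -
  have "row_block K id k \<in> jt_partition r K id"
    using row_block_in_jt_partition[of k r K id] D.diag_pos[OF assms] assms by simp
  then have "\<sigma> ` row_block K id k \<in> jt_partition r' K' id"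
    unfolding id_partition[symmetric] perm_partition_def by blast
  then show ?thesis using that same_rows by (auto simp: jt_partition_def simp del: atLeastAtMost_iff)
qed

lemma swap_image:
  assumes i: "1 \<le> i" "i < r"
  obtains \<epsilon>' where "\<epsilon>' \<in> jt_perms r' K'" "jt_partition r' K' \<epsilon>' = perm_partition \<sigma> (jt_partition r K (transpose i (Suc i)))"
  using transfer[OF D.swap_in_jt_perms[OF i] D.jt_coeff_swap[OF i]] .

lemma T_nonempty: "k \<in> {1..r} \<Longrightarrow> row_block K' id k \<noteq> {}"
  using row_block_empty_iff[of k K' id] T.diag_pos[of k] same_rows by simp

lemma D_nonempty: "k \<in> {1..r} \<Longrightarrow> row_block K id k \<noteq> {}"
  using row_block_empty_iff[of k K id] D.diag_pos[of k] by simp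

text \<open>The block \<open>X\<close> of the transposition \<open>(i, i+1)\<close> that contains row block \<open>i\<close> and meets row block \<open>i + 1\<close> has
  an interval as image.  A row block of \<open>K'\<close> strictly between the images of these two would lie inside
  that interval, although it is the image of a row block disjoint from \<open>X\<close>.\<close>

lemma adjacent:
  assumes f: "\<And>k. k \<in> {1..r} \<Longrightarrow> f k \<in> {1..r} \<and> \<sigma> ` row_block K id k = row_block K' id (f k)"
    and surj: "f ` {1..r} = {1..r}"
    and i: "1 \<le> i" "i < r"
  shows "\<not> (\<exists>w. f i < w \<and> w < f (Suc i))" "\<not> (\<exists>w. f (Suc i) < w \<and> w < f i)"
proof -
  obtain \<epsilon>' where e: "\<epsilon>' \<in> jt_perms r' K'"
    "jt_partition r' K' \<epsilon>' = perm_partition \<sigma> (jt_partition r K (transpose i (Suc i)))"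
    using swap_image[OF i] .
  have ir: "i \<in> {1..r}" "Suc i \<in> {1..r}" using i by auto
  let ?X = "row_block K (transpose i (Suc i)) i"
  have "K i (transpose i (Suc i) i) > 0" using D.K_superdiag_pos[OF i] by simp
  then have "?X \<in> jt_partition r K (transpose i (Suc i))"
    using row_block_in_jt_partition[OF ir(1)] by blast
  then have X: "\<sigma> ` ?X \<in> jt_partition r' K' \<epsilon>'" unfolding e(2) perm_partition_def by blast
  then obtain m where m: "\<sigma> ` ?X = row_block K' \<epsilon>' m" unfolding jt_partition_def by blast
  have sub: "row_block K' id (f i) \<subseteq> \<sigma> ` ?X"
    using D.row_block_swap_first_meets(1)[OF i] f[OF ir(1)] by blast
  obtain x where x: "x \<in> row_block K' id (f i)" using T_nonempty f[OF ir(1)] by blast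
  obtain z where z: "z \<in> \<sigma> ` ?X" "z \<in> row_block K' id (f (Suc i))"
    using D.row_block_swap_first_meets(2)[OF i] f[OF ir(2)] by blast
  have no: "\<not> (l < w \<and> w < u)"
    if lu: "{l, u} = {f i, f (Suc i)}" for l w u
  proof
    assume w: "l < w \<and> w < u"
    have lur: "l \<in> {1..r}" "u \<in> {1..r}" using lu f[OF ir(1)] f[OF ir(2)] by (metis insertCI insertE singletonD)+
    then have wr: "w \<in> {1..r}" using w by auto
    obtain y where y: "y \<in> row_block K' id w" using T_nonempty[OF wr] by blast
    obtain p q where pq: "p \<in> \<sigma> ` ?X" "p \<in> row_block K' id l" "q \<in> \<sigma> ` ?X" "q \<in> row_block K' id u"
      using lu x z sub by (metis doubleton_eq_iff subsetD)
    have "p \<le> y"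
    proof -
      have "T.P l \<le> T.P (w - 1)" by (rule partial_sum_mono) (use w in auto)
      then show ?thesis using pq y by (auto simp: row_block_def)
    qed
    moreover have "y \<le> q"
    proof -
      have "T.P w \<le> T.P (u - 1)" by (rule partial_sum_mono) (use w in auto)
      then show ?thesis using pq y by (auto simp: row_block_def)
    qed
    ultimately have yX: "y \<in> \<sigma> ` ?X" using pq unfolding m by (auto simp: row_block_def)
    obtain k where k: "k \<in> {1..r}" "f k = w" using surj wr by (metis imageE)
    have ki: "k \<noteq> i" "k \<noteq> Suc i" using w lu k by auto
    have "y \<in> \<sigma> ` row_block K id k" using f[OF k(1)] k y by simp
    then have "y \<in> \<sigma> ` row_block K (transpose i (Suc i)) k"
      using D.row_block_swap_other[OF i k(1) ki] by simp
    then have "\<exists>v. v \<in> ?X \<and> v \<in> row_block K (transpose i (Suc i)) k"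
      using yX inj_\<sigma> by (auto dest: injD)
    then show False using row_block_unique ki by blast
  qed
  show "\<not> (\<exists>w. f i < w \<and> w < f (Suc i))" using no by blast
  show "\<not> (\<exists>w. f (Suc i) < w \<and> w < f i)" using no by blast
qed

lemma block_dichotomy:
  "(\<forall>k\<in>{1..r}. \<sigma> ` row_block K id k = row_block K' id k) \<or>
   (\<forall>k\<in>{1..r}. \<sigma> ` row_block K id k = row_block K' id (r + 1 - k))"
proof -
  have "\<exists>l. l \<in> {1..r} \<and> \<sigma> ` row_block K id k = row_block K' id l" if "k \<in> {1..r}" for k
    using block_image[OF that] by blast
  then obtain f where f: "\<And>k. k \<in> {1..r} \<Longrightarrow> f k \<in> {1..r} \<and> \<sigma> ` row_block K id k = row_block K' id (f k)"
    by metis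
  have inj: "inj_on f {1..r}"
  proof (rule inj_onI)
    fix k l assume kl: "k \<in> {1..r}" "l \<in> {1..r}" "f k = f l"
    then have "\<sigma> ` row_block K id k = \<sigma> ` row_block K id l" using f by simp
    then have "row_block K id k = row_block K id l" using inj_image_eq_iff[OF inj_\<sigma>] by blast
    then show "k = l" using D_nonempty[OF kl(1)] row_block_unique by blast
  qed
  have sub: "f ` {1..r} \<subseteq> {1..r}" using f by blast
  then have surj: "f ` {1..r} = {1..r}" using endo_inj_surj[OF _ sub inj] by simp
  have "f (Suc i) = Suc (f i) \<or> f i = Suc (f (Suc i))" if i: "1 \<le> i" "i < r" for i
  proof -
    have "f i \<noteq> f (Suc i)" using inj_onD[OF inj, of i "Suc i"] i by auto
    moreover have "\<not> (f i < Suc (f i) \<and> Suc (f i) < f (Suc i))" "\<not> (f (Suc i) < Suc (f (Suc i)) \<and> Suc (f (Suc i)) < f i)"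
      using adjacent[OF f surj i] by blast+
    ultimately show ?thesis by linarith
  qed
  from path_automorphism[OF sub inj this] f show ?thesis by metis
qed

text \<open>For a positive subdiagonal entry the partition of \<open>(i, i+1)\<close> has \<open>r\<close> blocks, two of them unknown to
  \<open>[\<alpha>]\<close>, so its image is the partition of \<open>(j, j+1)\<close>.  The shorter new block \<open>Y\<close> lies inside row block \<open>i + 1\<close>
  and has the subdiagonal entry as its size; of the two new blocks for \<open>(j, j+1)\<close> only the second one lies
  inside a single row block, namely \<open>j + 1\<close>.  So \<open>Y\<close> is mapped onto that one.\<close>

lemma subdiagonal_transfer:
  assumes f: "\<And>k. k \<in> {1..r} \<Longrightarrow> f k \<in> {1..r} \<and> \<sigma> ` row_block K id k = row_block K' id (f k)"
    and surj: "f ` {1..r} = {1..r}"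
    and i: "1 \<le> i" "i < r" and j: "1 \<le> j" "j < r" "{f i, f (Suc i)} = {j, Suc j}"
    and pos: "K (Suc i) i > 0"
  shows "f (Suc i) = Suc j" "K' (Suc j) j = K (Suc i) i"
proof -
  let ?s = "transpose i (Suc i)" and ?t = "transpose j (Suc j)"
  obtain \<epsilon>' where e: "\<epsilon>' \<in> jt_perms r' K'"
    "jt_partition r' K' \<epsilon>' = perm_partition \<sigma> (jt_partition r K ?s)"
    using swap_image[OF i] .
  have jr': "j < r'" using j same_rows by simp
  have ir: "i \<in> {1..r}" "Suc i \<in> {1..r}" using i by auto
  have spos: "K k (?s k) > 0" if "k \<in> {1..r}" for k
    using D.K_superdiag_pos[OF i] pos D.diag_pos[OF that] by (cases "k = i"; cases "k = Suc i") auto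
  have card: "card (jt_partition r' K' \<epsilon>') = r'"
  proof -
    have "card (jt_partition r' K' \<epsilon>') = card (jt_partition r K ?s)"
      unfolding e(2) by (rule card_perm_partition[OF inj_\<sigma>])
    also have "\<dots> = r" by (rule card_jt_partition) (rule spos)
    finally show ?thesis using same_rows by simp
  qed
  have "?s \<noteq> id" using i by (metis id_apply n_not_Suc_n transpose_apply_first)
  then have "jt_partition r K ?s \<noteq> jt_partition r K id"
    using D.jt_partition_id_unique[OF D.swap_in_jt_perms[OF i]] by blast
  then have ne: "jt_partition r' K' \<epsilon>' \<noteq> jt_partition r' K' id"
    unfolding e(2) id_partition[symmetric] using inj_perm_partition[OF inj_\<sigma>] by (auto dest: injD)
  have "\<epsilon>' = ?t"
  proof (rule T.eq_swap_if_other_blocks[OF e(1) card j(1) jr' _ ne])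
    fix k assume k: "k \<in> {1..r'}" "k \<noteq> j" "k \<noteq> Suc j"
    then obtain l where l: "l \<in> {1..r}" "f l = k" using surj same_rows by (metis imageE)
    have li: "l \<noteq> i" "l \<noteq> Suc i" using k l j(3) by auto
    have "row_block K id l \<in> jt_partition r K ?s"
      using row_block_in_jt_partition[where K = K and \<epsilon> = ?s, OF l(1) spos[OF l(1)]] D.row_block_swap_other[OF i l(1) li] by simp
    then show "row_block K' id k \<in> jt_partition r' K' \<epsilon>'"
      unfolding e(2) perm_partition_def using f[OF l(1)] l(2) by (metis imageI)
  qed
  then have tp: "jt_partition r' K' ?t = perm_partition \<sigma> (jt_partition r K ?s)" using e by simp
  let ?Y = "row_block K ?s (Suc i)"
  have Y: "?Y \<in> jt_partition r K ?s" "?Y \<noteq> {}"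
    using row_block_in_jt_partition[where K = K and \<epsilon> = ?s, OF ir(2) spos[OF ir(2)]] by (auto simp: jt_partition_def)
  have sY: "\<sigma> ` ?Y \<in> jt_partition r' K' ?t" unfolding tp perm_partition_def using Y by blast
  then obtain m where m: "m \<in> {1..r'}" "\<sigma> ` ?Y = row_block K' ?t m" unfolding jt_partition_def by blast
  have fi: "f (Suc i) \<in> {j, Suc j}" using j(3) by blast
  have YB: "\<sigma> ` ?Y \<subseteq> row_block K' id (f (Suc i))"
    using D.row_block_swap_second_subset[OF i] f[OF ir(2)] by blast
  have jj: "j \<in> {1..r}" "Suc j \<in> {1..r}" using j by auto
  have "m = Suc j"
  proof (rule ccontr)
    assume "m \<noteq> Suc j"
    then consider "m = j" | "m \<noteq> j" "m \<noteq> Suc j" by blast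
    then show False
    proof cases
      case 1
      have "Suc (T.P j) \<in> row_block K' id (Suc j)" "row_block K' id j \<subseteq> \<sigma> ` ?Y" "Suc (T.P j) \<in> \<sigma> ` ?Y"
        using T.row_block_swap_first_meets[OF j(1) jr'] m 1 by auto
      then have "f (Suc i) = Suc j" "f (Suc i) = j"
        using YB T_nonempty[OF jj(1)] row_block_unique by blast+
      then show False by simp
    next
      case 2
      then have "row_block K' ?t m = row_block K' id m"
        using T.row_block_swap_other[OF j(1) jr' m(1)] by blast
      moreover obtain y where "y \<in> \<sigma> ` ?Y" using Y by blast
      ultimately have "f (Suc i) = m" using YB m row_block_unique by blast
      then show False using fi 2 by blast
    qed
  qed
  then have "row_block K' ?t m \<subseteq> row_block K' id (Suc j)"
    using T.row_block_swap_second_subset[OF j(1) jr'] by simp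
  moreover obtain y where "y \<in> \<sigma> ` ?Y" using Y by blast
  ultimately show "f (Suc i) = Suc j" using YB m row_block_unique by blast
  have "card (\<sigma> ` ?Y) = card ?Y" using inj_\<sigma> by (intro card_image inj_on_subset[OF inj_\<sigma>]) auto
  then have "card ?Y = card (row_block K' ?t (Suc j))" using m \<open>m = Suc j\<close> by simp
  then have "nat (K (Suc i) i) = nat (K' (Suc j) j)"
    using card_row_block[of "Suc i" K ?s] card_row_block[of "Suc j" K' ?t] by simp
  then show "K' (Suc j) j = K (Suc i) i" using pos by (simp add: nat_eq_iff split: if_splits)
qed

lemma diag_transfer:
  assumes "\<sigma> ` row_block K id k = row_block K' id l" "k \<in> {1..r}" "l \<in> {1..r}"
  shows "K' l l = K k k"
proof -
  have "card (\<sigma> ` row_block K id k) = card (row_block K id k)"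
    by (intro card_image inj_on_subset[OF inj_\<sigma>]) auto
  then have "nat (K k k) = nat (K' l l)"
    using assms card_row_block[of k K id] card_row_block[of l K' id] by simp
  then show ?thesis using D.diag_pos[OF assms(2)] T.diag_pos[of l] assms(3) same_rows by simp
qed

lemma inv_block:
  assumes "\<sigma> ` row_block K id k = row_block K' id l"
  shows "inv \<sigma> ` row_block K' id l = row_block K id k"
  unfolding assms[symmetric] using inj_\<sigma> by (rule image_inv_f_f)

text \<open>A positive subdiagonal entry keeps the order of two adjacent row blocks
  (\<open>subdiagonal_transfer\<close>), which is impossible if \<open>\<sigma>\<close> reverses them.\<close>

theorem equal_or_reversed:
  "(\<forall>k\<in>{1..r}. K' k k = K k k) \<and> (\<forall>i. 1 \<le> i \<and> i < r \<longrightarrow> K' (Suc i) i = K (Suc i) i) \<or>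
   (\<forall>k\<in>{1..r}. \<sigma> ` row_block K id k = row_block K' id (r + 1 - k)) \<and>
   (\<forall>k\<in>{1..r}. K' (r + 1 - k) (r + 1 - k) = K k k) \<and>
   (\<forall>i. 1 \<le> i \<and> i < r \<longrightarrow> K (Suc i) i = 0 \<and> K' (Suc i) i = 0)"
proof -
  interpret R: jt_pair r' K' a' b' r K a b n "inv \<sigma>" by (rule reverse)
  consider (same) "\<forall>k\<in>{1..r}. \<sigma> ` row_block K id k = row_block K' id k"
    | (rev) "\<forall>k\<in>{1..r}. \<sigma> ` row_block K id k = row_block K' id (r + 1 - k)"
    using block_dichotomy by blast
  then show ?thesis
  proof cases
    case same
    have "K' (Suc i) i = K (Suc i) i" if i: "1 \<le> i" "i < r" for i
    proof -
      have 1: "K (Suc i) i > 0 \<Longrightarrow> K' (Suc i) i = K (Suc i) i"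
        by (rule subdiagonal_transfer(2)[where f = "\<lambda>k. k"]) (use same i in auto)
      have 2: "K' (Suc i) i > 0 \<Longrightarrow> K (Suc i) i = K' (Suc i) i"
      proof (rule R.subdiagonal_transfer(2)[where f = "\<lambda>k. k"])
        show "k \<in> {1..r'} \<and> inv \<sigma> ` row_block K' id k = row_block K id k" if "k \<in> {1..r'}" for k
          using that same same_rows by (intro conjI inv_block) auto
      qed (use i same_rows in auto)
      show ?thesis using 1 2 D.sub_nonneg[OF i] T.sub_nonneg[of i] i same_rows by fastforce
    qed
    moreover have "K' k k = K k k" if "k \<in> {1..r}" for k
      using diag_transfer[OF bspec[OF same that] that that] .
    ultimately show ?thesis by (intro disjI1) simp
  next
    case rev
    define f where "f k = r + 1 - k" for k
    have fi: "f k \<in> {1..r}" if "k \<in> {1..r}" for k using that by (auto simp: f_def)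
    have ff: "f (f k) = k" if "k \<in> {1..r}" for k using that by (auto simp: f_def)
    have surj: "f ` {1..r} = {1..r}"
      using fi ff by (metis (no_types, lifting) image_eqI image_subsetI subsetI subset_antisym)
    have rev': "\<sigma> ` row_block K id k = row_block K' id (f k)" if "k \<in> {1..r}" for k
      using rev that by (simp add: f_def)
    have Rrev: "inv \<sigma> ` row_block K' id k = row_block K id (f k)" if "k \<in> {1..r}" for k
      using inv_block[OF rev'[OF fi[OF that]]] ff[OF that] by simp
    have "K (Suc i) i = 0 \<and> K' (Suc i) i = 0" if i: "1 \<le> i" "i < r" for i
    proof -
      have j: "1 \<le> r - i" "r - i < r" "{f i, f (Suc i)} = {r - i, Suc (r - i)}" "f (Suc i) \<noteq> Suc (r - i)"
        using i by (auto simp: f_def)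
      have 1: "\<not> K (Suc i) i > 0"
      proof
        assume "K (Suc i) i > 0"
        then have "f (Suc i) = Suc (r - i)"
          by (intro subdiagonal_transfer(1)[OF _ surj i j(1-3)]) (use fi rev' in auto)
        then show False using j(4) by simp
      qed
      have 2: "\<not> K' (Suc i) i > 0"
      proof
        assume p: "K' (Suc i) i > 0"
        have "f (Suc i) = Suc (r - i)"
        proof (rule R.subdiagonal_transfer(1)[of f i "r - i"])
          show "f k \<in> {1..r'} \<and> inv \<sigma> ` row_block K' id k = row_block K id (f k)" if "k \<in> {1..r'}" for k
            using that fi Rrev unfolding same_rows by blast
        qed (use surj i j p same_rows in auto)
        then show False using j(4) by simp
      qed
      show ?thesis using 1 2 D.sub_nonneg[OF i] T.sub_nonneg[of i] i same_rows by fastforce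
    qed
    moreover have "K' (f k) (f k) = K k k" if "k \<in> {1..r}" for k
      using diag_transfer[OF rev'[OF that] that fi[OF that]] .
    ultimately show ?thesis using rev unfolding f_def by (intro disjI2) simp
  qed
qed

end


section \<open>Reversed ribbons\<close>

definition flip :: "nat \<Rightarrow> nat \<Rightarrow> nat" where
  "flip r k = (if k \<in> {1..r} then r + 1 - k else k)"

lemma flip_flip [simp]: "flip r (flip r k) = k"
  by (auto simp: flip_def)

lemma flip_in: "k \<in> {1..r} \<Longrightarrow> flip r k \<in> {1..r}"
  by (auto simp: flip_def)

lemma flip_image: "flip r ` {1..r} = {1..r}"
proof
  show "flip r ` {1..r} \<subseteq> {1..r}" using flip_in by blast
  show "{1..r} \<subseteq> flip r ` {1..r}" using flip_in flip_flip by (metis image_eqI subsetI)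
qed

lemma flip_permutes: "flip r permutes {1..r}"
  by (rule permutes_imageI[OF _ flip_image]) (auto simp: flip_def)

lemma reflect_interval:
  fixes n l u :: nat
  assumes "l \<le> n" "u \<le> n"
  shows "(\<lambda>x. n + 1 - x) ` {l<..u} = {n - u<..n - l}"
proof
  show "(\<lambda>x. n + 1 - x) ` {l<..u} \<subseteq> {n - u<..n - l}" using assms by auto
  show "{n - u<..n - l} \<subseteq> (\<lambda>x. n + 1 - x) ` {l<..u}"
  proof
    fix y assume y: "y \<in> {n - u<..n - l}"
    then have "y = n + 1 - (n + 1 - y)" "n + 1 - y \<in> {l<..u}" using assms by auto
    then show "y \<in> (\<lambda>x. n + 1 - x) ` {l<..u}" by blast
  qed
qed

context jt_matrix
begin

lemma P_strict_mono: "i < j \<Longrightarrow> j \<le> r \<Longrightarrow> P i < P j"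
proof -
  assume ij: "i < j" "j \<le> r"
  have "P i \<le> P (j - 1)" using ij by (intro partial_sum_mono) simp
  also have "\<dots> < P j" using partial_sum_minus_1[of j K id] diag_pos[of j] ij by simp
  finally show "P i < P j" .
qed

lemma interval_eq_Union_blocks:
  assumes "p \<ge> 1"
  shows "{P (p - 1)<..P m} = (\<Union>k\<in>{p..m}. row_block K id k)"
proof (cases "p \<le> m")
  case False
  then have "P m \<le> P (p - 1)" by (intro partial_sum_mono) simp
  then show ?thesis using False by simp
next
  case True
  then show ?thesis
  proof (induction m rule: dec_induct)
    case base then show ?case by (simp add: row_block_def)
  next
    case (step m)
    have "P (p - 1) \<le> P m" "P m \<le> P (Suc m)" using step by (auto intro!: partial_sum_mono)
    then have "{P (p - 1)<..P (Suc m)} = {P (p - 1)<..P m} \<union> row_block K id (Suc m)"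
      by (auto simp: row_block_def)
    moreover have "{p..Suc m} = insert (Suc m) {p..m}" using step by auto
    ultimately show ?case using step.IH by (simp add: id_def Un_commute)
  qed
qed

text \<open>Vanishing of the subdiagonal means \<open>a\<^bsub>k+1\<^esub> = - b\<^sub>k\<close>, so the partial sums of the diagonal telescope.\<close>

lemma ribbon_entry:
  assumes ribbon: "\<And>i. 1 \<le> i \<Longrightarrow> i < r \<Longrightarrow> K (Suc i) i = 0"
    and ij: "i \<in> {1..r}" "j \<in> {1..r}"
  shows "K i j = int (P j) - int (P (i - 1))"
proof -
  have 1: "int (P m) = a 1 + b m" if "1 \<le> m" "m \<le> r" for m
    using that
  proof (induction m rule: nat_induct_at_least)
    case base
    then show ?case using partial_sum_minus_1[of 1 K id] diag_pos[of 1] K_eq[of 1 1] by (simp add: id_def)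
  next
    case (Suc m)
    then show ?case
      using partial_sum_Suc[of K id m] diag_pos[of "Suc m"] ribbon[of m]
        K_eq[of "Suc m" "Suc m"] K_eq[of "Suc m" m] by (simp add: id_def)
  qed
  have 2: "int (P (i - 1)) = a 1 - a i"
  proof (cases "i = 1")
    case False
    then have "1 \<le> i - 1" "i - 1 < r" "Suc (i - 1) = i" using ij by auto
    then show ?thesis using 1[of "i - 1"] ribbon[of "i - 1"] K_eq[of i "i - 1"] by simp
  qed simp
  show ?thesis using 1[of j] 2 ij K_eq[of i j] by simp
qed

text \<open>An entry is nonnegative only if \<open>\<epsilon> i \<ge> i - 1\<close>, and it is \<open>0\<close> for \<open>\<epsilon> i = i - 1\<close>.  If \<open>\<epsilon> i \<ge> i\<close>, then
  all columns before \<open>i\<close> have been used by the rows before \<open>i\<close>, so the row block starts where it would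
  start for the identity.\<close>

lemma ribbon_jt_partition:
  assumes ribbon: "\<And>i. 1 \<le> i \<Longrightarrow> i < r \<Longrightarrow> K (Suc i) i = 0"
    and \<epsilon>: "\<epsilon> \<in> jt_perms r K"
  shows "jt_partition r K \<epsilon> = (\<lambda>i. {P (i - 1)<..P (\<epsilon> i)}) ` {1..r} - {{}}"
proof -
  have p: "\<epsilon> permutes {1..r}" using \<epsilon> by (simp add: jt_perms_def)
  have ge: "\<epsilon> i \<ge> i - 1" if i: "i \<in> {1..r}" for i
  proof (rule ccontr)
    assume "\<not> ?thesis"
    then have "P (\<epsilon> i) < P (i - 1)" using i by (intro P_strict_mono) auto
    then show False
      using jt_perms_nonneg[OF \<epsilon> i] ribbon_entry[OF ribbon i jt_perms_in[OF \<epsilon> i]] by simp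
  qed
  have "row_block K \<epsilon> i = {P (i - 1)<..P (\<epsilon> i)}" if i: "i \<in> {1..r}" for i
  proof (cases "\<epsilon> i = i - 1")
    case True
    then have "K i (\<epsilon> i) = 0" using ribbon_entry[OF ribbon i jt_perms_in[OF \<epsilon> i]] by simp
    then show ?thesis using True row_block_empty_iff[of i K \<epsilon>] i by simp
  next
    case False
    then have gi: "\<epsilon> i \<ge> i" using ge[OF i] by simp
    have "{1..i - 1} \<subseteq> \<epsilon> ` {1..i - 1}"
    proof
      fix j assume j: "j \<in> {1..i - 1}"
      then have "j \<in> {1..r}" using i by auto
      then obtain k where k: "k \<in> {1..r}" "j = \<epsilon> k" using permutes_image[OF p] by blast
      have "k \<noteq> i" using gi j k by auto
      then have "k \<in> {1..i - 1}" using ge[OF k(1)] k j by auto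
      then show "j \<in> \<epsilon> ` {1..i - 1}" using k by blast
    qed
    then have "\<epsilon> ` {1..i - 1} = {1..i - 1}"
      using card_image[OF permutes_inj_on[OF p], of "{1..i - 1}"]
      by (metis card_subset_eq finite_atLeastAtMost finite_imageI)
    then have "partial_sum K \<epsilon> (i - 1) = P (i - 1)" 
      by (intro partial_sum_stable[OF \<epsilon>]) (use i in auto)
    moreover have "partial_sum K \<epsilon> i = P (\<epsilon> i)"
      using partial_sum_minus_1[of i K \<epsilon>] ribbon_entry[OF ribbon i jt_perms_in[OF \<epsilon> i]]
        jt_perms_nonneg[OF \<epsilon> i] i calculation by (simp add: nat_diff_distrib)
    ultimately show ?thesis by (simp add: row_block_def)
  qed
  then have "row_block K \<epsilon> ` {1..r} = (\<lambda>i. {P (i - 1)<..P (\<epsilon> i)}) ` {1..r}"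
    by (rule image_cong[OF refl])
  then show ?thesis by (simp only: jt_partition_def)
qed

end

text \<open>Two shapes with mutually reversed row lengths; their row blocks correspond under \<open>x \<mapsto> n + 1 - x\<close>.\<close>

locale jt_reversed_diagonal = D: jt_matrix r K a b + T: jt_matrix r K' a' b'
  for r K a b K' a' b' +
  assumes diag: "k \<in> {1..r} \<Longrightarrow> K' (r + 1 - k) (r + 1 - k) = K k k"
begin

lemma P_reversed: "m \<le> r \<Longrightarrow> T.P m + D.P (r - m) = D.P r"
proof (induction m)
  case 0 then show ?case by simp
next
  case (Suc m)
  have "r - m \<in> {1..r}" "r + 1 - (r - m) = Suc m" using Suc.prems by auto
  then have "K' (Suc m) (Suc m) = K (r - m) (r - m)" using diag[of "r - m"] by simp
  moreover have "D.P (r - m) = D.P (r - Suc m) + nat (K (r - m) (r - m))"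
    using partial_sum_minus_1[of "r - m" K id] Suc.prems by simp
  moreover have "T.P (Suc m) = T.P m + nat (K' (Suc m) (Suc m))"
    by (simp add: partial_sum_Suc)
  ultimately show ?case using Suc by (simp add: id_def)
qed

lemma reversed_interval:
  assumes "i \<le> r" "j \<le> r"
  shows "{T.P i<..T.P j} = (\<lambda>x. D.P r + 1 - x) ` {D.P (r - j)<..D.P (r - i)}"
proof -
  have "T.P i = D.P r - D.P (r - i)" "T.P j = D.P r - D.P (r - j)"
    using P_reversed[OF assms(1)] P_reversed[OF assms(2)] by auto
  moreover have "D.P (r - i) \<le> D.P r" "D.P (r - j) \<le> D.P r" by (auto intro: partial_sum_mono)
  ultimately show ?thesis by (simp only: reflect_interval)
qed

lemma reversed_block:
  assumes "k \<in> {1..r}"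
  shows "row_block K' id (r + 1 - k) = (\<lambda>x. D.P r + 1 - x) ` row_block K id k"
proof -
  have e: "r + 1 - k \<le> r" "r - (r + 1 - k) = k - 1" "r - (r - k) = k" "r + 1 - k - 1 = r - k"
    using assms by auto
  then show ?thesis using reversed_interval[of "r - k" "r + 1 - k"] by (simp only: row_block_def diff_le_self)
qed

end

locale reversed_ribbons = jt_reversed_diagonal +
  fixes \<sigma> :: "nat \<Rightarrow> nat"
  assumes ribbon: "1 \<le> i \<Longrightarrow> i < r \<Longrightarrow> K (Suc i) i = 0"
    and ribbon': "1 \<le> i \<Longrightarrow> i < r \<Longrightarrow> K' (Suc i) i = 0"
    and blocks: "k \<in> {1..r} \<Longrightarrow> \<sigma> ` row_block K id k = row_block K' id (r + 1 - k)"
begin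

text \<open>Rotating a shape by 180 degrees reflects its matrix in the antidiagonal; this is the effect on
  permutations.\<close>

definition dual :: "(nat \<Rightarrow> nat) \<Rightarrow> nat \<Rightarrow> nat" where
  "dual \<epsilon> = flip r \<circ> inv \<epsilon> \<circ> flip r"

lemma dual_permutes: "\<epsilon> permutes {1..r} \<Longrightarrow> dual \<epsilon> permutes {1..r}"
  unfolding dual_def by (intro permutes_compose flip_permutes permutes_inv)

lemma dual_dual:
  assumes "\<epsilon> permutes {1..r}"
  shows "dual (dual \<epsilon>) = \<epsilon>"
proof -
  have "inv (dual \<epsilon>) = flip r \<circ> \<epsilon> \<circ> flip r"
  proof (rule inv_unique_comp)
    show "dual \<epsilon> \<circ> (flip r \<circ> \<epsilon> \<circ> flip r) = id"
      unfolding dual_def using permutes_inverses[OF assms] by (auto simp: fun_eq_iff)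
    show "flip r \<circ> \<epsilon> \<circ> flip r \<circ> dual \<epsilon> = id"
      unfolding dual_def using permutes_inverses[OF assms] by (auto simp: fun_eq_iff)
  qed
  then show ?thesis unfolding dual_def[of "dual \<epsilon>"] by (simp add: fun_eq_iff)
qed

lemma sign_dual:
  assumes "\<epsilon> permutes {1..r}"
  shows "sign (dual \<epsilon>) = sign \<epsilon>"
proof -
  have f: "permutation (flip r)" and e: "permutation \<epsilon>" and i: "permutation (inv \<epsilon>)"
    using flip_permutes assms permutes_inv[OF assms] by (auto intro: permutes_imp_permutation)
  have "sign (dual \<epsilon>) = sign (flip r) * sign (inv \<epsilon>) * sign (flip r)"
    unfolding dual_def using f i by (simp add: sign_compose permutation_compose)
  then show ?thesis using sign_inverse[OF e] sign_idempotent[of "flip r"] by (simp add: mult.commute mult.left_commute)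
qed

lemma entry_reversed:
  assumes "i \<in> {1..r}" "j \<in> {1..r}"
  shows "K' i j = K (flip r j) (flip r i)"
proof -
  have e: "flip r j - 1 = r - j" "flip r i = r - (i - 1)" using assms by (auto simp: flip_def)
  have "T.P j + D.P (r - j) = D.P r" "T.P (i - 1) + D.P (r - (i - 1)) = D.P r"
    using P_reversed[of j] P_reversed[of "i - 1"] assms by auto
  then show ?thesis
    using T.ribbon_entry[OF ribbon' assms] D.ribbon_entry[OF ribbon flip_in[OF assms(2)] flip_in[OF assms(1)]] e
    by (simp add: e)
qed

lemma entry_dual:
  assumes \<epsilon>: "\<epsilon> permutes {1..r}" and i: "i \<in> {1..r}"
  shows "K' i (dual \<epsilon> i) = K (inv \<epsilon> (flip r i)) (\<epsilon> (inv \<epsilon> (flip r i)))"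
proof -
  have "dual \<epsilon> i \<in> {1..r}" using permutes_in_image[OF dual_permutes[OF \<epsilon>]] i by blast
  then show ?thesis
    using entry_reversed[OF i] permutes_inverses[OF \<epsilon>] by (simp add: dual_def)
qed

lemma reindex_image:
  assumes "\<epsilon> permutes {1..r}"
  shows "(\<lambda>i. inv \<epsilon> (flip r i)) ` {1..r} = {1..r}"
proof -
  have "(\<lambda>i. inv \<epsilon> (flip r i)) ` {1..r} = inv \<epsilon> ` flip r ` {1..r}" by (simp only: image_image)
  then show ?thesis by (simp only: flip_image permutes_image[OF permutes_inv[OF assms]])
qed

lemma dual_in_jt_perms:
  assumes "\<epsilon> \<in> jt_perms r K"
  shows "dual \<epsilon> \<in> jt_perms r K'"
proof -
  have p: "\<epsilon> permutes {1..r}" using assms by (simp add: jt_perms_def)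
  have "K' i (dual \<epsilon> i) \<ge> 0" if i: "i \<in> {1..r}" for i
  proof -
    have "inv \<epsilon> (flip r i) \<in> {1..r}" using reindex_image[OF p] i by blast
    then show ?thesis using entry_dual[OF p i] D.jt_perms_nonneg[OF assms] by simp
  qed
  then show ?thesis using dual_permutes[OF p] unfolding jt_perms_def by blast
qed

lemma dual_in_jt_perms':
  assumes "\<epsilon> \<in> jt_perms r K'"
  shows "dual \<epsilon> \<in> jt_perms r K"
proof -
  have p: "\<epsilon> permutes {1..r}" using assms by (simp add: jt_perms_def)
  have "K i (dual \<epsilon> i) \<ge> 0" if i: "i \<in> {1..r}" for i
  proof -
    let ?k = "inv \<epsilon> (flip r i)"
    have k: "?k \<in> {1..r}" using reindex_image[OF p] i by blast
    have "K' ?k (\<epsilon> ?k) = K (flip r (\<epsilon> ?k)) (flip r ?k)"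
      using entry_reversed[OF k] T.jt_perms_in[OF assms k] by blast
    then have "K' ?k (\<epsilon> ?k) = K i (dual \<epsilon> i)"
      using permutes_inverses[OF p] by (simp add: dual_def)
    then show ?thesis using T.jt_perms_nonneg[OF assms k] by simp
  qed
  then show ?thesis using dual_permutes[OF p] unfolding jt_perms_def by blast
qed

lemma bij_dual: "bij_betw dual (jt_perms r K) (jt_perms r K')"
  by (rule bij_betw_byWitness[where f' = dual])
     (use dual_dual dual_in_jt_perms dual_in_jt_perms' in \<open>auto simp: jt_perms_def simp del: atLeastAtMost_iff\<close>)

lemma weight_dual:
  assumes "\<epsilon> \<in> jt_perms r K"
  shows "jt_weight r K' (dual \<epsilon>) = jt_weight r K \<epsilon>"
proof -
  have p: "\<epsilon> permutes {1..r}" using assms by (simp add: jt_perms_def)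
  let ?g = "\<lambda>k. 1 / fact (nat (K k (\<epsilon> k))) :: rat"
  have "inj_on (\<lambda>i. inv \<epsilon> (flip r i)) {1..r}"
    by (rule inj_onI) (metis flip_flip permutes_inverses(1)[OF p])
  then have "prod ?g {1..r} = (\<Prod>i\<in>{1..r}. ?g (inv \<epsilon> (flip r i)))"
    using prod.reindex[of "\<lambda>i. inv \<epsilon> (flip r i)" "{1..r}" ?g] by (simp only: reindex_image[OF p] o_def)
  also have "\<dots> = (\<Prod>i\<in>{1..r}. 1 / fact (nat (K' i (dual \<epsilon> i))))"
    by (intro prod.cong refl) (simp only: entry_dual[OF p])
  finally show ?thesis by (simp add: jt_weight_def sign_dual[OF p])
qed

text \<open>Every interval \<open>{P (k - 1)<..P (\<epsilon> k)}\<close> is a union of row blocks, and on row blocks \<open>\<sigma>\<close> has the same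
  images as the reflection \<open>x \<mapsto> n + 1 - x\<close>.\<close>

lemma partition_dual:
  assumes "\<epsilon> \<in> jt_perms r K"
  shows "jt_partition r K' (dual \<epsilon>) = perm_partition \<sigma> (jt_partition r K \<epsilon>)"
proof -
  have p: "\<epsilon> permutes {1..r}" using assms by (simp add: jt_perms_def)
  let ?q = "\<lambda>i. inv \<epsilon> (flip r i)"
  let ?I = "\<lambda>k. {D.P (k - 1)<..D.P (\<epsilon> k)}"
  have im: "\<sigma> ` ?I k = (\<lambda>x. D.P r + 1 - x) ` ?I k" if k: "k \<in> {1..r}" for k
  proof -
    have k1: "1 \<le> k" using k by simp
    have "\<sigma> ` row_block K id l = (\<lambda>x. D.P r + 1 - x) ` row_block K id l" if "l \<in> {k..\<epsilon> k}" for l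
    proof -
      have "l \<in> {1..r}" using that k D.jt_perms_in[OF assms k] by auto
      then show ?thesis using blocks reversed_block by simp
    qed
    then show ?thesis
      unfolding D.interval_eq_Union_blocks[of k "\<epsilon> k", OF k1] image_UN
      by (intro SUP_cong) auto
  qed
  have step: "{T.P (i - 1)<..T.P (dual \<epsilon> i)} = \<sigma> ` ?I (?q i)" if i: "i \<in> {1..r}" for i
  proof -
    have q: "?q i \<in> {1..r}" using reindex_image[OF p] i by blast
    have d: "dual \<epsilon> i = flip r (?q i)" by (simp add: dual_def)
    have e: "r - dual \<epsilon> i = ?q i - 1" "r - (i - 1) = \<epsilon> (?q i)"
      using q i permutes_inverses[OF p] unfolding d by (auto simp: flip_def)
    have "dual \<epsilon> i \<le> r" "i - 1 \<le> r" using flip_in[OF q] i unfolding d by auto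
    then show ?thesis using reversed_interval[of "i - 1" "dual \<epsilon> i"] unfolding e im[OF q] by simp
  qed
  have "jt_partition r K' (dual \<epsilon>) = (\<lambda>i. {T.P (i - 1)<..T.P (dual \<epsilon> i)}) ` {1..r} - {{}}"
    by (rule T.ribbon_jt_partition[OF ribbon' dual_in_jt_perms[OF assms]])
  also have "(\<lambda>i. {T.P (i - 1)<..T.P (dual \<epsilon> i)}) ` {1..r} = (\<lambda>i. \<sigma> ` ?I (?q i)) ` {1..r}"
    by (rule image_cong[OF refl step])
  also have "\<dots> = (\<lambda>k. \<sigma> ` ?I k) ` ?q ` {1..r}" by (simp only: image_image)
  also have "\<dots> = (\<lambda>k. \<sigma> ` ?I k) ` {1..r}" by (simp only: reindex_image[OF p])
  also have "\<dots> - {{}} = perm_partition \<sigma> (?I ` {1..r} - {{}})"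
    unfolding perm_partition_def by blast
  also have "\<dots> = perm_partition \<sigma> (jt_partition r K \<epsilon>)"
    by (simp only: D.ribbon_jt_partition[OF ribbon assms])
  finally show ?thesis .
qed

lemma sum_dual:
  "(\<Sum>\<epsilon>\<in>jt_perms r K'. nc_scale (jt_weight r K' \<epsilon>) (h (jt_partition r K' \<epsilon>))) =
   (\<Sum>\<epsilon>\<in>jt_perms r K. nc_scale (jt_weight r K \<epsilon>) (h (perm_partition \<sigma> (jt_partition r K \<epsilon>))))"
  unfolding sum.reindex_bij_betw[OF bij_dual, symmetric]
  by (intro sum.cong refl) (simp only: weight_dual partition_dual)

end


section \<open>Skew diagrams\<close>

lemma same_array_sym: "same_array D T \<Longrightarrow> same_array T D"
proof -
  assume "same_array D T"
  then obtain a b where T: "T = (\<lambda>(i, j). (i + a, j + b)) ` D" by (auto simp: same_array_def)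
  have "D = (\<lambda>(i, j). (i + - a, j + - b)) ` T" unfolding T by (force simp: image_image)
  then show ?thesis unfolding same_array_def by blast
qed

lemma same_array_trans: "same_array D T \<Longrightarrow> same_array T U \<Longrightarrow> same_array D U"
proof -
  assume "same_array D T" "same_array T U"
  then obtain a b a' b' where "T = (\<lambda>(i, j). (i + a, j + b)) ` D" "U = (\<lambda>(i, j). (i + a', j + b')) ` T"
    by (auto simp: same_array_def)
  then have "U = (\<lambda>(i, j). (i + (a + a'), j + (b + b'))) ` D" by (force simp: image_image)
  then show ?thesis unfolding same_array_def by blast
qed

definition jt_index :: "nat list \<Rightarrow> nat list \<Rightarrow> nat \<Rightarrow> nat \<Rightarrow> int" where
  "jt_index lam mu i j = int (part lam i) - int (part mu j) - int i + int j"

lemma mem_skew_boxes: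
  "(x, y) \<in> skew_boxes lam mu \<longleftrightarrow>
    (\<exists>i\<in>{1..length lam}. x = int i \<and> int (part mu i) < y \<and> y \<le> int (part lam i))"
proof
  assume "\<exists>i\<in>{1..length lam}. x = int i \<and> int (part mu i) < y \<and> y \<le> int (part lam i)"
  then obtain i where i: "i \<in> {1..length lam}" "x = int i" "int (part mu i) < y" "y \<le> int (part lam i)" by blast
  then obtain j where "y = int j" using nonneg_int_cases[of y] by auto
  then show "(x, y) \<in> skew_boxes lam mu" unfolding skew_boxes_def using i by auto
qed (auto simp: skew_boxes_def)

lemma skew_row_eq: "i \<in> {1..length lam} \<Longrightarrow> skew_row lam mu i = {int (part mu i)<..int (part lam i)}"
  by (auto simp: skew_row_def mem_skew_boxes)

locale connected_skew =
  fixes lam mu :: "nat list" and n :: nat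
  assumes shape: "skew_shape lam mu" and connected: "skew_connected lam mu"
    and size: "skew_size lam mu = n" and n_pos: "n \<ge> 1"
begin

abbreviation r :: nat where "r \<equiv> length lam"
abbreviation K :: "nat \<Rightarrow> nat \<Rightarrow> int" where "K \<equiv> jt_index lam mu"

lemma lam_mono: "1 \<le> i \<Longrightarrow> i \<le> j \<Longrightarrow> j \<le> r \<Longrightarrow> part lam j \<le> part lam i"
  using shape sorted_wrt_nth_less[of "(\<ge>)" lam "i - 1" "j - 1"]
  by (cases "i = j") (auto simp: skew_shape_def is_partition_def part_def)

lemma mu_mono: "1 \<le> i \<Longrightarrow> i \<le> j \<Longrightarrow> part mu j \<le> part mu i"
  using shape sorted_wrt_nth_less[of "(\<ge>)" mu "i - 1" "j - 1"]
  by (cases "i = j") (auto simp: skew_shape_def is_partition_def part_def)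

lemma r_pos: "r \<ge> 1"
proof (rule ccontr)
  assume "\<not> ?thesis"
  then have "skew_boxes lam mu = {}" by (auto simp: skew_boxes_def)
  then show False using size n_pos by (simp add: skew_size_def)
qed

lemma overlap_row:
  assumes "1 \<le> i" "i < r"
  shows "skew_row lam mu i \<inter> skew_row lam mu (Suc i) = {int (part mu i)<..int (part lam (Suc i))}"
  using skew_row_eq[of i lam mu] skew_row_eq[of "Suc i" lam mu] assms
    lam_mono[of i "Suc i"] mu_mono[of i "Suc i"] by auto

lemma overlap_nonempty:
  assumes "1 \<le> i" "i < r"
  shows "part mu i < part lam (Suc i)"
  using connected assms overlap_row[OF assms] unfolding skew_connected_def by force

lemma skew_boxes_finite_card: "card (skew_boxes lam mu) = (\<Sum>i\<in>{1..r}. nat (K i i))"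
proof -
  let ?S = "Sigma {1..r} (\<lambda>i. {int (part mu i)<..int (part lam i)})"
  have "skew_boxes lam mu = (\<lambda>(i, j). (int i, j)) ` ?S"
  proof (rule set_eqI)
    fix p :: "int \<times> int"
    show "p \<in> skew_boxes lam mu \<longleftrightarrow> p \<in> (\<lambda>(i, j). (int i, j)) ` ?S"
      by (cases p) (force simp: mem_skew_boxes simp del: One_nat_def)
  qed
  moreover have "inj_on (\<lambda>(i, j). (int i, j)) ?S" by (auto simp: inj_on_def)
  ultimately have "card (skew_boxes lam mu) = card ?S" by (simp add: card_image)
  also have "\<dots> = (\<Sum>i\<in>{1..r}. nat (K i i))" by (simp add: jt_index_def)
  finally show ?thesis .
qed

lemma row_nonempty:
  assumes i: "i \<in> {1..r}"
  shows "part mu i < part lam i"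
proof (cases "i < r")
  case True
  then show ?thesis using overlap_nonempty[of i] lam_mono[of i "Suc i"] i by simp
next
  case False
  then have ir: "i = r" using i by simp
  show ?thesis
  proof (cases "r = 1")
    case True
    then show ?thesis using skew_boxes_finite_card size n_pos ir by (simp add: skew_size_def jt_index_def)
  next
    case False
    then have "1 \<le> r - 1" "r - 1 < r" "Suc (r - 1) = r" using r_pos by auto
    then show ?thesis using overlap_nonempty[of "r - 1"] mu_mono[of "r - 1" r] ir by simp
  qed
qed

sublocale jt_matrix r K "\<lambda>i. int (part lam i) - int i" "\<lambda>j. int j - int (part mu j)"
proof
  show "K i j = int (part lam i) - int i + (int j - int (part mu j))" for i j
    by (simp add: jt_index_def)
  show "int (part lam j) - int j < int (part lam i) - int i" if "1 \<le> i" "i < j" "j \<le> r" for i j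
    using lam_mono[of i j] that by simp
  show "int i - int (part mu i) < int j - int (part mu j)" if "1 \<le> i" "i < j" "j \<le> r" for i j
    using mu_mono[of i j] that by simp
  show "K i i > 0" if "i \<in> {1..r}" for i
    using row_nonempty[OF that] by (simp add: jt_index_def)
  show "K (Suc i) i \<ge> 0" if "1 \<le> i" "i < r" for i
    using overlap_nonempty[OF that] by (simp add: jt_index_def)
qed

lemma P_r: "P r = n"
  using skew_boxes_finite_card size by (simp add: partial_sum_def skew_size_def)

lemma interval_partition_row_lengths:
  "interval_partition (row_lengths lam mu) = row_block K id ` {1..r}"
proof -
  have "row_lengths lam mu = map (\<lambda>i. nat (K i (id i))) [1..<Suc r]"
    unfolding row_lengths_def
    by (rule map_cong[OF refl]) (auto simp: skew_row_eq jt_index_def simp del: upt_Suc)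
  then show ?thesis by (simp only: interval_partition_map row_block_def[abs_def] partial_sum_def)
qed

lemma card_overlap: "1 \<le> i \<Longrightarrow> i < r \<Longrightarrow> int (card (skew_row lam mu i \<inter> skew_row lam mu (Suc i))) = K (Suc i) i + 1"
  using overlap_nonempty[of i] by (simp add: overlap_row jt_index_def)

lemma ribbon_iff: "skew_ribbon lam mu \<longleftrightarrow> (\<forall>i. 1 \<le> i \<and> i < r \<longrightarrow> K (Suc i) i = 0)"
proof -
  have "card (skew_row lam mu i \<inter> skew_row lam mu (Suc i)) = 1 \<longleftrightarrow> K (Suc i) i = 0" if "1 \<le> i" "i < r" for i
    using card_overlap[OF that] by linarith
  then show ?thesis unfolding skew_ribbon_def by blast
qed

lemma jt_partitions_in: "jt_partition r K ` jt_perms r K \<subseteq> set_partitions n"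
proof (rule image_subsetI)
  fix \<epsilon> assume "\<epsilon> \<in> jt_perms r K"
  then show "jt_partition r K \<epsilon> \<in> set_partitions n"
    using jt_partition_in_set_partitions[of r K \<epsilon>] by (simp only: partial_sum_total P_r)
qed

lemma skew_schur_expansion:
  "skew_schur \<delta> lam mu = (\<Sum>\<epsilon>\<in>jt_perms r K.
    nc_scale (jt_weight r K \<epsilon>) (h_partition n (perm_partition \<delta> (jt_partition r K \<epsilon>))))"
proof -
  have "jt_entry lam mu = (\<lambda>i j. nc_scale (1 / fact (nat (K i j))) (h_single (K i j)))"
    by (simp add: fun_eq_iff jt_entry_def jt_index_def Let_def)
  then have "nc_det r (jt_entry lam mu) =
      (\<Sum>\<epsilon>\<in>jt_perms r K. nc_scale (jt_weight r K \<epsilon>) (h_partition (partial_sum K \<epsilon> r) (jt_partition r K \<epsilon>)))"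
    by (simp only: nc_det_expansion)
  also have "\<dots> = (\<Sum>\<epsilon>\<in>jt_perms r K. nc_scale (jt_weight r K \<epsilon>) (h_partition n (jt_partition r K \<epsilon>)))"
    by (intro sum.cong refl) (simp only: partial_sum_total P_r)
  finally show ?thesis
    unfolding skew_schur_def size
    by (simp only: ncsym_act_combination[OF finite_jt_perms jt_partitions_in])
qed

end

lemma mem_translate: "(x, y) \<in> (\<lambda>(i, j). (i + a, j + b)) ` D \<longleftrightarrow> (x - a, y - b) \<in> D" for a b :: int
  by force

lemma mem_rotate_array: "(x, y) \<in> rotate_array D \<longleftrightarrow> (- x, - y) \<in> D"
  unfolding rotate_array_def by force

lemma same_array_iff: "same_array D T \<longleftrightarrow> (\<exists>a b. \<forall>x y. (x, y) \<in> T \<longleftrightarrow> (x - a, y - b) \<in> D)"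
proof -
  have "T = (\<lambda>(i, j). (i + a, j + b)) ` D \<longleftrightarrow> (\<forall>x y. (x, y) \<in> T \<longleftrightarrow> (x - a, y - b) \<in> D)" for a b
    unfolding set_eq_iff split_paired_All mem_translate ..
  then show ?thesis unfolding same_array_def by blast
qed

locale skew_pair = D: connected_skew lam mu n + T: connected_skew lam' mu' n
  for lam mu lam' mu' n
begin

text \<open>The row lengths and the overlaps fix the position of each row relative to its predecessor.\<close>

lemma same_array_if_same_entries:
  assumes r: "length lam' = length lam"
    and diag: "\<And>k. k \<in> {1..length lam} \<Longrightarrow> T.K k k = D.K k k"
    and sub: "\<And>i. 1 \<le> i \<Longrightarrow> i < length lam \<Longrightarrow> T.K (Suc i) i = D.K (Suc i) i"
  shows "same_array (skew_boxes lam mu) (skew_boxes lam' mu')"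
proof -
  define c where "c = int (part mu' 1) - int (part mu 1)"
  have mu: "int (part mu' k) = int (part mu k) + c" if "1 \<le> k" "k \<le> length lam" for k
    using that
  proof (induction k rule: nat_induct_at_least)
    case base then show ?case by (simp add: c_def)
  next
    case (Suc k)
    then show ?case using sub[of k] diag[of "Suc k"] by (simp add: jt_index_def)
  qed
  have lam: "int (part lam' k) = int (part lam k) + c" if "1 \<le> k" "k \<le> length lam" for k
    using mu[OF that] diag[of k] that by (simp add: jt_index_def)
  have "(x, y) \<in> skew_boxes lam' mu' \<longleftrightarrow> (x - 0, y - c) \<in> skew_boxes lam mu" for x y
    unfolding mem_skew_boxes r by (rule bex_cong[OF refl]) (use lam mu in auto)
  then show ?thesis unfolding same_array_iff by blast
qed

lemma same_array_rotate_if_reversed_ribbon: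
  assumes r: "length lam' = length lam"
    and diag: "\<And>k. k \<in> {1..length lam} \<Longrightarrow> T.K (length lam + 1 - k) (length lam + 1 - k) = D.K k k"
    and sub: "\<And>i. 1 \<le> i \<Longrightarrow> i < length lam \<Longrightarrow> D.K (Suc i) i = 0 \<and> T.K (Suc i) i = 0"
  shows "same_array (skew_boxes lam' mu') (rotate_array (skew_boxes lam mu))"
proof -
  let ?r = "length lam"
  define s where "s = int (part mu' ?r) + int (part lam 1)"
  have lr: "int (part lam' (?r + 1 - k)) + int (part mu k) = int (part mu' (?r + 1 - k)) + int (part lam k)"
    if "1 \<le> k" "k \<le> ?r" for k
    using diag[of k] that by (simp add: jt_index_def)
  have 1: "int (part mu' (?r + 1 - k)) + int (part lam k) = s" if "1 \<le> k" "k \<le> ?r" for k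
    using that
  proof (induction k rule: nat_induct_at_least)
    case base then show ?case by (simp add: s_def)
  next
    case (Suc k)
    have "?r + 1 - k = Suc (?r - k)" "?r + 1 - Suc k = ?r - k" using Suc by auto
    moreover have "int (part lam (Suc k)) = int (part mu k) + 1"
      using sub[of k] Suc by (simp add: jt_index_def)
    moreover have "int (part lam' (Suc (?r - k))) = int (part mu' (?r - k)) + 1"
    proof -
      have "1 \<le> ?r - k" "?r - k < ?r" using Suc by auto
      then show ?thesis using sub[of "?r - k"] by (simp add: jt_index_def)
    qed
    ultimately show ?case using Suc lr[of k] by simp
  qed
  have 2: "int (part lam' (?r + 1 - k)) + int (part mu k) = s" if "1 \<le> k" "k \<le> ?r" for k
    using 1[OF that] lr[OF that] by simp
  have "(x, y) \<in> rotate_array (skew_boxes lam mu) \<longleftrightarrow>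
      (x - (- int ?r - 1), y - (- s - 1)) \<in> skew_boxes lam' mu'" for x y
  proof
    assume "(x, y) \<in> rotate_array (skew_boxes lam mu)"
    then obtain i where i: "i \<in> {1..?r}" "- x = int i" "int (part mu i) < - y" "- y \<le> int (part lam i)"
      unfolding mem_rotate_array mem_skew_boxes by blast
    show "(x - (- int ?r - 1), y - (- s - 1)) \<in> skew_boxes lam' mu'"
      unfolding mem_skew_boxes r
    proof (intro bexI[of _ "?r + 1 - i"] conjI)
      show "int (part mu' (?r + 1 - i)) < y - (- s - 1)" using 1[of i] i by simp
      show "y - (- s - 1) \<le> int (part lam' (?r + 1 - i))" using 2[of i] i by simp
    qed (use i in auto)
  next
    assume "(x - (- int ?r - 1), y - (- s - 1)) \<in> skew_boxes lam' mu'"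
    then obtain k where k: "k \<in> {1..?r}" "x - (- int ?r - 1) = int k"
      "int (part mu' k) < y - (- s - 1)" "y - (- s - 1) \<le> int (part lam' k)"
      unfolding mem_skew_boxes r by blast
    have kk: "?r + 1 - (?r + 1 - k) = k" "1 \<le> ?r + 1 - k" "?r + 1 - k \<le> ?r" using k by auto
    show "(x, y) \<in> rotate_array (skew_boxes lam mu)"
      unfolding mem_rotate_array mem_skew_boxes
    proof (intro bexI[of _ "?r + 1 - k"] conjI)
      show "int (part mu (?r + 1 - k)) < - y" using 2[OF kk(2,3)] k kk(1) by simp
      show "- y \<le> int (part lam (?r + 1 - k))" using 1[OF kk(2,3)] k kk(1) by simp
    qed (use k in auto)
  qed
  then show ?thesis unfolding same_array_iff by blast
qed

text \<open>Since no row is empty, the row indices occurring in an array determine the vertical translation,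
  and each row of one array is a reflected copy of the opposite row of the other.\<close>

lemma reversed_entries_if_same_array_rotate:
  assumes same: "same_array (skew_boxes lam' mu') (rotate_array (skew_boxes lam mu))"
  shows "length lam' = length lam"
    and "\<And>k. k \<in> {1..length lam} \<Longrightarrow> T.K (length lam + 1 - k) (length lam + 1 - k) = D.K k k"
    and "\<And>i. 1 \<le> i \<Longrightarrow> i < length lam \<Longrightarrow> T.K (Suc (length lam - i)) (length lam - i) = D.K (Suc i) i"
proof -
  let ?r = "length lam"
  obtain a b where ab: "\<And>x y. (x, y) \<in> rotate_array (skew_boxes lam mu) \<longleftrightarrow> (x - a, y - b) \<in> skew_boxes lam' mu'"
    using same unfolding same_array_iff by blast
  have boxes: "(x, y) \<in> skew_boxes lam mu \<longleftrightarrow> (- x - a, - y - b) \<in> skew_boxes lam' mu'" for x y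
    using ab[of "- x" "- y"] by (simp add: mem_rotate_array)
  have boxes': "(x, y) \<in> skew_boxes lam' mu' \<longleftrightarrow> (- x - a, - y - b) \<in> skew_boxes lam mu" for x y
    using boxes[of "- x - a" "- y - b"] by simp
  have rowD: "(\<exists>y. (x, y) \<in> skew_boxes lam mu) \<longleftrightarrow> 1 \<le> x \<and> x \<le> int ?r" for x
  proof
    assume x: "1 \<le> x \<and> x \<le> int ?r"
    then have "nat x \<in> {1..?r}" "x = int (nat x)" by auto
    then show "\<exists>y. (x, y) \<in> skew_boxes lam mu"
      unfolding mem_skew_boxes using D.row_nonempty by (meson of_nat_less_iff order_refl)
  qed (auto simp: mem_skew_boxes)
  have rowT: "(\<exists>y. (x, y) \<in> skew_boxes lam' mu') \<longleftrightarrow> 1 \<le> x \<and> x \<le> int (length lam')" for x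
  proof
    assume x: "1 \<le> x \<and> x \<le> int (length lam')"
    then have "nat x \<in> {1..length lam'}" "x = int (nat x)" by auto
    then show "\<exists>y. (x, y) \<in> skew_boxes lam' mu'"
      unfolding mem_skew_boxes using T.row_nonempty by (meson of_nat_less_iff order_refl)
  qed (auto simp: mem_skew_boxes)
  have rows: "1 \<le> x \<and> x \<le> int ?r \<longleftrightarrow> 1 \<le> - x - a \<and> - x - a \<le> int (length lam')" for x
    unfolding rowD[symmetric] rowT[symmetric]
  proof
    assume "\<exists>y. (- x - a, y) \<in> skew_boxes lam' mu'"
    then obtain y where "(- x - a, y) \<in> skew_boxes lam' mu'" ..
    then have "(x, - y - b) \<in> skew_boxes lam mu" using boxes'[of "- x - a" y] by simp
    then show "\<exists>y. (x, y) \<in> skew_boxes lam mu" ..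
  qed (use boxes in blast)
  have a: "- a = int (length lam') + 1"
    using rows[of 1] rows[of 0] D.r_pos by simp
  have "length lam' = ?r"
    using rows[of "int ?r"] rows[of "- a - 1"] T.r_pos D.r_pos a by simp
  then show r: "length lam' = length lam" .
  define \<rho> where "\<rho> y = - y - b" for y
  have inj: "inj \<rho>" by (auto simp: \<rho>_def inj_def)
  have row: "skew_row lam' mu' (?r + 1 - k) = \<rho> ` skew_row lam mu k" if "k \<in> {1..?r}" for k
  proof -
    have x: "- int (?r + 1 - k) - a = int k" using a r that by auto
    have "(int (?r + 1 - k), y) \<in> skew_boxes lam' mu' \<longleftrightarrow> y \<in> \<rho> ` {j. (int k, j) \<in> skew_boxes lam mu}" for y
    proof -
      have "y \<in> \<rho> ` {j. (int k, j) \<in> skew_boxes lam mu} \<longleftrightarrow> (int k, - y - b) \<in> skew_boxes lam mu"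
        unfolding \<rho>_def by force
      then show ?thesis using boxes'[of "int (?r + 1 - k)" y] unfolding x by simp
    qed
    then show ?thesis unfolding skew_row_def by blast
  qed
  show "T.K (?r + 1 - k) (?r + 1 - k) = D.K k k" if k: "k \<in> {1..?r}" for k
  proof -
    have k': "?r + 1 - k \<in> {1..length lam'}" using k r by auto
    have "card (skew_row lam' mu' (?r + 1 - k)) = card (skew_row lam mu k)"
      unfolding row[OF k] by (rule card_image[OF inj_on_subset[OF inj subset_UNIV]])
    then have "nat (T.K (?r + 1 - k) (?r + 1 - k)) = nat (D.K k k)"
      unfolding skew_row_eq[OF k] skew_row_eq[OF k'] jt_index_def by simp
    then show ?thesis using D.diag_pos[OF k] T.diag_pos[OF k'] by simp
  qed
  show "T.K (Suc (?r - i)) (?r - i) = D.K (Suc i) i" if i: "1 \<le> i" "i < ?r" for i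
  proof -
    have e: "?r + 1 - i = Suc (?r - i)" "?r + 1 - Suc i = ?r - i" using i by auto
    have "skew_row lam' mu' (?r - i) \<inter> skew_row lam' mu' (Suc (?r - i)) =
        \<rho> ` (skew_row lam mu i \<inter> skew_row lam mu (Suc i))"
      using row[of i] row[of "Suc i"] i unfolding e image_Int[OF inj] by (auto simp: Int_commute)
    then have "card (skew_row lam' mu' (?r - i) \<inter> skew_row lam' mu' (Suc (?r - i))) =
        card (skew_row lam mu i \<inter> skew_row lam mu (Suc i))"
      using card_image[OF inj_on_subset[OF inj subset_UNIV]] by metis
    then show ?thesis using D.card_overlap[OF i] T.card_overlap[of "?r - i"] i r by simp
  qed
qed

end

theorem mainTheorem1:
  fixes n :: nat
    and lam mu lam' mu' :: "nat list"
    and \<delta> \<tau> :: "nat \<Rightarrow> nat"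
  assumes "n \<ge> 1"
    and "skew_shape lam mu" "skew_connected lam mu" "skew_size lam mu = n"
    and "skew_shape lam' mu'" "skew_connected lam' mu'" "skew_size lam' mu' = n"
    and "\<not> same_array (skew_boxes lam mu) (skew_boxes lam' mu')"
    and "\<delta> permutes {1..n}" "\<tau> permutes {1..n}"
  shows "skew_schur \<delta> lam mu = skew_schur \<tau> lam' mu' \<longleftrightarrow>
    (skew_ribbon lam mu \<and> \<not> skew_symmetric lam mu) \<and>
    same_array (skew_boxes lam' mu') (rotate_array (skew_boxes lam mu)) \<and>
    (\<forall>B\<in>interval_partition (row_lengths lam mu). (\<lambda>j. n + 1 - inv \<tau> (\<delta> j)) ` B = B)"
proof -
  interpret D: connected_skew lam mu n by unfold_locales (use assms in auto)
  interpret T: connected_skew lam' mu' n by unfold_locales (use assms in auto)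
  interpret skew_pair lam mu lam' mu' n ..
  let ?r = "length lam"
  define \<sigma> where "\<sigma> = inv \<tau> \<circ> \<delta>"
  define \<rho> where "\<rho> x = n + 1 - x" for x
  have \<sigma>: "\<sigma> permutes {1..n}"
    unfolding \<sigma>_def by (intro permutes_compose permutes_inv assms)
  have \<tau>\<sigma>: "\<tau> \<circ> \<sigma> = \<delta>" unfolding \<sigma>_def using permutes_inverses[OF assms(10)] by (auto simp: fun_eq_iff)
  have sub_n: "row_block D.K id k \<subseteq> {1..n}" if "k \<in> {1..?r}" for k
  proof -
    have "D.P k \<le> n" using partial_sum_mono[of k ?r D.K id] that D.P_r by simp
    then show ?thesis by (auto simp: row_block_def)
  qed
  have cond3: "(\<forall>B\<in>interval_partition (row_lengths lam mu). (\<lambda>j. n + 1 - inv \<tau> (\<delta> j)) ` B = B) \<longleftrightarrow>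
      (\<forall>k\<in>{1..?r}. \<sigma> ` row_block D.K id k = \<rho> ` row_block D.K id k)"
  proof -
    have inv: "\<rho> ` \<rho> ` B = B" if "B \<subseteq> {1..n}" for B
    proof -
      have "\<rho> ` \<rho> ` B = (\<lambda>x. x) ` B"
        unfolding image_image by (rule image_cong[OF refl]) (use that in \<open>auto simp: \<rho>_def\<close>)
      then show ?thesis by simp
    qed
    have "(\<lambda>j. n + 1 - inv \<tau> (\<delta> j)) ` B = B \<longleftrightarrow> \<sigma> ` B = \<rho> ` B" if B: "B \<subseteq> {1..n}" for B
    proof -
      have e: "(\<lambda>j. n + 1 - inv \<tau> (\<delta> j)) ` B = \<rho> ` \<sigma> ` B"
        by (simp add: image_image \<rho>_def \<sigma>_def)
      have "\<sigma> ` B \<subseteq> {1..n}" using image_mono[OF B, of \<sigma>] permutes_image[OF \<sigma>] by simp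
      then show ?thesis unfolding e using inv[OF B] inv[of "\<sigma> ` B"] by metis
    qed
    from this[OF sub_n] show ?thesis
      unfolding D.interval_partition_row_lengths ball_simps(9) by (rule ball_cong[OF refl])
  qed
  show ?thesis
  proof
    assume eq: "skew_schur \<delta> lam mu = skew_schur \<tau> lam' mu'"
    have inj\<delta>: "inj (perm_partition \<delta>)" using inj_perm_partition permutes_inj[OF assms(9)] .
    have inj\<tau>: "inj (perm_partition \<tau>)" using inj_perm_partition permutes_inj[OF assms(10)] .
    interpret P: jt_pair ?r D.K "\<lambda>i. int (part lam i) - int i" "\<lambda>j. int j - int (part mu j)"
      "length lam'" T.K "\<lambda>i. int (part lam' i) - int i" "\<lambda>j. int j - int (part mu' j)" n \<sigma>
    proof (unfold_locales, rule \<sigma>, rule D.P_r, rule T.P_r)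
      fix \<pi> assume \<pi>: "\<pi> \<in> set_partitions n"
      let ?p = "\<lambda>\<epsilon>. perm_partition \<delta> (jt_partition ?r D.K \<epsilon>)"
      let ?p' = "\<lambda>\<epsilon>. perm_partition \<tau> (jt_partition (length lam') T.K \<epsilon>)"
      have "?p ` jt_perms ?r D.K \<subseteq> set_partitions n" "?p' ` jt_perms (length lam') T.K \<subseteq> set_partitions n"
        using D.jt_partitions_in T.jt_partitions_in perm_partition_in_set_partitions[OF assms(9)]
          perm_partition_in_set_partitions[OF assms(10)] by blast+
      from h_combination_unique[OF finite_jt_perms this(1) finite_jt_perms this(2)
          eq[unfolded D.skew_schur_expansion T.skew_schur_expansion]
          perm_partition_in_set_partitions[OF assms(9) \<pi>]]
      have "(\<Sum>\<epsilon>\<in>{\<epsilon>\<in>jt_perms ?r D.K. ?p \<epsilon> = perm_partition \<delta> \<pi>}. jt_weight ?r D.K \<epsilon>) =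
        (\<Sum>\<epsilon>\<in>{\<epsilon>\<in>jt_perms (length lam') T.K. ?p' \<epsilon> = perm_partition \<delta> \<pi>}. jt_weight (length lam') T.K \<epsilon>)" .
      moreover have "?p \<epsilon> = perm_partition \<delta> \<pi> \<longleftrightarrow> jt_partition ?r D.K \<epsilon> = \<pi>" for \<epsilon>
        using inj\<delta> by (simp add: inj_eq)
      moreover have "?p' \<epsilon> = perm_partition \<delta> \<pi> \<longleftrightarrow> jt_partition (length lam') T.K \<epsilon> = perm_partition \<sigma> \<pi>" for \<epsilon>
        unfolding \<tau>\<sigma>[symmetric] perm_partition_comp[symmetric] using inj\<tau> by (simp add: inj_eq)
      ultimately show "jt_coeff ?r D.K \<pi> = jt_coeff (length lam') T.K (perm_partition \<sigma> \<pi>)"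
        by (simp add: jt_coeff_def)
    qed
    have r: "length lam' = ?r" by (rule P.same_rows)
    have "\<not> ((\<forall>k\<in>{1..?r}. T.K k k = D.K k k) \<and> (\<forall>i. 1 \<le> i \<and> i < ?r \<longrightarrow> T.K (Suc i) i = D.K (Suc i) i))"
      using same_array_if_same_entries[OF r] assms(8) by blast
    then have rev: "\<forall>k\<in>{1..?r}. \<sigma> ` row_block D.K id k = row_block T.K id (?r + 1 - k)"
      and diag: "\<forall>k\<in>{1..?r}. T.K (?r + 1 - k) (?r + 1 - k) = D.K k k"
      and sub: "\<forall>i. 1 \<le> i \<and> i < ?r \<longrightarrow> D.K (Suc i) i = 0 \<and> T.K (Suc i) i = 0"
      using P.equal_or_reversed by blast+
    have ribbon: "skew_ribbon lam mu" using sub D.ribbon_iff by blast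
    have rot: "same_array (skew_boxes lam' mu') (rotate_array (skew_boxes lam mu))"
      by (rule same_array_rotate_if_reversed_ribbon[OF r]) (use diag sub in blast)+
    have "\<not> skew_symmetric lam mu"
      using rot assms(8) same_array_sym same_array_trans unfolding skew_symmetric_def by blast
    moreover interpret R: jt_reversed_diagonal ?r D.K "\<lambda>i. int (part lam i) - int i" "\<lambda>j. int j - int (part mu j)"
      T.K "\<lambda>i. int (part lam' i) - int i" "\<lambda>j. int j - int (part mu' j)"
      by (intro jt_reversed_diagonal.intro jt_reversed_diagonal_axioms.intro D.jt_matrix_axioms T.jt_matrix_axioms[unfolded r])
         (use diag in blast)
    have "\<forall>k\<in>{1..?r}. \<sigma> ` row_block D.K id k = \<rho> ` row_block D.K id k"
      using rev R.reversed_block unfolding D.P_r \<rho>_def by simp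
    ultimately show "(skew_ribbon lam mu \<and> \<not> skew_symmetric lam mu) \<and>
      same_array (skew_boxes lam' mu') (rotate_array (skew_boxes lam mu)) \<and>
      (\<forall>B\<in>interval_partition (row_lengths lam mu). (\<lambda>j. n + 1 - inv \<tau> (\<delta> j)) ` B = B)"
      using ribbon rot cond3 by blast
  next
    assume R: "(skew_ribbon lam mu \<and> \<not> skew_symmetric lam mu) \<and>
      same_array (skew_boxes lam' mu') (rotate_array (skew_boxes lam mu)) \<and>
      (\<forall>B\<in>interval_partition (row_lengths lam mu). (\<lambda>j. n + 1 - inv \<tau> (\<delta> j)) ` B = B)"
    then have rot: "same_array (skew_boxes lam' mu') (rotate_array (skew_boxes lam mu))" by blast
    note rev = reversed_entries_if_same_array_rotate[OF rot]
    note r = rev(1)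
    have sub: "D.K (Suc i) i = 0" if "1 \<le> i" "i < ?r" for i
      using R that D.ribbon_iff by blast
    have sub': "T.K (Suc i) i = 0" if "1 \<le> i" "i < ?r" for i
      using rev(3)[of "?r - i"] sub[of "?r - i"] that by simp
    interpret J: jt_reversed_diagonal ?r D.K "\<lambda>i. int (part lam i) - int i" "\<lambda>j. int j - int (part mu j)"
      T.K "\<lambda>i. int (part lam' i) - int i" "\<lambda>j. int j - int (part mu' j)"
      by (intro jt_reversed_diagonal.intro jt_reversed_diagonal_axioms.intro D.jt_matrix_axioms T.jt_matrix_axioms[unfolded r])
         (rule rev(2))
    interpret J: reversed_ribbons ?r D.K "\<lambda>i. int (part lam i) - int i" "\<lambda>j. int j - int (part mu j)"
      T.K "\<lambda>i. int (part lam' i) - int i" "\<lambda>j. int j - int (part mu' j)" \<sigma>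
    proof
      show "\<sigma> ` row_block D.K id k = row_block T.K id (?r + 1 - k)" if k: "k \<in> {1..?r}" for k
        using R cond3 J.reversed_block[OF k] k unfolding D.P_r \<rho>_def by simp
    qed (rule sub sub'; assumption)+
    have "skew_schur \<tau> lam' mu' = (\<Sum>\<epsilon>\<in>jt_perms ?r T.K. nc_scale (jt_weight ?r T.K \<epsilon>)
        (h_partition n (perm_partition \<tau> (jt_partition ?r T.K \<epsilon>))))"
      using T.skew_schur_expansion[of \<tau>] unfolding r .
    also have "\<dots> = (\<Sum>\<epsilon>\<in>jt_perms ?r D.K. nc_scale (jt_weight ?r D.K \<epsilon>)
        (h_partition n (perm_partition \<tau> (perm_partition \<sigma> (jt_partition ?r D.K \<epsilon>)))))"
      by (rule J.sum_dual)
    also have "\<dots> = skew_schur \<delta> lam mu"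
      unfolding perm_partition_comp \<tau>\<sigma> D.skew_schur_expansion ..
    finally show "skew_schur \<delta> lam mu = skew_schur \<tau> lam' mu'" ..
  qed
qed

end
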